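(* Let $\eta,\theta$ be two inner functions and let $X:\eta H^2\to K_\theta$ be a bounded linear operator. Then $X$ is a restricted Hankel operator (i.e. $X=\mathcal{H}_\psi$ for some $\psi\in L^\infty$) if and only if there is some $\phi\in L^\infty$ such that $$X\mathcal{S}_{(\eta)}-S_\theta^*X=S^*(\theta)\otimes P(\breve\theta\,\overline{z\eta\phi}),$$ where the right-hand side is understood through the identification $\eta f\leftrightarrow f$ of $\eta H^2$ with $H^2$, that is, $$X\mathcal{S}_{(\eta)}(\eta f)-S_\theta^*X(\eta f)=\langle f,P(\breve\theta\,\overline{z\eta\phi})\rangle\,S^*(\theta)\qquad\text{for all } f\in H^2 .$$
   Context: $H^2$ is the Hardy space, viewed as a closed subspace of $L^2=L^2(\mathbb{T})$ (normalized Lebesgue measure); $P:L^2\to H^2$ is the orthogonal projection; $L^\infty=L^\infty(\mathbb{T})$. For an inner function $\theta$, $K_\theta=H^2\ominus\theta H^2$ is the model space and $P_\theta:L^2\to K_\theta$ the orthogonal projection. $S$ is the shift $Sf=zf$ on $H^2$, $S^*$ its adjoint; $S_\theta=P_\theta S|_{K_\theta}$; $\mathcal{S}_{(\eta)}=P_{\eta H^2}S|_{\eta H^2}$, i.e. multiplication by $z$ on $\eta H^2$. The flip operator $\mathcal{J}:L^2\to L^2$ is $(\mathcal{J}f)(\xi)=\bar\xi f(\bar\xi)$, $\xi\in\mathbb{T}$; and $\breve f(\xi)=f(\bar\xi)$. For $\phi\in L^\infty$ and inner functions $\eta,\theta$, the restricted Hankel operator is $\mathcal{H}_\phi:\eta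 H^2\to K_\theta$, $\mathcal{H}_\phi(h)=P_\theta\mathcal{J}(\phi h)$. For vectors $u,v$, $(u\otimes v)(x)=\langle x,v\rangle u$. *)

theory Defs
  imports "HOL-Analysis.Analysis"
begin

section \<open>The space \<open>L\<^sup>2\<close> of the unit circle\<close>

text \<open>
  Normalized Lebesgue measure of the unit circle is carried by the type of all complex numbers:
  it is the image of the uniform probability measure on \<open>[-\<pi>, \<pi>]\<close> under \<open>t \<mapsto> exp (i t)\<close>.
  Every statement that holds almost everywhere with respect to it only concerns points of the circle.
\<close>

definition circle :: "complex measure" where
  "circle = distr (uniform_measure lborel {-pi..pi}) borel cis"

lemma sets_circle [simp, measurable_cong]: "sets circle = sets borel"
  by (simp add: circle_def)

lemma space_circle [simp]: "space circle = UNIV"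
  by (simp add: circle_def)

lemma borel_measurable_circle [simp]: "borel_measurable circle = borel_measurable borel"
  by (rule measurable_cong_sets) simp_all

lemma cis_measurable [measurable]: "cis \<in> borel_measurable borel"
  by (intro borel_measurable_continuous_onI continuous_intros)

lemma emeasure_circle_UNIV: "emeasure circle UNIV = 1"
  by (simp add: circle_def emeasure_distr ennreal_divide_self)

lemma finite_measure_circle: "finite_measure circle"
  by (intro finite_measureI) (simp add: emeasure_circle_UNIV)

lemma AE_circle_norm: "AE \<xi> in circle. cmod \<xi> = 1"
  unfolding circle_def by (subst AE_distr_iff) auto

lemma distr_circle_cnj: "distr circle borel cnj = circle"
proof -
  let ?U = "uniform_measure lborel {-pi..pi} :: real measure"
  have cnj_m: "cnj \<in> borel_measurable borel"
    by (intro borel_measurable_continuous_onI continuous_intros)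
  have U: "distr ?U borel uminus = ?U"
  proof (rule measure_eqI)
    fix A :: "real set" assume "A \<in> sets (distr ?U borel uminus)"
    then have A [measurable]: "A \<in> sets borel" by simp
    have B: "uminus -` A \<in> sets borel"
      using measurable_sets[of uminus borel borel A] by simp
    have "emeasure lborel ({-pi..pi} \<inter> A) = emeasure (distr lborel borel uminus) ({-pi..pi} \<inter> A)"
      by (simp add: lborel_distr_uminus)
    also have "\<dots> = emeasure lborel (uminus -` ({-pi..pi} \<inter> A))"
      by (subst emeasure_distr) auto
    also have "uminus -` ({-pi..pi} \<inter> A) = {-pi..pi} \<inter> uminus -` A"
      by auto
    finally show "emeasure (distr ?U borel uminus) A = emeasure ?U A"
      using B by (simp add: emeasure_distr)
  qed simp
  have "distr circle borel cnj = distr ?U borel (cnj \<circ> cis)"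
    unfolding circle_def using cnj_m by (subst distr_distr) auto
  also have "cnj \<circ> cis = cis \<circ> uminus"
    by (auto simp: cis_cnj)
  also have "distr ?U borel (cis \<circ> uminus) = distr (distr ?U borel uminus) borel cis"
    by (subst distr_distr) auto
  finally show ?thesis
    by (simp only: U circle_def)
qed

definition square_integrable :: "(complex \<Rightarrow> complex) \<Rightarrow> bool" where
  "square_integrable f \<longleftrightarrow>
     f \<in> borel_measurable circle \<and> integrable circle (\<lambda>\<xi>. (cmod (f \<xi>))\<^sup>2)"

lemma square_integrable_measurable: "square_integrable f \<Longrightarrow> f \<in> borel_measurable borel"
  by (simp add: square_integrable_def)

lemma square_integrable_scale: "square_integrable f \<Longrightarrow> square_integrable (\<lambda>\<xi>. c * f \<xi>)"
  by (auto simp: square_integrable_def norm_mult power_mult_distrib)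

lemma square_integrable_bound:
  assumes "square_integrable f" "g \<in> borel_measurable borel"
    "AE \<xi> in circle. cmod (g \<xi>) \<le> C * cmod (f \<xi>)"
  shows "square_integrable g"
proof -
  have "integrable circle (\<lambda>\<xi>. C\<^sup>2 * (cmod (f \<xi>))\<^sup>2)"
    using assms(1) by (auto simp: square_integrable_def)
  then have "integrable circle (\<lambda>\<xi>. (cmod (g \<xi>))\<^sup>2)"
  proof (rule Bochner_Integration.integrable_bound)
    show "AE \<xi> in circle. norm ((cmod (g \<xi>))\<^sup>2) \<le> norm (C\<^sup>2 * (cmod (f \<xi>))\<^sup>2)"
      using assms(3)
    proof eventually_elim
      case (elim \<xi>)
      then have "(cmod (g \<xi>))\<^sup>2 \<le> (C * cmod (f \<xi>))\<^sup>2"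
        by (intro power_mono) auto
      then show ?case by (simp add: power_mult_distrib)
    qed
  qed (use assms(2) in measurable)
  with assms(2) show ?thesis by (simp add: square_integrable_def)
qed

lemma square_integrable_add:
  assumes f: "square_integrable f" and g: "square_integrable g"
  shows "square_integrable (\<lambda>\<xi>. f \<xi> + g \<xi>)"
proof -
  note [measurable] = f[THEN square_integrable_measurable] g[THEN square_integrable_measurable]
  have "integrable circle (\<lambda>\<xi>. 2 * (cmod (f \<xi>))\<^sup>2 + 2 * (cmod (g \<xi>))\<^sup>2)"
    using f g by (auto simp: square_integrable_def)
  then have "integrable circle (\<lambda>\<xi>. (cmod (f \<xi> + g \<xi>))\<^sup>2)"
  proof (rule Bochner_Integration.integrable_bound)
    have "(cmod (a + b))\<^sup>2 \<le> 2 * (cmod a)\<^sup>2 + 2 * (cmod b)\<^sup>2" for a b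
    proof -
      have "(cmod (a + b))\<^sup>2 \<le> (cmod a + cmod b)\<^sup>2"
        by (intro power_mono norm_triangle_ineq) auto
      also have "\<dots> \<le> 2 * (cmod a)\<^sup>2 + 2 * (cmod b)\<^sup>2"
        using sum_squares_bound[of "cmod a" "cmod b"] by (simp add: power2_sum)
      finally show ?thesis .
    qed
    then show "AE \<xi> in circle. norm ((cmod (f \<xi> + g \<xi>))\<^sup>2)
        \<le> norm (2 * (cmod (f \<xi>))\<^sup>2 + 2 * (cmod (g \<xi>))\<^sup>2)"
      by auto
  qed measurable
  then show ?thesis by (simp add: square_integrable_def)
qed

lemma integrable_mult_cnj:
  assumes f: "square_integrable f" and g: "square_integrable g"
  shows "integrable circle (\<lambda>\<xi>. f \<xi> * cnj (g \<xi>))"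
proof -
  note [measurable] = f[THEN square_integrable_measurable] g[THEN square_integrable_measurable]
  have [measurable]: "cnj \<in> borel_measurable borel"
    by (intro borel_measurable_continuous_onI continuous_intros)
  have "integrable circle (\<lambda>\<xi>. (cmod (f \<xi>))\<^sup>2 + (cmod (g \<xi>))\<^sup>2)"
    using f g by (auto simp: square_integrable_def)
  then show ?thesis
  proof (rule Bochner_Integration.integrable_bound)
    have "cmod (a * cnj b) \<le> (cmod a)\<^sup>2 + (cmod b)\<^sup>2" for a b
    proof -
      have "2 * (cmod a * cmod b) \<le> (cmod a)\<^sup>2 + (cmod b)\<^sup>2"
        using sum_squares_bound[of "cmod a" "cmod b"] by simp
      moreover have "0 \<le> cmod a * cmod b" by simp
      ultimately show ?thesis unfolding norm_mult complex_mod_cnj by linarith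
    qed
    then show "AE \<xi> in circle. norm (f \<xi> * cnj (g \<xi>)) \<le> norm ((cmod (f \<xi>))\<^sup>2 + (cmod (g \<xi>))\<^sup>2)"
      by (simp add: norm_mult)
  qed measurable
qed

definition L2_eq :: "(complex \<Rightarrow> complex) \<Rightarrow> (complex \<Rightarrow> complex) \<Rightarrow> bool" where
  "L2_eq f g \<longleftrightarrow> square_integrable f \<and> square_integrable g \<and> (AE \<xi> in circle. f \<xi> = g \<xi>)"

quotient_type L2 = "complex \<Rightarrow> complex" / partial: L2_eq
  morphisms rep_L2 L2_of
proof (rule part_equivpI)
  show "\<exists>f. L2_eq f f"
    by (rule exI[of _ "\<lambda>_. 0"]) (simp add: L2_eq_def square_integrable_def)
  show "symp L2_eq"
    by (rule sympI) (auto simp: L2_eq_def eq_commute)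
  show "transp L2_eq"
    by (rule transpI) (auto simp: L2_eq_def)
qed

text \<open>The inner product is linear in its first argument.\<close>

lift_definition cinner :: "L2 \<Rightarrow> L2 \<Rightarrow> complex" is
  "\<lambda>f g. \<integral>\<xi>. f \<xi> * cnj (g \<xi>) \<partial>circle"
proof -
  fix f f' g g' assume *: "L2_eq f f'" "L2_eq g g'"
  have "(\<lambda>\<xi>. f \<xi> * cnj (g \<xi>)) \<in> borel_measurable circle"
    "(\<lambda>\<xi>. f' \<xi> * cnj (g' \<xi>)) \<in> borel_measurable circle"
    using * by (auto simp only: L2_eq_def intro!: borel_measurable_integrable integrable_mult_cnj)
  moreover have "AE \<xi> in circle. f \<xi> * cnj (g \<xi>) = f' \<xi> * cnj (g' \<xi>)"
    using * by (auto simp: L2_eq_def)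
  ultimately show "(\<integral>\<xi>. f \<xi> * cnj (g \<xi>) \<partial>circle) = (\<integral>\<xi>. f' \<xi> * cnj (g' \<xi>) \<partial>circle)"
    by (rule integral_cong_AE)
qed

instantiation L2 :: real_inner
begin

lift_definition zero_L2 :: L2 is "\<lambda>_. 0"
  by (simp add: L2_eq_def square_integrable_def)

lift_definition plus_L2 :: "L2 \<Rightarrow> L2 \<Rightarrow> L2" is "\<lambda>f g \<xi>. f \<xi> + g \<xi>"
  by (auto simp: L2_eq_def square_integrable_add)

lift_definition uminus_L2 :: "L2 \<Rightarrow> L2" is "\<lambda>f \<xi>. - f \<xi>"
  by (auto simp: L2_eq_def square_integrable_def)

definition minus_L2 :: "L2 \<Rightarrow> L2 \<Rightarrow> L2" where
  "minus_L2 f g = f + (- g)"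

lift_definition scaleR_L2 :: "real \<Rightarrow> L2 \<Rightarrow> L2" is "\<lambda>r f \<xi>. complex_of_real r * f \<xi>"
  by (auto simp: L2_eq_def square_integrable_scale)

definition inner_L2 :: "L2 \<Rightarrow> L2 \<Rightarrow> real" where
  "inner_L2 f g = Re (cinner f g)"

definition norm_L2 :: "L2 \<Rightarrow> real" where "norm_L2 f = sqrt (inner f f)"
definition dist_L2 :: "L2 \<Rightarrow> L2 \<Rightarrow> real" where "dist_L2 f g = norm (f - g)"
definition sgn_L2 :: "L2 \<Rightarrow> L2" where "sgn_L2 f = inverse (norm f) *\<^sub>R f"
definition uniformity_L2 :: "(L2 \<times> L2) filter" where
  "uniformity_L2 = (INF e\<in>{0<..}. principal {(f, g). dist f g < e})"
definition open_L2 :: "L2 set \<Rightarrow> bool" where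
  "open_L2 U \<longleftrightarrow> (\<forall>f\<in>U. \<forall>\<^sub>F (f', g) in uniformity. f' = f \<longrightarrow> g \<in> U)"

instance
proof
  fix f g h :: L2 and r s :: real
  show "f + g + h = f + (g + h)"
    by transfer (auto simp: L2_eq_def square_integrable_add add.assoc)
  show "f + g = g + f"
    by transfer (auto simp: L2_eq_def square_integrable_add add.commute)
  show "0 + f = f"
    by transfer (auto simp: L2_eq_def)
  show "- f + f = 0"
    by transfer (auto simp: L2_eq_def square_integrable_def)
  show "f - g = f + - g"
    by (simp add: minus_L2_def)
  show "r *\<^sub>R (f + g) = r *\<^sub>R f + r *\<^sub>R g"
    by transfer (auto simp: L2_eq_def square_integrable_add square_integrable_scale distrib_left)
  show "(r + s) *\<^sub>R f = r *\<^sub>R f + s *\<^sub>R f"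
    by transfer
      (auto simp: L2_eq_def square_integrable_add square_integrable_scale distrib_right
        simp flip: distrib_right of_real_add)
  show "r *\<^sub>R s *\<^sub>R f = (r * s) *\<^sub>R f"
    by transfer (auto simp: L2_eq_def square_integrable_scale mult.assoc
        simp flip: mult.assoc of_real_mult)
  show "1 *\<^sub>R f = f"
    by transfer (auto simp: L2_eq_def)
  show "dist f g = norm (f - g)"
    by (simp add: dist_L2_def)
  show "sgn f = inverse (norm f) *\<^sub>R f"
    by (simp add: sgn_L2_def)
  show "uniformity = (INF e\<in>{0<..}. principal {(f :: L2, g). dist f g < e})"
    by (simp add: uniformity_L2_def)
  show "open U \<longleftrightarrow> (\<forall>f\<in>U. \<forall>\<^sub>F (f', g) in uniformity. f' = f \<longrightarrow> g \<in> U)" for U :: "L2 set"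
    by (simp add: open_L2_def)
  show "inner f g = inner g f"
    unfolding inner_L2_def
  proof transfer
    fix f g
    have "(\<integral>\<xi>. f \<xi> * cnj (g \<xi>) \<partial>circle) = (\<integral>\<xi>. cnj (g \<xi> * cnj (f \<xi>)) \<partial>circle)"
      by (simp add: mult.commute)
    also have "\<dots> = cnj (\<integral>\<xi>. g \<xi> * cnj (f \<xi>) \<partial>circle)"
      by (rule Bochner_Integration.integral_cnj)
    finally show "Re (\<integral>\<xi>. f \<xi> * cnj (g \<xi>) \<partial>circle) = Re (\<integral>\<xi>. g \<xi> * cnj (f \<xi>) \<partial>circle)"
      by simp
  qed
  show "inner (f + g) h = inner f h + inner g h"
    unfolding inner_L2_def by transfer (simp add: L2_eq_def distrib_right integrable_mult_cnj)
  show "inner (r *\<^sub>R f) g = r * inner f g"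
    unfolding inner_L2_def by transfer (simp add: L2_eq_def mult.assoc)
  have sq: "Re (\<integral>\<xi>. f \<xi> * cnj (f \<xi>) \<partial>circle) = (\<integral>\<xi>. (cmod (f \<xi>))\<^sup>2 \<partial>circle)" for f
    by (simp only: complex_norm_square[symmetric] integral_complex_of_real Re_complex_of_real)
  show "0 \<le> inner f f"
    unfolding inner_L2_def by transfer (simp only: sq, simp)
  show "inner f f = 0 \<longleftrightarrow> f = 0"
    unfolding inner_L2_def
  proof transfer
    fix f assume "L2_eq f f"
    then have f: "square_integrable f" by (simp add: L2_eq_def)
    then have "(\<integral>\<xi>. (cmod (f \<xi>))\<^sup>2 \<partial>circle) = 0 \<longleftrightarrow> (AE \<xi> in circle. (cmod (f \<xi>))\<^sup>2 = 0)"
      by (intro integral_nonneg_eq_0_iff_AE) (auto simp: square_integrable_def)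
    with f show "Re (\<integral>\<xi>. f \<xi> * cnj (f \<xi>) \<partial>circle) = 0 \<longleftrightarrow> L2_eq f (\<lambda>_. 0)"
      unfolding sq by (simp add: L2_eq_def) (simp add: square_integrable_def)
  qed
  show "norm f = sqrt (inner f f)"
    by (simp add: norm_L2_def)
qed

end

lift_definition scaleC :: "complex \<Rightarrow> L2 \<Rightarrow> L2" (infixr \<open>*\<^sub>C\<close> 75) is "\<lambda>c f \<xi>. c * f \<xi>"
  by (auto simp: L2_eq_def square_integrable_scale)

definition Linfty :: "(complex \<Rightarrow> complex) set" where
  "Linfty = {\<phi>. \<phi> \<in> borel_measurable circle \<and> (\<exists>C. AE \<xi> in circle. cmod (\<phi> \<xi>) \<le> C)}"

text \<open>
  Symbols are functions, vectors are classes of functions. The product of a symbol with a vector is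
  meaningful for symbols in \<^const>\<open>Linfty\<close>; the chosen representative is irrelevant, as shown next.
\<close>

definition mult_L2 :: "(complex \<Rightarrow> complex) \<Rightarrow> L2 \<Rightarrow> L2" where
  "mult_L2 \<phi> f = L2_of (\<lambda>\<xi>. \<phi> \<xi> * rep_L2 f \<xi>)"

lemma L2_of_eqI:
  "square_integrable f \<Longrightarrow> square_integrable g \<Longrightarrow> AE \<xi> in circle. f \<xi> = g \<xi> \<Longrightarrow> L2_of f = L2_of g"
  by (rule Quotient3_rel_abs[OF Quotient3_L2]) (simp add: L2_eq_def)

lemma rep_L2_of:
  assumes "square_integrable f"
  shows "square_integrable (rep_L2 (L2_of f))" "AE \<xi> in circle. rep_L2 (L2_of f) \<xi> = f \<xi>"
  using Quotient3_rep_abs[OF Quotient3_L2, of f] assms by (auto simp: L2_eq_def)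

lemma square_integrable_mult:
  assumes "\<phi> \<in> Linfty" "square_integrable f"
  shows "square_integrable (\<lambda>\<xi>. \<phi> \<xi> * f \<xi>)"
proof -
  obtain C where C: "AE \<xi> in circle. cmod (\<phi> \<xi>) \<le> C"
    using assms(1) by (auto simp: Linfty_def)
  have m: "(\<lambda>\<xi>. \<phi> \<xi> * f \<xi>) \<in> borel_measurable borel"
    using assms by (auto simp: Linfty_def square_integrable_def)
  have "AE \<xi> in circle. cmod (\<phi> \<xi> * f \<xi>) \<le> C * cmod (f \<xi>)"
    using C by eventually_elim (simp add: norm_mult mult_right_mono)
  then show ?thesis by (rule square_integrable_bound[OF assms(2) m])
qed

lemma square_integrable_Linfty:
  assumes "\<phi> \<in> Linfty"
  shows "square_integrable \<phi>"
proof -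
  have "square_integrable (\<lambda>_. 1)"
    using finite_measure.integrable_const[OF finite_measure_circle]
    by (simp add: square_integrable_def)
  from square_integrable_mult[OF assms this] show ?thesis by simp
qed

lemma mult_L2_of:
  assumes "\<phi> \<in> Linfty" "square_integrable f"
  shows "mult_L2 \<phi> (L2_of f) = L2_of (\<lambda>\<xi>. \<phi> \<xi> * f \<xi>)"
  unfolding mult_L2_def
  using rep_L2_of[OF assms(2)] by (intro L2_of_eqI) (auto intro: square_integrable_mult assms)

lift_definition flip :: "L2 \<Rightarrow> L2" is "\<lambda>f \<xi>. cnj \<xi> * f (cnj \<xi>)"
proof -
  fix f g assume fg: "L2_eq f g"
  have cnj_m [measurable]: "cnj \<in> borel_measurable borel"
    by (intro borel_measurable_continuous_onI continuous_intros)
  have AE_cnj: "AE \<xi> in circle. P (cnj \<xi>)" if "AE \<xi> in circle. P \<xi>" for P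
    using that cnj_m AE_distrD[of cnj circle borel P] unfolding distr_circle_cnj by simp
  have sq: "square_integrable (\<lambda>\<xi>. cnj \<xi> * h (cnj \<xi>))" if h: "square_integrable h" for h
  proof -
    note [measurable] = square_integrable_measurable[OF h]
    have "integrable (distr circle borel cnj) (\<lambda>\<xi>. (cmod (h \<xi>))\<^sup>2)"
      using h by (simp add: distr_circle_cnj square_integrable_def)
    then have "square_integrable (\<lambda>\<xi>. h (cnj \<xi>))"
      by (simp add: integrable_distr_eq square_integrable_def)
    moreover have "AE \<xi> in circle. cmod (cnj \<xi> * h (cnj \<xi>)) \<le> 1 * cmod (h (cnj \<xi>))"
      using AE_circle_norm by eventually_elim (simp add: norm_mult)
    moreover have "(\<lambda>\<xi>. cnj \<xi> * h (cnj \<xi>)) \<in> borel_measurable borel"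
      by measurable
    ultimately show ?thesis
      using square_integrable_bound by blast
  qed
  have "AE \<xi> in circle. f (cnj \<xi>) = g (cnj \<xi>)"
    using fg AE_cnj[of "\<lambda>\<xi>. f \<xi> = g \<xi>"] by (simp add: L2_eq_def)
  with fg sq show "L2_eq (\<lambda>\<xi>. cnj \<xi> * f (cnj \<xi>)) (\<lambda>\<xi>. cnj \<xi> * g (cnj \<xi>))"
    by (auto simp: L2_eq_def)
qed

section \<open>Operators between subspaces of \<open>L\<^sup>2\<close>\<close>

text \<open>
  An operator with domain a subspace is a function on the whole type of which only the values on
  that subspace matter.
\<close>

definition bounded_operator :: "L2 set \<Rightarrow> L2 set \<Rightarrow> (L2 \<Rightarrow> L2) \<Rightarrow> bool" where
  "bounded_operator M N T \<longleftrightarrow>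
     (\<forall>f\<in>M. T f \<in> N) \<and>
     (\<forall>f\<in>M. \<forall>g\<in>M. T (f + g) = T f + T g) \<and>
     (\<forall>c. \<forall>f\<in>M. T (c *\<^sub>C f) = c *\<^sub>C T f) \<and>
     (\<exists>C. \<forall>f\<in>M. norm (T f) \<le> C * norm f)"

text \<open>
  The two descriptions below determine a vector when \<open>M\<close> is a closed subspace and, for the adjoint,
  \<open>T\<close> is a bounded operator on \<open>M\<close>; the adjoint then maps back into \<open>M\<close>.
\<close>

definition proj :: "L2 set \<Rightarrow> L2 \<Rightarrow> L2" where
  "proj M f = (THE g. g \<in> M \<and> (\<forall>h\<in>M. cinner (f - g) h = 0))"

definition adjoint_on :: "L2 set \<Rightarrow> (L2 \<Rightarrow> L2) \<Rightarrow> L2 \<Rightarrow> L2" where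
  "adjoint_on M T g = (THE h. h \<in> M \<and> (\<forall>f\<in>M. cinner (T f) g = cinner f h))"

section \<open>Hardy space, inner functions, model spaces\<close>

definition fourier_coeff :: "L2 \<Rightarrow> int \<Rightarrow> complex" where
  "fourier_coeff f n = cinner f (L2_of (\<lambda>\<xi>. \<xi> powi n))"

definition H2 :: "L2 set" where
  "H2 = {f. \<forall>n<0. fourier_coeff f n = 0}"

text \<open>Inner functions are given by their boundary values.\<close>

definition inner_function :: "(complex \<Rightarrow> complex) \<Rightarrow> bool" where
  "inner_function \<theta> \<longleftrightarrow>
     \<theta> \<in> borel_measurable circle \<and> (AE \<xi> in circle. cmod (\<theta> \<xi>) = 1) \<and> L2_of \<theta> \<in> H2"

definition mult_H2 :: "(complex \<Rightarrow> complex) \<Rightarrow> L2 set" where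
  "mult_H2 \<eta> = mult_L2 \<eta> ` H2"

definition model_space :: "(complex \<Rightarrow> complex) \<Rightarrow> L2 set" where
  "model_space \<theta> = {f \<in> H2. \<forall>g\<in>mult_H2 \<theta>. cinner f g = 0}"

definition shift :: "L2 \<Rightarrow> L2" where
  "shift f = mult_L2 (\<lambda>\<xi>. \<xi>) f"

definition backward_shift :: "L2 \<Rightarrow> L2" where
  "backward_shift = adjoint_on H2 shift"

definition compressed_shift :: "(complex \<Rightarrow> complex) \<Rightarrow> L2 \<Rightarrow> L2" where
  "compressed_shift \<theta> f = proj (model_space \<theta>) (shift f)"

definition restricted_shift :: "(complex \<Rightarrow> complex) \<Rightarrow> L2 \<Rightarrow> L2" where
  "restricted_shift \<eta> f = proj (mult_H2 \<eta>) (shift f)"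

definition restricted_hankel :: "(complex \<Rightarrow> complex) \<Rightarrow> (complex \<Rightarrow> complex) \<Rightarrow> L2 \<Rightarrow> L2" where
  "restricted_hankel \<theta> \<phi> h = proj (model_space \<theta>) (flip (mult_L2 \<phi> h))"

definition is_restricted_hankel ::
    "(complex \<Rightarrow> complex) \<Rightarrow> (complex \<Rightarrow> complex) \<Rightarrow> (L2 \<Rightarrow> L2) \<Rightarrow> bool" where
  "is_restricted_hankel \<eta> \<theta> X \<longleftrightarrow>
     (\<exists>\<psi>\<in>Linfty. \<forall>h\<in>mult_H2 \<eta>. X h = restricted_hankel \<theta> \<psi> h)"

definition reflect :: "(complex \<Rightarrow> complex) \<Rightarrow> complex \<Rightarrow> complex" where
  "reflect f \<xi> = f (cnj \<xi>)"

definition rank_one :: "L2 \<Rightarrow> L2 \<Rightarrow> L2 \<Rightarrow> L2" where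
  "rank_one u v f = cinner f v *\<^sub>C u"

end

theory Submission
  imports Defs "HOL-Complex_Analysis.Complex_Analysis"
    "HOL-Computational_Algebra.Fundamental_Theorem_Algebra"
begin

text \<open>
  For \<open>h\<close> in the model space, \<open>zh - \<langle>zh, \<theta>\<rangle>\<theta>\<close> is again in the model space. Testing against such \<open>h\<close>
  shows that every restricted Hankel operator satisfies the commutator identity with \<open>\<phi>\<close> its own
  symbol. Conversely, if \<open>X\<close> satisfies the identity for \<open>\<phi>\<close>, the difference of \<open>X\<close> and the restricted
  Hankel operator with symbol \<open>\<phi>\<close>, precomposed with multiplication by \<open>\<eta>\<close>, is an operator \<open>A\<close> on
  \<open>H\<^sup>2\<close> that intertwines the shift with its adjoint. By Nehari's theorem \<open>A\<close> has a bounded symbol \<open>\<psi>\<close>,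
  and then \<open>X\<close> has the symbol \<open>\<phi> + \<psi> cnj \<eta>\<close>.

  Nehari's theorem is proved by duality. An analytic polynomial is a product \<open>fg\<close> with
  \<open>\<bar>f\<bar> = \<kappa> \<bar>g\<bar>\<close> on the circle, so the functional \<open>f \<mapsto> \<langle>A f, 1\<rangle>\<close> is bounded on \<open>H\<^sup>2\<close> in the \<open>L\<^sup>1\<close>
  norm. The Hahn--Banach theorem extends its real part to \<open>L\<^sup>2\<close> with the same \<open>L\<^sup>1\<close> bound, and the
  vector representing the extension is a bounded function.
\<close>

section \<open>The Hahn--Banach theorem\<close>

text \<open>The identity fixes X only up to an operator A with A S = S^* A, so the given \<phi> need
  not be a symbol of X, and a bounded symbol for A has to be produced. The obstacle is a mismatch of
  norms: A is bounded for the L2 norm, while a bounded symbol amounts to a bound of <A f, 1> by the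
  L1 norm of f. Products bridge the gap: <A(fg), 1> is bounded by the product of the two L2 norms,
  and when |f| and |g| are proportional, Cauchy-Schwarz is an equality and that product is the L1
  norm of fg. Factoring polynomials is enough by density and stays explicit: finitely many Blaschke
  factors and square roots of linear factors, no inner-outer factorization.

  Extending inside L2, with the L1 norm only as a gauge, keeps the functional L2-continuous, so an
  L2 vector represents it and the dual of L1 never enters; that the vector is bounded is read off by
  testing on the set where it is large. The real Hahn-Banach theorem suffices because H2 is closed
  under multiplication by i, which recovers the imaginary part. Completeness of L2 is needed twice:
  for this representation and for every projection in the statement to exist.\<close>

definition sublinear :: "('a::real_vector \<Rightarrow> real) \<Rightarrow> bool" where
  "sublinear q \<longleftrightarrow> (\<forall>x y. q (x + y) \<le> q x + q y) \<and> (\<forall>t\<ge>0. \<forall>x. q (t *\<^sub>R x) = t * q x)"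

lemma sublinearD:
  assumes "sublinear q"
  shows "q (x + y) \<le> q x + q y" "t \<ge> 0 \<Longrightarrow> q (t *\<^sub>R x) = t * q x" "q 0 = 0" "- q (- x) \<le> q x"
proof -
  show *: "q (x + y) \<le> q x + q y" for x y
    using assms by (simp add: sublinear_def)
  show "t \<ge> 0 \<Longrightarrow> q (t *\<^sub>R x) = t * q x"
    using assms by (simp add: sublinear_def)
  have "q (0 *\<^sub>R 0) = 0 * q 0"
    using assms unfolding sublinear_def by blast
  then show "q 0 = 0" by simp
  with *[of x "- x"] show "- q (- x) \<le> q x" by simp
qed

lemma sublinearI:
  assumes add: "\<And>x y. q (x + y) \<le> q x + q y"
    and scale: "\<And>t x. t > 0 \<Longrightarrow> q (t *\<^sub>R x) \<le> t * q x"
    and zero: "q 0 = 0"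
  shows "sublinear q"
proof -
  have "q (t *\<^sub>R x) = t * q x" if "t \<ge> 0" for t x
  proof (cases "t = 0")
    case False
    with that have t: "t > 0" by simp
    have "q ((1 / t) *\<^sub>R (t *\<^sub>R x)) \<le> (1 / t) * q (t *\<^sub>R x)"
      using t by (intro scale) simp
    then have "t * q x \<le> q (t *\<^sub>R x)"
      using t by (simp add: field_simps)
    with scale[OF t, of x] show ?thesis by simp
  qed (simp add: zero)
  with add show ?thesis by (simp add: sublinear_def)
qed

text \<open>\<open>K\<close> is a cone of constraints "at most \<open>c\<close> at
  \<open>m\<close>". The witness is the infimal convolution of \<open>q\<close> with these
  constraints, the largest sublinear functional below \<open>q\<close> that obeys them;
  \<open>low\<close> is what keeps the infimum finite. It serves twice: to make a minimal functional
  odd, and to impose prescribed values on a subspace.\<close>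

lemma sublinear_relax:
  assumes q: "sublinear q" and zero: "(0, 0) \<in> K"
    and add: "\<And>m c n d. (m, c) \<in> K \<Longrightarrow> (n, d) \<in> K \<Longrightarrow> (m + n, c + d) \<in> K"
    and scale: "\<And>t m c. t > 0 \<Longrightarrow> (m, c) \<in> K \<Longrightarrow> (t *\<^sub>R m, t * c) \<in> K"
    and low: "\<And>m c. (m, c) \<in> K \<Longrightarrow> - c \<le> q (- m)"
  obtains r where "sublinear r" "\<And>x. r x \<le> q x" "\<And>m c. (m, c) \<in> K \<Longrightarrow> r m \<le> c"
proof -
  define r where "r x = (INF (m, c)\<in>K. q (x - m) + c)" for x
  have lb: "- q (- x) \<le> q (x - m) + c" if "(m, c) \<in> K" for x m c
    using sublinearD(1)[OF q, of "x - m" "- x"] low[OF that] by simp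
  have bdd: "bdd_below ((\<lambda>(m, c). q (x - m) + c) ` K)" for x
    using lb by (intro bdd_belowI[of _ "- q (- x)"]) auto
  have r_le: "r x \<le> q (x - m) + c" if "(m, c) \<in> K" for x m c
    unfolding r_def using cINF_lower[OF bdd that] by simp
  have le_r: "b \<le> r x" if "\<And>m c. (m, c) \<in> K \<Longrightarrow> b \<le> q (x - m) + c" for b x
    unfolding r_def using zero that by (intro cINF_greatest) auto
  have "sublinear r"
  proof (rule sublinearI)
    fix x y
    have "r (x + y) - (q (y - n) + d) \<le> r x" if "(n, d) \<in> K" for n d
    proof (rule le_r)
      fix m c assume "(m, c) \<in> K"
      then have "r (x + y) \<le> q (x + y - (m + n)) + (c + d)"
        using that by (intro r_le add)
      also have "q (x + y - (m + n)) \<le> q (x - m) + q (y - n)"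
        using sublinearD(1)[OF q, of "x - m" "y - n"] by (simp add: algebra_simps)
      finally show "r (x + y) - (q (y - n) + d) \<le> q (x - m) + c" by simp
    qed
    then have "r (x + y) - r x \<le> r y"
      by (intro le_r) force
    then show "r (x + y) \<le> r x + r y" by simp
  next
    fix t :: real and x assume t: "t > 0"
    have "r (t *\<^sub>R x) / t \<le> r x"
    proof (rule le_r)
      fix m c assume "(m, c) \<in> K"
      then have "r (t *\<^sub>R x) \<le> q (t *\<^sub>R x - t *\<^sub>R m) + t * c"
        using t by (intro r_le scale)
      also have "\<dots> = t * (q (x - m) + c)"
        using sublinearD(2)[OF q, of t "x - m"] t by (simp add: algebra_simps)
      finally show "r (t *\<^sub>R x) / t \<le> q (x - m) + c"
        using t by (simp add: field_simps)
    qed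
    then show "r (t *\<^sub>R x) \<le> t * r x"
      using t by (simp add: field_simps)
  next
    have "r 0 \<le> 0"
      using r_le[OF zero, of 0] sublinearD(3)[OF q] by simp
    moreover have "0 \<le> r 0"
      using lb[of _ _ 0] sublinearD(3)[OF q] by (intro le_r) simp
    ultimately show "r 0 = 0" by simp
  qed
  moreover have "r x \<le> q x" for x
    using r_le[OF zero, of x] by simp
  moreover have "r m \<le> c" if "(m, c) \<in> K" for m c
    using r_le[OF that, of m] sublinearD(3)[OF q] by simp
  ultimately show thesis using that by blast
qed

text \<open>Subadditivity is where the chain condition enters: \<open>c x + d y\<close> is bounded
  below through whichever of \<open>c\<close> and \<open>d\<close> is smaller. The common lower
  bound - p (- x) makes the pointwise infimum finite.\<close>

lemma sublinear_Inf_chain: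
  assumes C: "C \<noteq> {}" "\<And>c. c \<in> C \<Longrightarrow> sublinear c" "\<And>c x. c \<in> C \<Longrightarrow> c x \<le> p x"
    and chain: "\<And>c d. c \<in> C \<Longrightarrow> d \<in> C \<Longrightarrow> c \<le> d \<or> d \<le> c"
  shows "sublinear (\<lambda>x. INF c\<in>C. c x)" "c \<in> C \<Longrightarrow> (INF c\<in>C. c x) \<le> c x"
proof -
  have "- p (- x) \<le> c x" if "c \<in> C" for c x
    using sublinearD(4)[OF C(2)[OF that], of x] C(3)[OF that, of "- x"] by simp
  then have bdd: "bdd_below ((\<lambda>c. c x) ` C)" for x
    by (intro bdd_belowI[of _ "- p (- x)"]) auto
  let ?q = "\<lambda>x. INF c\<in>C. c x"
  show q_le: "?q x \<le> c x" if "c \<in> C" for c x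
    using cINF_lower[OF bdd that] by simp
  have le_q: "b \<le> ?q x" if "\<And>c. c \<in> C \<Longrightarrow> b \<le> c x" for b x
    using C(1) that by (intro cINF_greatest) auto
  show "sublinear ?q"
  proof (rule sublinearI)
    fix x y
    have *: "?q (x + y) \<le> c x + d y" if cd: "c \<in> C" "d \<in> C" for c d
    proof -
      obtain e where e: "e \<in> C" "e \<le> c" "e \<le> d"
        using chain[OF cd] cd by blast
      have "?q (x + y) \<le> e (x + y)" using e by (intro q_le)
      also have "\<dots> \<le> e x + e y" by (intro sublinearD C e)
      also have "\<dots> \<le> c x + d y"
        using e(2,3) by (intro add_mono) (simp_all add: le_fun_def)
      finally show ?thesis .
    qed
    have "?q (x + y) - c x \<le> ?q y" if "c \<in> C" for c
      using *[OF that] by (intro le_q) (simp add: algebra_simps)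
    then have "?q (x + y) - ?q y \<le> ?q x"
      by (intro le_q) (simp add: algebra_simps)
    then show "?q (x + y) \<le> ?q x + ?q y" by simp
  next
    fix t :: real and x assume t: "t > 0"
    have "?q (t *\<^sub>R x) / t \<le> ?q x"
    proof (rule le_q)
      fix c assume c: "c \<in> C"
      then have "?q (t *\<^sub>R x) \<le> c (t *\<^sub>R x)" by (rule q_le)
      also have "\<dots> = t * c x" using t c by (intro sublinearD C) auto
      finally show "?q (t *\<^sub>R x) / t \<le> c x" using t by (simp add: field_simps)
    qed
    then show "?q (t *\<^sub>R x) \<le> t * ?q x"
      using t by (simp add: field_simps)
  next
    have "?q 0 = (INF c\<in>C. 0)"
      using sublinearD(3)[OF C(2)] by (intro INF_cong) auto
    then show "?q 0 = 0" using C(1) by simp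
  qed
qed

text \<open>A minimal sublinear functional below \<open>p\<close> is odd, and oddness turns
  subadditivity into additivity and extends homogeneity to negative scalars.\<close>

lemma linear_below_sublinear:
  fixes p :: "'a::real_vector \<Rightarrow> real"
  assumes p: "sublinear p"
  obtains L where "linear L" "\<And>x. L x \<le> p x"
proof -
  let ?A = "{q. sublinear q \<and> q \<le> p}"
  have "\<exists>m\<in>?A. \<forall>a\<in>?A. a \<le> m \<longrightarrow> a = m"
  \<comment> \<open>Zorn's lemma yields maximal elements, so the order is reversed to obtain a
    minimal functional.\<close>
  proof (rule predicate_Zorn)
    show "partial_order_on ?A (relation_of (\<lambda>x y. y \<le> x) ?A)"
      by (rule partial_order_on_relation_ofI) auto
    fix C assume "C \<in> Chains (relation_of (\<lambda>x y. y \<le> x) ?A)"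
    then have C: "\<And>c. c \<in> C \<Longrightarrow> sublinear c" "\<And>c x. c \<in> C \<Longrightarrow> c x \<le> p x"
      and chain: "\<And>c d. c \<in> C \<Longrightarrow> d \<in> C \<Longrightarrow> c \<le> d \<or> d \<le> c"
      unfolding Chains_def relation_of_def le_fun_def by blast+
    show "\<exists>u\<in>?A. \<forall>a\<in>C. u \<le> a"
    proof (cases "C = {}")
      case True
      with p show ?thesis by blast
    next
      case False
      let ?q = "\<lambda>x. INF c\<in>C. c x"
      have q: "sublinear ?q"
        by (rule sublinear_Inf_chain(1)[of C p]) (use False C chain in auto)
      have q_le: "?q x \<le> c x" if "c \<in> C" for c x
        by (rule sublinear_Inf_chain(2)[of C p]) (use False C chain that in auto)
      have "?q \<le> p"
        unfolding le_fun_def using False C(2) q_le by (meson ex_in_conv order_trans)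
      with q q_le show ?thesis
        by (intro bexI[of _ ?q]) (auto simp: le_fun_def)
    qed
  qed
  then obtain q where q: "sublinear q" "q \<le> p"
    and min: "\<And>a. sublinear a \<Longrightarrow> a \<le> p \<Longrightarrow> a \<le> q \<Longrightarrow> a = q" by blast
  \<comment> \<open>Relaxing a minimal \<open>q\<close> to be at most \<open>- q y\<close> at \<open>- y\<close> changes nothing, so \<open>q\<close> is odd.\<close>
  have odd: "q (- y) = - q y" for y
  proof -
    let ?K = "(\<lambda>t. (- (t *\<^sub>R y), - (t * q y))) ` {0..}"
    obtain r where r: "sublinear r" "\<And>x. r x \<le> q x" "\<And>m c. (m, c) \<in> ?K \<Longrightarrow> r m \<le> c"
    proof (rule sublinear_relax[OF q(1), of ?K])
      show "(0, 0) \<in> ?K" by (auto intro!: image_eqI[of _ _ 0])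
      show "(m + n, c + d) \<in> ?K" if "(m, c) \<in> ?K" "(n, d) \<in> ?K" for m c n d
      proof -
        from that obtain s t where "s \<ge> 0" "t \<ge> 0" "m = - (s *\<^sub>R y)" "c = - (s * q y)"
          "n = - (t *\<^sub>R y)" "d = - (t * q y)" by auto
        then show ?thesis by (intro image_eqI[of _ _ "s + t"]) (auto simp: algebra_simps)
      qed
      show "(t *\<^sub>R m, t * c) \<in> ?K" if "t > 0" "(m, c) \<in> ?K" for t m c
      proof -
        from that obtain s where "s \<ge> 0" "m = - (s *\<^sub>R y)" "c = - (s * q y)" by auto
        with \<open>t > 0\<close> show ?thesis by (intro image_eqI[of _ _ "t * s"]) auto
      qed
      show "- c \<le> q (- m)" if "(m, c) \<in> ?K" for m c
        using that sublinearD(2)[OF q(1)] by auto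
    qed blast
    have "r \<le> q" using r(2) by (simp add: le_fun_def)
    with min[of r] r(1) q(2) have "r = q" by (meson order_trans)
    moreover have "(- y, - q y) \<in> ?K" by (auto intro!: image_eqI[of _ _ 1])
    ultimately have "q (- y) \<le> - q y" using r(3) by blast
    with sublinearD(4)[OF q(1), of y] show ?thesis by simp
  qed
  have "linear q"
  proof (rule linearI)
    fix x y
    have "- q (- x + - y) \<ge> - (q (- x) + q (- y))"
      using sublinearD(1)[OF q(1), of "- x" "- y"] by linarith
    then have "q (x + y) \<ge> q x + q y"
      using odd[of x] odd[of y] odd[of "x + y"] by simp
    with sublinearD(1)[OF q(1), of x y] show "q (x + y) = q x + q y" by simp
  next
    fix t :: real and x
    show "q (t *\<^sub>R x) = t *\<^sub>R q x"
    proof (cases "t \<ge> 0")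
      case False
      then show ?thesis
        using sublinearD(2)[OF q(1), of "- t" x] odd[of "t *\<^sub>R x"] by simp
    qed (use sublinearD(2)[OF q(1)] in auto)
  qed
  with q(2) that show thesis by (auto simp: le_fun_def)
qed

text \<open>The graph of \<open>l\<close> on \<open>M\<close> serves as the set of constraints. A
  linear functional below the relaxed gauge is then at most \<open>l\<close> on \<open>M\<close>,
  and applying this to \<open>- x\<close> gives equality.\<close>

theorem Hahn_Banach:
  fixes p :: "'a::real_vector \<Rightarrow> real"
  assumes p: "sublinear p" and M: "subspace M"
    and add: "\<And>x y. x \<in> M \<Longrightarrow> y \<in> M \<Longrightarrow> l (x + y) = l x + l y"
    and scale: "\<And>t x. x \<in> M \<Longrightarrow> l (t *\<^sub>R x) = t * l x"
    and le: "\<And>x. x \<in> M \<Longrightarrow> l x \<le> p x"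
  obtains L where "linear L" "\<And>x. L x \<le> p x" "\<And>x. x \<in> M \<Longrightarrow> L x = l x"
proof -
  have l0: "l 0 = 0" using scale[OF subspace_0[OF M], of 0] by simp
  have neg: "- x \<in> M" "l (- x) = - l x" if "x \<in> M" for x
    using scale[OF that, of "- 1"] subspace_neg[OF M that] by simp_all
  obtain r where r: "sublinear r" "\<And>x. r x \<le> p x" "\<And>m c. (m, c) \<in> (\<lambda>x. (x, l x)) ` M \<Longrightarrow> r m \<le> c"
  proof (rule sublinear_relax[OF p, of "(\<lambda>x. (x, l x)) ` M"])
    show "- c \<le> p (- m)" if "(m, c) \<in> (\<lambda>x. (x, l x)) ` M" for m c
      using that le[of "- m"] neg by auto
  qed (use l0 add scale subspace_0[OF M] subspace_add[OF M] subspace_scale[OF M] in auto)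
  obtain L where L: "linear L" "\<And>x. L x \<le> r x"
    using linear_below_sublinear[OF r(1)] by blast
  have L_le: "L x \<le> l x" if "x \<in> M" for x
    using L(2)[of x] r(3)[of x "l x"] that by fastforce
  have "L x = l x" if "x \<in> M" for x
    using L_le[OF that] L_le[OF neg(1)[OF that]] linear_neg[OF L(1), of x] neg(2)[OF that] by simp
  with L r(2) that show thesis by (meson order_trans)
qed

section \<open>Projections and functionals in real Hilbert spaces\<close>

text \<open>Parallelogram law: the midpoint of two almost optimal points lies in \<open>M\<close>,
  so its distance to \<open>f\<close> is again at least the minimum, which forces the two points to
  be close.\<close>

lemma minimizing_sequence_Cauchy:
  fixes f :: "'a::real_inner"
  assumes M: "subspace M" and d: "\<And>g. g \<in> M \<Longrightarrow> d \<le> (norm (f - g))\<^sup>2"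
    and X: "\<And>n. X n \<in> M" "(\<lambda>n. (norm (f - X n))\<^sup>2) \<longlonglongrightarrow> d"
  shows "Cauchy X"
proof (rule metric_CauchyI)
  fix e :: real assume e: "e > 0"
  \<comment> \<open>The tolerance is \<open>e\<^sup>2 / 4\<close> because the parallelogram law
    multiplies the two excesses by 2 and adds them, leaving exactly
    \<open>e\<^sup>2\<close>.\<close>
  then have "\<forall>\<^sub>F n in sequentially. (norm (f - X n))\<^sup>2 < d + e\<^sup>2 / 4"
    by (intro order_tendstoD(2)[OF X(2)]) simp
  then obtain N where N: "\<And>n. n \<ge> N \<Longrightarrow> (norm (f - X n))\<^sup>2 < d + e\<^sup>2 / 4"
    by (auto simp: eventually_sequentially)
  have "dist (X m) (X n) < e" if mn: "m \<ge> N" "n \<ge> N" for m n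
  proof -
    let ?g = "(1/2) *\<^sub>R (X m + X n)"
    have "?g \<in> M" using X(1) M by (intro subspace_scale subspace_add)
    then have "d \<le> (norm (f - ?g))\<^sup>2" by (rule d)
    moreover have "(norm (X m - X n))\<^sup>2 + 4 * (norm (f - ?g))\<^sup>2
        = 2 * (norm (f - X m))\<^sup>2 + 2 * (norm (f - X n))\<^sup>2"
      by (simp add: power2_norm_eq_inner inner_diff_left inner_diff_right inner_add_left
          inner_add_right inner_commute algebra_simps)
    ultimately have "(norm (X m - X n))\<^sup>2 < e\<^sup>2"
      using N[OF mn(1)] N[OF mn(2)] by simp
    then show ?thesis
      using e by (simp add: dist_norm power_less_imp_less_base)
  qed
  then show "\<exists>M. \<forall>m\<ge>M. \<forall>n\<ge>M. dist (X m) (X n) < e" by blast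
qed

theorem orthogonal_projection_exists:
  fixes f :: "'a::{real_inner, complete_space}"
  assumes M: "subspace M" and cl: "closed M"
  obtains g where "g \<in> M" "\<And>h. h \<in> M \<Longrightarrow> inner (f - g) h = 0"
proof -
  define d where "d = (INF g\<in>M. (norm (f - g))\<^sup>2)"
  have ne: "M \<noteq> {}" using subspace_0[OF M] by blast
  have bdd: "bdd_below ((\<lambda>g. (norm (f - g))\<^sup>2) ` M)" by (rule bdd_belowI[of _ 0]) auto
  have d_le: "d \<le> (norm (f - g))\<^sup>2" if "g \<in> M" for g
    unfolding d_def using cINF_lower[OF bdd that] .
  have "\<exists>g\<in>M. (norm (f - g))\<^sup>2 < d + 1 / Suc n" for n
    using cINF_less_iff[OF ne bdd, of "d + 1 / Suc n"] by (simp add: d_def)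
  then obtain X where X: "\<And>n. X n \<in> M" "\<And>n. (norm (f - X n))\<^sup>2 < d + 1 / Suc n" by metis
  have "(\<lambda>n. (norm (f - X n))\<^sup>2) \<longlonglongrightarrow> d"
  proof (rule tendsto_sandwich[of "\<lambda>_. d" _ _ "\<lambda>n. d + 1 / Suc n"])
    show "(\<lambda>n. d + 1 / Suc n) \<longlonglongrightarrow> d"
      using tendsto_add[OF tendsto_const[of d] LIMSEQ_inverse_real_of_nat]
      by (simp add: inverse_eq_divide del: of_nat_Suc)
    show "\<forall>\<^sub>F n in sequentially. (norm (f - X n))\<^sup>2 \<le> d + 1 / Suc n"
      using X(2) by (simp add: less_imp_le del: of_nat_Suc)
    show "\<forall>\<^sub>F n in sequentially. d \<le> (norm (f - X n))\<^sup>2"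
      using d_le X(1) by simp
  qed simp
  then have "Cauchy X" "(\<lambda>n. (norm (f - X n))\<^sup>2) \<longlonglongrightarrow> d"
    using minimizing_sequence_Cauchy[OF M d_le X(1)] by auto
  then obtain g where g: "X \<longlonglongrightarrow> g"
    using Cauchy_convergent_iff convergent_def by blast
  have gM: "g \<in> M"
    using closed_sequentially[OF cl X(1) g] .
  have "(\<lambda>n. (norm (f - X n))\<^sup>2) \<longlonglongrightarrow> (norm (f - g))\<^sup>2"
    by (intro tendsto_intros g)
  then have dg: "(norm (f - g))\<^sup>2 = d"
    using \<open>(\<lambda>n. (norm (f - X n))\<^sup>2) \<longlonglongrightarrow> d\<close> by (rule LIMSEQ_unique)
  have "inner (f - g) h = 0" if h: "h \<in> M" for h
  proof (cases "h = 0")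
    case False
    \<comment> \<open>\<open>t\<close> minimizes the quadratic norm (f - g - t h) squared; a nonzero
      inner product would make it smaller than the minimum \<open>d\<close>.\<close>
    define t where "t = inner (f - g) h / (norm h)\<^sup>2"
    have "g + t *\<^sub>R h \<in> M" using gM h M by (intro subspace_add subspace_scale)
    from d_le[OF this] have "(norm (f - g))\<^sup>2 \<le> (norm (f - g - t *\<^sub>R h))\<^sup>2"
      by (simp add: dg algebra_simps)
    also have "\<dots> = (norm (f - g))\<^sup>2 - 2 * t * inner (f - g) h + t\<^sup>2 * (norm h)\<^sup>2"
      unfolding power2_norm_eq_inner
      by (simp add: inner_diff_left inner_diff_right inner_commute algebra_simps power2_eq_square)
    also have "\<dots> = (norm (f - g))\<^sup>2 - (inner (f - g) h)\<^sup>2 / (norm h)\<^sup>2"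
      using False by (simp add: t_def power2_eq_square field_simps)
    finally show ?thesis using False by (simp add: divide_le_0_iff)
  qed simp
  with gM that show thesis by blast
qed

text \<open>The kernel is a closed hyperplane, and \<open>u\<close>, the part of \<open>v\<close>
  orthogonal to it, spans the complement. Every \<open>f\<close> differs from a multiple of
  \<open>u\<close> by an element of the kernel, so \<open>l\<close> is a multiple of the inner
  product with \<open>u\<close>.\<close>

theorem Riesz_representation:
  fixes l :: "'a::{real_inner, complete_space} \<Rightarrow> real"
  assumes l: "bounded_linear l"
  obtains w where "\<And>f. l f = inner f w"
proof (cases "\<forall>f. l f = 0")
  case True
  with that[of 0] show thesis by simp
next
  case False
  then obtain v where v: "l v \<noteq> 0" by blast
  interpret bounded_linear l by fact
  let ?M = "{f. l f = 0}"
  have M: "subspace ?M" by (auto simp: subspace_def add scale zero)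
  have "closed ?M"
    by (intro closed_Collect_eq continuous_intros linear_continuous_on l)
  then obtain g where g: "l g = 0" "\<And>h. l h = 0 \<Longrightarrow> inner (v - g) h = 0"
    using orthogonal_projection_exists[OF M, of v] by auto
  define u where "u = v - g"
  have lu: "l u \<noteq> 0" using v g by (simp add: u_def diff)
  then have u0: "u \<noteq> 0" by (auto simp: zero)
  have "l f = inner f ((l u / (norm u)\<^sup>2) *\<^sub>R u)" for f
  proof -
    have "l (f - (l f / l u) *\<^sub>R u) = 0" using lu by (simp add: diff scale)
    then have "inner u (f - (l f / l u) *\<^sub>R u) = 0" unfolding u_def by (rule g(2))
    then have "inner f u = (l f / l u) * (norm u)\<^sup>2"
      by (simp add: inner_diff_right inner_commute power2_norm_eq_inner)
    then show ?thesis using lu u0 by simp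
  qed
  with that show thesis by blast
qed

section \<open>Elementary properties of \<open>L\<^sup>2\<close>\<close>

interpretation circle: finite_measure circle
  by (rule finite_measure_circle)

lemma cnj_borel_measurable [measurable]: "cnj \<in> borel_measurable borel"
  by (intro borel_measurable_continuous_onI continuous_intros)

lemma AE_circle_cnj: "AE \<xi> in circle. P \<xi> \<Longrightarrow> AE \<xi> in circle. P (cnj \<xi>)"
  using AE_distrD[of cnj circle borel P] unfolding distr_circle_cnj by simp

lemma integral_circle_cnj:
  fixes f :: "complex \<Rightarrow> 'a::{banach, second_countable_topology}"
  assumes [measurable]: "f \<in> borel_measurable borel"
  shows "(\<integral>\<xi>. f (cnj \<xi>) \<partial>circle) = (\<integral>\<xi>. f \<xi> \<partial>circle)"
  by (subst (2) distr_circle_cnj[symmetric], subst integral_distr) auto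

lemma square_integrable_rep: "square_integrable (rep_L2 f)"
  using Quotient3_rep_reflp[OF Quotient3_L2, of f] by (simp add: L2_eq_def)

lemma rep_L2_measurable [measurable]: "rep_L2 f \<in> borel_measurable borel"
  by (rule square_integrable_measurable[OF square_integrable_rep])

lemma L2_of_rep: "L2_of (rep_L2 f) = f"
  by (rule Quotient3_abs_rep[OF Quotient3_L2])

lemma L2_of_cases:
  obtains g where "square_integrable g" "f = L2_of g"
  using square_integrable_rep L2_of_rep by metis

lemma L2_of_eq_iff:
  assumes "square_integrable f" "square_integrable g"
  shows "L2_of f = L2_of g \<longleftrightarrow> (AE \<xi> in circle. f \<xi> = g \<xi>)"
  using Quotient3_rel[OF Quotient3_L2, of f g] assms by (auto simp: L2_eq_def)

lemma L2_eq_refl: "square_integrable f \<Longrightarrow> L2_eq f f"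
  by (simp add: L2_eq_def)

lemma square_integrable_uminus: "square_integrable f \<Longrightarrow> square_integrable (\<lambda>\<xi>. - f \<xi>)"
  using square_integrable_scale[of f "- 1"] by simp

lemma square_integrable_diff:
  "square_integrable f \<Longrightarrow> square_integrable g \<Longrightarrow> square_integrable (\<lambda>\<xi>. f \<xi> - g \<xi>)"
  using square_integrable_add[of f "\<lambda>\<xi>. - g \<xi>"] by (simp add: square_integrable_uminus)

lemma zero_L2_eq: "0 = L2_of (\<lambda>_. 0)"
  by (simp add: zero_L2_def)

lemma add_L2_of:
  "square_integrable f \<Longrightarrow> square_integrable g \<Longrightarrow> L2_of f + L2_of g = L2_of (\<lambda>\<xi>. f \<xi> + g \<xi>)"
  by (rule plus_L2.abs_eq) (simp_all add: L2_eq_refl)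

lemma diff_L2_of:
  "square_integrable f \<Longrightarrow> square_integrable g \<Longrightarrow> L2_of f - L2_of g = L2_of (\<lambda>\<xi>. f \<xi> - g \<xi>)"
  by (simp add: minus_L2_def uminus_L2.abs_eq L2_eq_refl add_L2_of square_integrable_uminus)

lemma scaleC_L2_of: "square_integrable f \<Longrightarrow> c *\<^sub>C L2_of f = L2_of (\<lambda>\<xi>. c * f \<xi>)"
  by (rule scaleC.abs_eq) (simp_all add: L2_eq_refl)

lemma scaleR_scaleC: "r *\<^sub>R f = complex_of_real r *\<^sub>C f"
proof -
  obtain f' where "square_integrable f'" "f = L2_of f'" by (rule L2_of_cases)
  then show ?thesis by (simp add: scaleR_L2.abs_eq scaleC.abs_eq L2_eq_refl)
qed

lemma cinner_L2_of:
  "square_integrable f \<Longrightarrow> square_integrable g \<Longrightarrow>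
    cinner (L2_of f) (L2_of g) = (\<integral>\<xi>. f \<xi> * cnj (g \<xi>) \<partial>circle)"
  by (rule cinner.abs_eq) (simp_all add: L2_eq_refl)

lemma scaleC_simps [simp]:
  "1 *\<^sub>C f = f" "0 *\<^sub>C f = 0" "c *\<^sub>C (0 :: L2) = 0" "c *\<^sub>C d *\<^sub>C f = (c * d) *\<^sub>C f" "(-1) *\<^sub>C f = - f"
proof -
  obtain f' where "square_integrable f'" "f = L2_of f'" by (rule L2_of_cases)
  then show "1 *\<^sub>C f = f" "0 *\<^sub>C f = 0" "c *\<^sub>C d *\<^sub>C f = (c * d) *\<^sub>C f" "(-1) *\<^sub>C f = - f"
    by (simp_all add: scaleC_L2_of zero_L2_eq mult.assoc square_integrable_scale
        uminus_L2.abs_eq L2_eq_refl)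
  have "square_integrable (\<lambda>_. 0)" by (simp add: square_integrable_def)
  then show "c *\<^sub>C (0 :: L2) = 0" by (simp add: zero_L2_eq scaleC_L2_of)
qed

lemma scaleC_add: "c *\<^sub>C (f + g) = c *\<^sub>C f + c *\<^sub>C g"
proof -
  obtain f' where "square_integrable f'" "f = L2_of f'" by (rule L2_of_cases)
  moreover obtain g' where "square_integrable g'" "g = L2_of g'" by (rule L2_of_cases)
  ultimately show ?thesis
    by (simp add: scaleC_L2_of add_L2_of square_integrable_add square_integrable_scale distrib_left)
qed

lemma scaleC_diff: "c *\<^sub>C (f - g) = c *\<^sub>C f - c *\<^sub>C g"
  using scaleC_add[of c f "- g"] by (metis (no_types) diff_conv_add_uminus mult.commute scaleC_simps(4,5))

lemma cinner_add_left: "cinner (f + g) h = cinner f h + cinner g h"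
  by transfer (simp add: L2_eq_def distrib_right integrable_mult_cnj)

lemma cinner_scaleC_left: "cinner (c *\<^sub>C f) g = c * cinner f g"
  by transfer (simp add: L2_eq_def mult.assoc)

lemma cinner_commute: "cinner f g = cnj (cinner g f)"
  by transfer (simp flip: Bochner_Integration.integral_cnj add: mult.commute)

lemma cinner_add_right: "cinner f (g + h) = cinner f g + cinner f h"
  by (subst (1 2 3) cinner_commute) (simp add: cinner_add_left)

lemma cinner_scaleC_right: "cinner f (c *\<^sub>C g) = cnj c * cinner f g"
  by (subst (1 2) cinner_commute) (simp add: cinner_scaleC_left)

lemma cinner_minus_left: "cinner (- f) g = - cinner f g"
  using cinner_scaleC_left[of "-1" f g] by simp

lemma cinner_minus_right: "cinner f (- g) = - cinner f g"
  using cinner_scaleC_right[of f "-1" g] by simp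

lemma cinner_diff_left: "cinner (f - g) h = cinner f h - cinner g h"
  using cinner_add_left[of f "- g" h] by (simp add: cinner_minus_left)

lemma cinner_diff_right: "cinner f (g - h) = cinner f g - cinner f h"
  using cinner_add_right[of f g "- h"] by (simp add: cinner_minus_right)

lemma cinner_zero [simp]: "cinner 0 f = 0" "cinner f 0 = 0"
  using cinner_scaleC_left[of 0 f f] cinner_scaleC_right[of f 0 f] by simp_all

text \<open>Passes from the real inner product to the complex one: over a set closed under
  multiplication by i, real orthogonality already implies complex orthogonality.\<close>

lemma Im_cinner: "Im (cinner f g) = inner f (\<i> *\<^sub>C g)"
  by (simp add: inner_L2_def cinner_scaleC_right)

lemma cinner_self: "cinner f f = complex_of_real ((norm f)\<^sup>2)"
proof -
  have "Im (cinner f f) = 0" using cinner_commute[of f f] by (metis cnj.simps(2) neg_equal_zero)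
  then show ?thesis
    by (simp add: complex_eq_iff power2_norm_eq_inner inner_L2_def)
qed

lemma norm_scaleC: "norm (c *\<^sub>C f) = cmod c * norm f"
proof -
  have "complex_of_real ((norm (c *\<^sub>C f))\<^sup>2) = complex_of_real ((cmod c * norm f)\<^sup>2)"
    unfolding cinner_self[symmetric] power_mult_distrib of_real_mult
    by (simp add: cinner_scaleC_left cinner_scaleC_right complex_norm_square flip: of_real_power mult.assoc)
  then show ?thesis
    unfolding of_real_eq_iff by (rule power2_eq_imp_eq) auto
qed

lemma norm_cinner_le: "cmod (cinner f g) \<le> norm f * norm g"
proof (cases "cinner f g = 0")
  case False
  \<comment> \<open>A unimodular factor that rotates the inner product onto the positive real axis,
    where the real Cauchy-Schwarz inequality applies.\<close>
  let ?c = "cnj (cinner f g) / cmod (cinner f g)"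
  have "cmod (cinner f g) = Re (?c * cinner f g)"
    by (simp add: mult.commute complex_norm_square[symmetric] power2_eq_square)
  also have "\<dots> = inner (?c *\<^sub>C f) g" by (simp only: inner_L2_def cinner_scaleC_left)
  also have "\<dots> \<le> norm (?c *\<^sub>C f) * norm g" by (rule norm_cauchy_schwarz)
  also have "norm (?c *\<^sub>C f) = norm f" using False by (simp add: norm_scaleC norm_divide)
  finally show ?thesis .
qed simp

text \<open>Test with \<open>h\<close> equal to \<open>f - g\<close> itself. This gives uniqueness
  for every vector characterized by its inner products over a subspace.\<close>

lemma cinner_zero_imp_eq: "(\<And>h. h \<in> M \<Longrightarrow> cinner f h = cinner g h) \<Longrightarrow> f - g \<in> M \<Longrightarrow> f = g"
  using cinner_self[of "f - g"] by (fastforce simp: cinner_diff_left)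

lemma bounded_bilinear_cinner: "bounded_bilinear cinner"
proof
  show "\<exists>K. \<forall>a b. norm (cinner a b) \<le> norm a * norm b * K"
    using norm_cinner_le by (intro exI[of _ 1]) simp
qed (simp_all add: cinner_add_left cinner_add_right scaleR_scaleC cinner_scaleC_left
    cinner_scaleC_right scaleR_conv_of_real)

lemmas continuous_on_cinner [continuous_intros] =
  bounded_bilinear.continuous_on[OF bounded_bilinear_cinner]

lemma norm_L2_of:
  assumes "square_integrable f"
  shows "(norm (L2_of f))\<^sup>2 = (\<integral>\<xi>. (cmod (f \<xi>))\<^sup>2 \<partial>circle)"
proof -
  have "complex_of_real ((norm (L2_of f))\<^sup>2) = complex_of_real (\<integral>\<xi>. (cmod (f \<xi>))\<^sup>2 \<partial>circle)"
    unfolding cinner_self[symmetric] cinner_L2_of[OF assms assms] integral_complex_of_real[symmetric]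
    by (simp only: complex_norm_square)
  then show ?thesis by (simp only: of_real_eq_iff)
qed

lemma norm_L2_of_mono:
  assumes f: "square_integrable f" and g: "square_integrable g"
    and le: "AE \<xi> in circle. cmod (f \<xi>) \<le> C * cmod (g \<xi>)" and C: "C \<ge> 0"
  shows "norm (L2_of f) \<le> C * norm (L2_of g)"
proof (rule power2_le_imp_le)
  have "(norm (L2_of f))\<^sup>2 = (\<integral>\<xi>. (cmod (f \<xi>))\<^sup>2 \<partial>circle)" by (rule norm_L2_of[OF f])
  also have "\<dots> \<le> (\<integral>\<xi>. C\<^sup>2 * (cmod (g \<xi>))\<^sup>2 \<partial>circle)"
  proof (rule integral_mono_AE)
    show "AE \<xi> in circle. (cmod (f \<xi>))\<^sup>2 \<le> C\<^sup>2 * (cmod (g \<xi>))\<^sup>2"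
      using le
    proof eventually_elim
      case (elim \<xi>)
      then have "(cmod (f \<xi>))\<^sup>2 \<le> (C * cmod (g \<xi>))\<^sup>2" by (intro power_mono) auto
      then show ?case by (simp add: power_mult_distrib)
    qed
  qed (use f g in \<open>auto simp: square_integrable_def\<close>)
  also have "\<dots> = (C * norm (L2_of g))\<^sup>2"
    by (simp add: norm_L2_of[OF g] power_mult_distrib)
  finally show "(norm (L2_of f))\<^sup>2 \<le> (C * norm (L2_of g))\<^sup>2" .
qed (use C in simp)

lemma LinftyI: "\<phi> \<in> borel_measurable borel \<Longrightarrow> AE \<xi> in circle. cmod (\<phi> \<xi>) \<le> C \<Longrightarrow> \<phi> \<in> Linfty"
  by (auto simp: Linfty_def)

lemma LinftyE:
  assumes "\<phi> \<in> Linfty"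
  obtains C where "C \<ge> 0" "AE \<xi> in circle. cmod (\<phi> \<xi>) \<le> C" "\<phi> \<in> borel_measurable borel"
proof -
  obtain C where "AE \<xi> in circle. cmod (\<phi> \<xi>) \<le> C" "\<phi> \<in> borel_measurable borel"
    using assms by (auto simp: Linfty_def)
  then show thesis by (intro that[of "max C 0"]) auto
qed

lemma Linfty_mult:
  assumes "\<phi> \<in> Linfty" "\<psi> \<in> Linfty"
  shows "(\<lambda>\<xi>. \<phi> \<xi> * \<psi> \<xi>) \<in> Linfty"
proof -
  obtain C where C: "C \<ge> 0" "AE \<xi> in circle. cmod (\<phi> \<xi>) \<le> C" "\<phi> \<in> borel_measurable borel"
    using assms(1) by (rule LinftyE)
  obtain D where D: "D \<ge> 0" "AE \<xi> in circle. cmod (\<psi> \<xi>) \<le> D" "\<psi> \<in> borel_measurable borel"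
    using assms(2) by (rule LinftyE)
  have "AE \<xi> in circle. cmod (\<phi> \<xi> * \<psi> \<xi>) \<le> C * D"
    using C(2) D(2) by eventually_elim (use C(1) in \<open>auto simp: norm_mult intro: mult_mono\<close>)
  with C D show ?thesis by (intro LinftyI) auto
qed

lemma Linfty_add:
  assumes "\<phi> \<in> Linfty" "\<psi> \<in> Linfty"
  shows "(\<lambda>\<xi>. \<phi> \<xi> + \<psi> \<xi>) \<in> Linfty"
proof -
  obtain C where C: "C \<ge> 0" "AE \<xi> in circle. cmod (\<phi> \<xi>) \<le> C" "\<phi> \<in> borel_measurable borel"
    using assms(1) by (rule LinftyE)
  obtain D where D: "D \<ge> 0" "AE \<xi> in circle. cmod (\<psi> \<xi>) \<le> D" "\<psi> \<in> borel_measurable borel"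
    using assms(2) by (rule LinftyE)
  have "AE \<xi> in circle. cmod (\<phi> \<xi> + \<psi> \<xi>) \<le> C + D"
    using C(2) D(2) by eventually_elim (meson add_mono norm_triangle_le)
  with C D show ?thesis by (intro LinftyI) auto
qed

lemma Linfty_cnj: "\<phi> \<in> Linfty \<Longrightarrow> (\<lambda>\<xi>. cnj (\<phi> \<xi>)) \<in> Linfty"
  by (erule LinftyE, rule LinftyI) auto

lemma Linfty_reflect: "\<phi> \<in> Linfty \<Longrightarrow> reflect \<phi> \<in> Linfty"
proof (erule LinftyE, rule LinftyI)
  fix C assume "AE \<xi> in circle. cmod (\<phi> \<xi>) \<le> C"
  then show "AE \<xi> in circle. cmod (reflect \<phi> \<xi>) \<le> C"
    unfolding reflect_def by (rule AE_circle_cnj)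
  assume [measurable]: "\<phi> \<in> borel_measurable borel"
  show "reflect \<phi> \<in> borel_measurable borel"
    unfolding reflect_def[abs_def] by measurable
qed

lemma Linfty_id: "(\<lambda>\<xi>. \<xi>) \<in> Linfty"
  using AE_circle_norm by (intro LinftyI[of _ 1]) auto

lemma Linfty_powi: "(\<lambda>\<xi>. \<xi> powi n) \<in> Linfty"
proof (rule LinftyI)
  show "AE \<xi> in circle. cmod (\<xi> powi n) \<le> 1"
    using AE_circle_norm by eventually_elim (simp add: norm_power_int)
  show "(\<lambda>\<xi>::complex. \<xi> powi n) \<in> borel_measurable borel"
    unfolding power_int_def by measurable
qed

lemma Linfty_const: "(\<lambda>\<xi>. c) \<in> Linfty"
  by (intro LinftyI[of _ "cmod c"]) auto

lemma mult_L2_cong: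
  assumes "\<phi> \<in> Linfty" "\<psi> \<in> Linfty" "AE \<xi> in circle. \<phi> \<xi> = \<psi> \<xi>"
  shows "mult_L2 \<phi> f = mult_L2 \<psi> f"
  unfolding mult_L2_def using assms
  by (intro L2_of_eqI square_integrable_mult square_integrable_rep) auto

lemma mult_L2_mult:
  assumes "\<phi> \<in> Linfty" "\<psi> \<in> Linfty"
  shows "mult_L2 \<phi> (mult_L2 \<psi> f) = mult_L2 (\<lambda>\<xi>. \<phi> \<xi> * \<psi> \<xi>) f"
  using assms
  by (cases f rule: L2_of_cases) (simp add: mult_L2_of square_integrable_mult Linfty_mult mult.assoc)

lemma mult_L2_add: "\<phi> \<in> Linfty \<Longrightarrow> mult_L2 \<phi> (f + g) = mult_L2 \<phi> f + mult_L2 \<phi> g"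
  by (cases f rule: L2_of_cases, cases g rule: L2_of_cases)
    (simp add: mult_L2_of square_integrable_mult square_integrable_add add_L2_of distrib_left)

lemma mult_L2_diff: "\<phi> \<in> Linfty \<Longrightarrow> mult_L2 \<phi> (f - g) = mult_L2 \<phi> f - mult_L2 \<phi> g"
  by (cases f rule: L2_of_cases, cases g rule: L2_of_cases)
    (simp add: mult_L2_of square_integrable_mult square_integrable_diff diff_L2_of right_diff_distrib)

lemma mult_L2_scaleC: "\<phi> \<in> Linfty \<Longrightarrow> mult_L2 \<phi> (c *\<^sub>C f) = c *\<^sub>C mult_L2 \<phi> f"
  by (cases f rule: L2_of_cases)
    (simp add: mult_L2_of square_integrable_mult square_integrable_scale scaleC_L2_of mult.left_commute)

lemma mult_L2_plus:
  assumes "\<phi> \<in> Linfty" "\<psi> \<in> Linfty"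
  shows "mult_L2 (\<lambda>\<xi>. \<phi> \<xi> + \<psi> \<xi>) f = mult_L2 \<phi> f + mult_L2 \<psi> f"
  using assms by (cases f rule: L2_of_cases)
    (simp add: mult_L2_of square_integrable_mult add_L2_of distrib_right Linfty_add)

lemma mult_L2_adjoint:
  assumes "\<phi> \<in> Linfty"
  shows "cinner (mult_L2 \<phi> f) g = cinner f (mult_L2 (\<lambda>\<xi>. cnj (\<phi> \<xi>)) g)"
  using assms by (cases f rule: L2_of_cases, cases g rule: L2_of_cases)
    (simp add: mult_L2_of square_integrable_mult cinner_L2_of Linfty_cnj mult.assoc mult.left_commute)

lemma mult_L2_one:
  assumes "\<phi> \<in> Linfty" "AE \<xi> in circle. \<phi> \<xi> = 1"
  shows "mult_L2 \<phi> f = f"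
  using assms by (cases f rule: L2_of_cases)
    (simp add: mult_L2_of square_integrable_mult L2_of_eq_iff eventually_mono)

lemma bounded_linear_mult_L2:
  assumes "\<phi> \<in> Linfty"
  shows "bounded_linear (mult_L2 \<phi>)"
proof
  obtain C where C: "C \<ge> 0" "AE \<xi> in circle. cmod (\<phi> \<xi>) \<le> C"
    using assms by (rule LinftyE)
  have "norm (mult_L2 \<phi> f) \<le> norm f * C" for f
  proof -
    obtain f' where f: "square_integrable f'" "f = L2_of f'" by (rule L2_of_cases)
    have "norm (L2_of (\<lambda>\<xi>. \<phi> \<xi> * f' \<xi>)) \<le> C * norm (L2_of f')"
    proof (rule norm_L2_of_mono)
      show "AE \<xi> in circle. cmod (\<phi> \<xi> * f' \<xi>) \<le> C * cmod (f' \<xi>)"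
        using C(2) by eventually_elim (simp add: norm_mult mult_right_mono)
    qed (use f C assms in \<open>auto intro: square_integrable_mult\<close>)
    then show ?thesis using f assms by (simp add: mult_L2_of mult.commute)
  qed
  then show "\<exists>K. \<forall>f. norm (mult_L2 \<phi> f) \<le> norm f * K" by blast
qed (use assms in \<open>auto simp: mult_L2_add scaleR_scaleC mult_L2_scaleC\<close>)

lemma square_integrable_flip:
  assumes "square_integrable f"
  shows "square_integrable (\<lambda>\<xi>. cnj \<xi> * f (cnj \<xi>))"
  using assms flip.rsp by (simp add: rel_fun_def L2_eq_def) blast

lemma flip_L2_of: "square_integrable f \<Longrightarrow> flip (L2_of f) = L2_of (\<lambda>\<xi>. cnj \<xi> * f (cnj \<xi>))"
  by (rule flip.abs_eq) (rule L2_eq_refl)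

lemma flip_add: "flip (f + g) = flip f + flip g"
  by (cases f rule: L2_of_cases, cases g rule: L2_of_cases)
    (simp add: flip_L2_of square_integrable_flip square_integrable_add add_L2_of distrib_left)

lemma flip_scaleC: "flip (c *\<^sub>C f) = c *\<^sub>C flip f"
  by (cases f rule: L2_of_cases)
    (simp add: flip_L2_of square_integrable_flip square_integrable_scale scaleC_L2_of mult.left_commute)

lemma flip_mult:
  assumes "\<phi> \<in> Linfty"
  shows "flip (mult_L2 \<phi> f) = mult_L2 (reflect \<phi>) (flip f)"
  using assms by (cases f rule: L2_of_cases)
    (simp add: mult_L2_of flip_L2_of square_integrable_flip square_integrable_mult Linfty_reflect
      reflect_def mult.left_commute)

text \<open>Complex conjugation preserves the measure of the circle, so the substitution moves the
  flip from one argument to the other.\<close>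

lemma cinner_flip: "cinner (flip f) g = cinner f (flip g)"
proof -
  obtain f' where f: "square_integrable f'" "f = L2_of f'" by (rule L2_of_cases)
  obtain g' where g: "square_integrable g'" "g = L2_of g'" by (rule L2_of_cases)
  note [measurable] = f(1)[THEN square_integrable_measurable] g(1)[THEN square_integrable_measurable]
  have "cinner (flip f) g = (\<integral>\<xi>. cnj \<xi> * f' (cnj \<xi>) * cnj (g' \<xi>) \<partial>circle)"
    using f g by (simp add: flip_L2_of cinner_L2_of square_integrable_flip)
  also have "\<dots> = (\<integral>\<xi>. \<xi> * f' \<xi> * cnj (g' (cnj \<xi>)) \<partial>circle)"
    using integral_circle_cnj[of "\<lambda>\<xi>. \<xi> * f' \<xi> * cnj (g' (cnj \<xi>))"] by simp
  also have "\<dots> = cinner f (flip g)"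
    using f g by (simp add: flip_L2_of cinner_L2_of square_integrable_flip mult.commute mult.left_commute)
  finally show ?thesis .
qed

lemma flip_flip: "flip (flip f) = f"
proof -
  obtain f' where f: "square_integrable f'" "f = L2_of f'" by (rule L2_of_cases)
  have "AE \<xi> in circle. cnj \<xi> * (\<xi> * f' \<xi>) = f' \<xi>"
    using AE_circle_norm
    by eventually_elim (simp add: mult.commute complex_norm_square[symmetric] flip: mult.assoc)
  with f show ?thesis
    using square_integrable_flip[OF square_integrable_flip[OF f(1)]]
    by (simp add: flip_L2_of square_integrable_flip L2_of_eq_iff)
qed

lemma norm_flip: "norm (flip f) = norm f"
proof -
  have "complex_of_real ((norm (flip f))\<^sup>2) = complex_of_real ((norm f)\<^sup>2)"
    unfolding cinner_self[symmetric] by (simp add: cinner_flip flip_flip)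
  then show ?thesis unfolding of_real_eq_iff by simp
qed

lemma bounded_linear_flip: "bounded_linear flip"
  by (rule bounded_linear_intro[of _ 1]) (simp_all add: flip_add scaleR_scaleC flip_scaleC norm_flip)

section \<open>Completeness of \<open>L\<^sup>2\<close>\<close>

text \<open>L2 lies inside L1 because the measure is finite, so this gauge is defined on all of
  \<open>L2\<close>. It is the majorant for the Hahn-Banach extension and also controls almost
  everywhere convergence in the completeness proof.\<close>

definition L1_norm :: "L2 \<Rightarrow> real" where
  "L1_norm f = (\<integral>\<xi>. cmod (rep_L2 f \<xi>) \<partial>circle)"

lemma square_integrable_one: "square_integrable (\<lambda>_. 1)"
  by (simp add: square_integrable_def)

lemma square_integrable_norm: "square_integrable f \<Longrightarrow> square_integrable (\<lambda>\<xi>. complex_of_real (cmod (f \<xi>)))"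
  by (auto simp: square_integrable_def)

lemma square_integrable_imp_integrable: "square_integrable f \<Longrightarrow> integrable circle f"
  using integrable_mult_cnj[OF _ square_integrable_one] by simp

lemma L1_norm_L2_of:
  assumes "square_integrable f"
  shows "L1_norm (L2_of f) = (\<integral>\<xi>. cmod (f \<xi>) \<partial>circle)"
  unfolding L1_norm_def
proof (rule integral_cong_AE)
  show "AE \<xi> in circle. cmod (rep_L2 (L2_of f) \<xi>) = cmod (f \<xi>)"
    using rep_L2_of(2)[OF assms] by auto
qed (use square_integrable_measurable[OF assms] in \<open>auto intro: rep_L2_measurable\<close>)

lemma norm_L2_of_one: "norm (L2_of (\<lambda>_. 1)) = 1"
proof -
  have "measure circle UNIV = 1" by (simp add: measure_def emeasure_circle_UNIV)
  then have "(norm (L2_of (\<lambda>_. 1)))\<^sup>2 = 1"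
    by (simp add: norm_L2_of[OF square_integrable_one])
  then show ?thesis by (simp add: power2_eq_1_iff) (smt (verit) norm_ge_zero)
qed

text \<open>Cauchy-Schwarz against the constant 1, which has norm 1 because the measure is
  normalized.\<close>

lemma L1_norm_le_norm: "L1_norm f \<le> norm f"
proof -
  obtain g where g: "square_integrable g" "f = L2_of g" by (rule L2_of_cases)
  let ?h = "\<lambda>\<xi>. complex_of_real (cmod (g \<xi>))"
  have "complex_of_real (L1_norm f) = cinner (L2_of ?h) (L2_of (\<lambda>_. 1))"
    using g by (simp add: L1_norm_L2_of cinner_L2_of square_integrable_norm square_integrable_one)
  then have "\<bar>L1_norm f\<bar> \<le> norm (L2_of ?h) * norm (L2_of (\<lambda>_. 1))"
    using norm_cinner_le by (metis norm_of_real real_norm_def)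
  also have "norm (L2_of ?h) \<le> 1 * norm (L2_of g)"
    using g by (intro norm_L2_of_mono) (auto intro: square_integrable_norm)
  finally show ?thesis using g by (simp add: norm_L2_of_one)
qed

lemma L1_norm_scaleR: "L1_norm (r *\<^sub>R f) = \<bar>r\<bar> * L1_norm f"
  by (cases f rule: L2_of_cases)
    (simp add: scaleR_scaleC scaleC_L2_of L1_norm_L2_of square_integrable_scale norm_mult)

lemma L1_norm_triangle: "L1_norm (f + g) \<le> L1_norm f + L1_norm g"
proof -
  obtain f' where f: "square_integrable f'" "f = L2_of f'" by (rule L2_of_cases)
  obtain g' where g: "square_integrable g'" "g = L2_of g'" by (rule L2_of_cases)
  have "(\<integral>\<xi>. cmod (f' \<xi> + g' \<xi>) \<partial>circle) \<le> (\<integral>\<xi>. cmod (f' \<xi>) + cmod (g' \<xi>) \<partial>circle)"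
    using f g by (intro integral_mono integrable_norm Bochner_Integration.integrable_add
        square_integrable_imp_integrable square_integrable_add norm_triangle_ineq)
  also have "\<dots> = (\<integral>\<xi>. cmod (f' \<xi>) \<partial>circle) + (\<integral>\<xi>. cmod (g' \<xi>) \<partial>circle)"
    using f g by (intro Bochner_Integration.integral_add integrable_norm square_integrable_imp_integrable)
  finally show ?thesis
    using f g by (simp add: add_L2_of L1_norm_L2_of square_integrable_add)
qed

lemma nn_integral_norm_L2_of:
  assumes "square_integrable f"
  shows "(\<integral>\<^sup>+\<xi>. ennreal ((cmod (f \<xi>))\<^sup>2) \<partial>circle) = ennreal ((norm (L2_of f))\<^sup>2)"
  unfolding norm_L2_of[OF assms]
  using assms by (intro nn_integral_eq_integral) (auto simp: square_integrable_def)

lemma fast_Cauchy_subsequence: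
  fixes X :: "nat \<Rightarrow> 'a::metric_space"
  assumes "Cauchy X"
  obtains r where "strict_mono (r :: nat \<Rightarrow> nat)" "\<And>n. dist (X (r (Suc n))) (X (r n)) \<le> (1/2) ^ n"
proof -
  have "\<exists>N. \<forall>m\<ge>N. \<forall>k\<ge>N. dist (X m) (X k) < (1/2) ^ n" for n
    by (rule metric_CauchyD[OF assms]) simp
  then obtain N where N: "\<And>n m k. m \<ge> N n \<Longrightarrow> k \<ge> N n \<Longrightarrow> dist (X m) (X k) < (1/2) ^ n"
    by metis
  \<comment> \<open>Summing all thresholds up to \<open>n\<close> puts \<open>r n\<close> beyond
    \<open>N n\<close>; the extra \<open>n\<close> makes \<open>r\<close> strictly
    increasing.\<close>
  define r where "r n = (\<Sum>i\<le>n. N i) + n" for n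
  have "strict_mono r" by (rule strict_monoI_Suc) (simp add: r_def)
  moreover have "r n \<ge> N n" for n
    by (induction n) (simp_all add: r_def)
  then have "dist (X (r (Suc n))) (X (r n)) \<le> (1/2) ^ n" for n
    using strict_monoD[OF \<open>strict_mono r\<close>, of n "Suc n"] by (meson N less_imp_le lessI order_trans)
  ultimately show thesis using that by blast
qed

text \<open>The increments have L1 norms dominated by a geometric series, so the sum of their moduli
  has a finite integral and is finite almost everywhere; the sequence is the telescoping sum of its
  increments.\<close>

lemma AE_convergent_fast_Cauchy:
  fixes X :: "nat \<Rightarrow> L2"
  assumes "\<And>n. dist (X (Suc n)) (X n) \<le> (1/2) ^ n"
  shows "AE \<xi> in circle. convergent (\<lambda>n. rep_L2 (X n) \<xi>)"
proof -
  define F where "F n = rep_L2 (X n)" for n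
  have sq: "square_integrable (F n)" for n by (simp add: F_def square_integrable_rep)
  note [measurable] = square_integrable_measurable[OF sq]
  define G where "G n \<xi> = cmod (F (Suc n) \<xi> - F n \<xi>)" for n \<xi>
  have [measurable]: "G n \<in> borel_measurable borel" for n
    unfolding G_def by measurable
  have int: "(\<integral>\<^sup>+\<xi>. ennreal (G n \<xi>) \<partial>circle) \<le> ennreal ((1/2) ^ n)" for n
  proof -
    have "integrable circle (\<lambda>\<xi>. F (Suc n) \<xi> - F n \<xi>)"
      by (intro square_integrable_imp_integrable square_integrable_diff sq)
    then have "(\<integral>\<^sup>+\<xi>. ennreal (G n \<xi>) \<partial>circle) = ennreal (\<integral>\<xi>. cmod (F (Suc n) \<xi> - F n \<xi>) \<partial>circle)"
      unfolding G_def by (intro nn_integral_eq_integral) auto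
    also have "(\<integral>\<xi>. cmod (F (Suc n) \<xi> - F n \<xi>) \<partial>circle) = L1_norm (X (Suc n) - X n)"
      using L1_norm_L2_of[OF square_integrable_diff[OF sq sq], of "Suc n" n]
      by (simp add: diff_L2_of[symmetric] sq) (simp add: F_def L2_of_rep)
    also have "\<dots> \<le> (1/2) ^ n"
      using L1_norm_le_norm assms by (metis dist_norm order_trans)
    finally show ?thesis by (simp add: ennreal_leI)
  qed
  have "(\<integral>\<^sup>+\<xi>. (\<Sum>n. ennreal (G n \<xi>)) \<partial>circle) = (\<Sum>n. \<integral>\<^sup>+\<xi>. ennreal (G n \<xi>) \<partial>circle)"
    by (rule nn_integral_suminf) simp
  also have "\<dots> \<le> (\<Sum>n. ennreal ((1/2) ^ n))"
    by (intro suminf_le int) auto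
  also have "\<dots> = ennreal (\<Sum>n. (1/2) ^ n)"
    by (intro suminf_ennreal2 summable_geometric) auto
  finally have "(\<integral>\<^sup>+\<xi>. (\<Sum>n. ennreal (G n \<xi>)) \<partial>circle) \<noteq> \<infinity>"
    by (auto simp: top_unique)
  then have "AE \<xi> in circle. (\<Sum>n. ennreal (G n \<xi>)) \<noteq> \<infinity>"
    by (intro nn_integral_PInf_AE) auto
  then have "AE \<xi> in circle. convergent (\<lambda>n. F n \<xi>)"
  proof eventually_elim
    case (elim \<xi>)
    then have "summable (\<lambda>n. G n \<xi>)"
      by (intro summable_suminf_not_top) (auto simp: G_def)
    then have "summable (\<lambda>n. F (Suc n) \<xi> - F n \<xi>)"
      unfolding G_def by (rule summable_norm_cancel)
    then have "convergent (\<lambda>n. F n \<xi> - F 0 \<xi>)"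
      unfolding summable_iff_convergent sum_lessThan_telescope[where f = "\<lambda>n. F n \<xi>"] .
    from convergent_add[OF this convergent_const[of "F 0 \<xi>"]] show ?case by simp
  qed
  then show ?thesis by (simp add: F_def)
qed

text \<open>Fatou's lemma, applied in the index \<open>m\<close> to |F m - F n| squared, turns the
  Cauchy bound into a bound for the distance of \<open>F n\<close> to the pointwise limit. Square
  integrability of \<open>f\<close> comes out of the same estimate.\<close>

lemma AE_limit_imp_L2_limit:
  fixes X :: "nat \<Rightarrow> L2"
  assumes X: "Cauchy X" and f [measurable]: "f \<in> borel_measurable borel"
    and lim: "AE \<xi> in circle. (\<lambda>n. rep_L2 (X n) \<xi>) \<longlonglongrightarrow> f \<xi>"
  shows "convergent X"
proof -
  define F where "F n = rep_L2 (X n)" for n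
  have sq: "square_integrable (F n)" for n by (simp add: F_def square_integrable_rep)
  note [measurable] = square_integrable_measurable[OF sq]
  have X_eq: "X n = L2_of (F n)" for n by (simp add: F_def L2_of_rep)
  have *: "\<exists>N. \<forall>n\<ge>N. square_integrable (\<lambda>\<xi>. f \<xi> - F n \<xi>) \<and>
      norm (L2_of (\<lambda>\<xi>. f \<xi> - F n \<xi>)) \<le> e" if e: "e > 0" for e
  proof -
    obtain N where N: "\<And>m n. m \<ge> N \<Longrightarrow> n \<ge> N \<Longrightarrow> dist (X m) (X n) < e"
      using metric_CauchyD[OF X e] by blast
    have "square_integrable (\<lambda>\<xi>. f \<xi> - F n \<xi>) \<and> norm (L2_of (\<lambda>\<xi>. f \<xi> - F n \<xi>)) \<le> e"
      if n: "n \<ge> N" for n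
    proof -
      have "(\<integral>\<^sup>+\<xi>. ennreal ((cmod (f \<xi> - F n \<xi>))\<^sup>2) \<partial>circle)
          = (\<integral>\<^sup>+\<xi>. liminf (\<lambda>m. ennreal ((cmod (F m \<xi> - F n \<xi>))\<^sup>2)) \<partial>circle)"
      proof (rule nn_integral_cong_AE)
        show "AE \<xi> in circle. ennreal ((cmod (f \<xi> - F n \<xi>))\<^sup>2)
            = liminf (\<lambda>m. ennreal ((cmod (F m \<xi> - F n \<xi>))\<^sup>2))"
          using lim
        proof eventually_elim
          case (elim \<xi>)
          then have "(\<lambda>m. ennreal ((cmod (F m \<xi> - F n \<xi>))\<^sup>2)) \<longlonglongrightarrow> ennreal ((cmod (f \<xi> - F n \<xi>))\<^sup>2)"
            unfolding F_def by (intro tendsto_intros)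
          then show ?case by (intro lim_imp_Liminf[symmetric]) auto
        qed
      qed
      also have "\<dots> \<le> liminf (\<lambda>m. \<integral>\<^sup>+\<xi>. ennreal ((cmod (F m \<xi> - F n \<xi>))\<^sup>2) \<partial>circle)"
        by (rule nn_integral_liminf) simp
      also have "\<dots> \<le> liminf (\<lambda>m. ennreal (e\<^sup>2))"
      proof (rule Liminf_mono)
        show "\<forall>\<^sub>F m in sequentially.
            (\<integral>\<^sup>+\<xi>. ennreal ((cmod (F m \<xi> - F n \<xi>))\<^sup>2) \<partial>circle) \<le> ennreal (e\<^sup>2)"
          using eventually_ge_at_top[of N]
        proof eventually_elim
          case (elim m)
          have "norm (X m - X n) \<le> e" using N[OF elim n] by (simp add: dist_norm)
          then show ?case
            by (subst nn_integral_norm_L2_of) (auto intro!: square_integrable_diff sq ennreal_leI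
                power_mono simp: diff_L2_of[symmetric] sq X_eq)
        qed
      qed
      finally have le: "(\<integral>\<^sup>+\<xi>. ennreal ((cmod (f \<xi> - F n \<xi>))\<^sup>2) \<partial>circle) \<le> ennreal (e\<^sup>2)"
        by (simp add: Liminf_const)
      then have "integrable circle (\<lambda>\<xi>. (cmod (f \<xi> - F n \<xi>))\<^sup>2)"
        by (intro integrableI_bounded) (auto simp: top_unique less_top[symmetric])
      then have s: "square_integrable (\<lambda>\<xi>. f \<xi> - F n \<xi>)"
        by (simp add: square_integrable_def)
      moreover have "norm (L2_of (\<lambda>\<xi>. f \<xi> - F n \<xi>)) \<le> e"
      proof (rule power2_le_imp_le)
        show "(norm (L2_of (\<lambda>\<xi>. f \<xi> - F n \<xi>)))\<^sup>2 \<le> e\<^sup>2"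
          using le unfolding nn_integral_norm_L2_of[OF s] by (simp add: ennreal_le_iff)
      qed (use e in simp)
      ultimately show ?thesis by blast
    qed
    then show ?thesis by blast
  qed
  obtain n0 where "square_integrable (\<lambda>\<xi>. f \<xi> - F n0 \<xi>)"
    using *[of 1] by auto
  from square_integrable_add[OF this sq[of n0]] have f_sq: "square_integrable f" by simp
  have "X \<longlonglongrightarrow> L2_of f"
  proof (rule metric_LIMSEQ_I)
    fix e :: real assume "e > 0"
    then obtain N where N: "\<And>n. n \<ge> N \<Longrightarrow> norm (L2_of (\<lambda>\<xi>. f \<xi> - F n \<xi>)) \<le> e / 2"
      using *[of "e / 2"] by auto
    have "dist (X n) (L2_of f) < e" if "n \<ge> N" for n
      using N[OF that] \<open>e > 0\<close>
      by (subst dist_commute) (simp add: X_eq dist_norm diff_L2_of f_sq sq)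
    then show "\<exists>N. \<forall>n\<ge>N. dist (X n) (L2_of f) < e" by blast
  qed
  then show ?thesis by (rule convergentI)
qed

instance L2 :: complete_space
proof
  fix X :: "nat \<Rightarrow> L2" assume X: "Cauchy X"
  obtain r where r: "strict_mono r" "\<And>n. dist (X (r (Suc n))) (X (r n)) \<le> (1/2) ^ n"
    using fast_Cauchy_subsequence[OF X] by blast
  have "convergent (X \<circ> r)"
  proof (rule AE_limit_imp_L2_limit)
    show "Cauchy (X \<circ> r)" by (rule Cauchy_subseq_Cauchy[OF X r(1)])
    \<comment> \<open>\<open>lim\<close> has an unspecified value where the sequence diverges; that
      happens only on a null set, and this choice is measurable on the whole plane.\<close>
    show "(\<lambda>\<xi>. lim (\<lambda>n. rep_L2 (X (r n)) \<xi>)) \<in> borel_measurable borel"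
      by (intro borel_measurable_lim_metric rep_L2_measurable)
    show "AE \<xi> in circle. (\<lambda>n. rep_L2 ((X \<circ> r) n) \<xi>) \<longlonglongrightarrow> lim (\<lambda>n. rep_L2 (X (r n)) \<xi>)"
      using AE_convergent_fast_Cauchy[of "X \<circ> r"] r(2) by (simp add: convergent_LIMSEQ_iff)
  qed
  then show "convergent X"
    using Cauchy_converges_subseq[OF X r(1)] unfolding convergent_def by blast
qed

section \<open>Orthogonal projections\<close>

text \<open>\<open>subspace\<close> speaks of real scalars only, since \<open>L2\<close> is an
  instance of \<open>real_inner\<close>; closure under complex scalars is what makes projections
  orthogonal for \<open>cinner\<close>.\<close>

definition closed_subspace :: "L2 set \<Rightarrow> bool" where
  "closed_subspace M \<longleftrightarrow> closed M \<and> 0 \<in> M \<and> (\<forall>f\<in>M. \<forall>g\<in>M. f + g \<in> M) \<and> (\<forall>c. \<forall>f\<in>M. c *\<^sub>C f \<in> M)"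

lemma closed_subspaceD:
  assumes "closed_subspace M"
  shows "closed M" "subspace M" "f \<in> M \<Longrightarrow> c *\<^sub>C f \<in> M"
    "f \<in> M \<Longrightarrow> g \<in> M \<Longrightarrow> f + g \<in> M" "f \<in> M \<Longrightarrow> g \<in> M \<Longrightarrow> f - g \<in> M"
proof -
  show M: "subspace M"
    using assms by (auto simp: closed_subspace_def subspace_def scaleR_scaleC)
  show "f \<in> M \<Longrightarrow> g \<in> M \<Longrightarrow> f - g \<in> M" using M by (rule subspace_diff)
qed (use assms in \<open>auto simp: closed_subspace_def\<close>)

lemma proj_equality:
  assumes M: "closed_subspace M" and g: "g \<in> M" "\<And>h. h \<in> M \<Longrightarrow> cinner (f - g) h = 0"
  shows "proj M f = g"
  unfolding proj_def
proof (rule the_equality)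
  fix g' assume g': "g' \<in> M \<and> (\<forall>h\<in>M. cinner (f - g') h = 0)"
  show "g' = g"
  proof (rule cinner_zero_imp_eq)
    show "cinner g' h = cinner g h" if "h \<in> M" for h
      using g(2)[OF that] g' that by (simp add: cinner_diff_left)
    show "g' - g \<in> M" using g' g by (intro closed_subspaceD(5)[OF M]) auto
  qed
qed (use g in auto)

lemma proj_exists:
  assumes M: "closed_subspace M"
  shows "\<exists>g\<in>M. \<forall>h\<in>M. cinner (f - g) h = 0"
proof -
  obtain g where g: "g \<in> M" "\<And>h. h \<in> M \<Longrightarrow> inner (f - g) h = 0"
    using orthogonal_projection_exists[OF closed_subspaceD(2,1)[OF M]] by blast
  have "cinner (f - g) h = 0" if "h \<in> M" for h
    using g(2)[OF that] g(2)[OF closed_subspaceD(3)[OF M that, of \<i>]]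
    by (simp add: complex_eq_iff Im_cinner inner_L2_def)
  with g show ?thesis by blast
qed

lemma proj_in: "closed_subspace M \<Longrightarrow> proj M f \<in> M"
  using proj_exists[of M f] proj_equality by metis

lemma cinner_proj:
  assumes M: "closed_subspace M" and h: "h \<in> M"
  shows "cinner (proj M f) h = cinner f h" "cinner h (proj M f) = cinner h f"
proof -
  obtain g where g: "g \<in> M" "\<And>h. h \<in> M \<Longrightarrow> cinner (f - g) h = 0"
    using proj_exists[OF M] by blast
  with proj_equality[OF M g] h show *: "cinner (proj M f) h = cinner f h"
    by (simp add: cinner_diff_left)
  then show "cinner h (proj M f) = cinner h f"
    using cinner_commute[of h "proj M f"] cinner_commute[of h f] by simp
qed

lemma proj_eqI:
  assumes "closed_subspace M" "g \<in> M" "\<And>h. h \<in> M \<Longrightarrow> cinner f h = cinner g h"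
  shows "proj M f = g"
  using assms by (intro proj_equality) (auto simp: cinner_diff_left)

lemma proj_id: "closed_subspace M \<Longrightarrow> f \<in> M \<Longrightarrow> proj M f = f"
  by (rule proj_eqI) auto

lemma proj_add:
  assumes "closed_subspace M"
  shows "proj M (f + g) = proj M f + proj M g"
  using assms by (intro proj_eqI) (auto simp: proj_in closed_subspaceD cinner_add_left cinner_proj)

lemma proj_diff:
  assumes "closed_subspace M"
  shows "proj M (f - g) = proj M f - proj M g"
  using assms by (intro proj_eqI) (auto simp: proj_in closed_subspaceD cinner_diff_left cinner_proj)

lemma proj_scaleC:
  assumes "closed_subspace M"
  shows "proj M (c *\<^sub>C f) = c *\<^sub>C proj M f"
  using assms by (intro proj_eqI) (auto simp: proj_in closed_subspaceD cinner_scaleC_left cinner_proj)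

lemma norm_proj_le:
  assumes "closed_subspace M"
  shows "norm (proj M f) \<le> norm f"
proof -
  have "complex_of_real ((norm (proj M f))\<^sup>2) = cinner f (proj M f)"
    unfolding cinner_self[symmetric] using cinner_proj(1)[OF assms proj_in[OF assms]] .
  then have "norm (complex_of_real ((norm (proj M f))\<^sup>2)) \<le> norm f * norm (proj M f)"
    using norm_cinner_le[of f "proj M f"] by (simp only:)
  then have "norm (proj M f) * norm (proj M f) \<le> norm f * norm (proj M f)"
    by (simp add: power2_eq_square norm_mult)
  then show ?thesis
    by (cases "proj M f = 0") (simp_all add: mult_le_cancel_right)
qed

lemma bounded_linear_proj: "closed_subspace M \<Longrightarrow> bounded_linear (proj M)"
  by (rule bounded_linear_intro[of _ 1]) (simp_all add: proj_add scaleR_scaleC proj_scaleC norm_proj_le)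

lemma adjoint_on_equality:
  assumes M: "closed_subspace M" and h: "h \<in> M" "\<And>f. f \<in> M \<Longrightarrow> cinner (T f) g = cinner f h"
  shows "adjoint_on M T g = h"
  unfolding adjoint_on_def
proof (rule the_equality)
  fix h' assume h': "h' \<in> M \<and> (\<forall>f\<in>M. cinner (T f) g = cinner f h')"
  show "h' = h"
  proof (rule cinner_zero_imp_eq)
    show "cinner h' f = cinner h f" if "f \<in> M" for f
      using h(2)[OF that] h' that cinner_commute[of h' f] cinner_commute[of h f] by metis
    show "h' - h \<in> M" using h' h by (intro closed_subspaceD(5)[OF M]) auto
  qed
qed (use h in auto)

section \<open>Completeness of the Fourier basis\<close>

text \<open>Dynkin's theorem: closed sets generate the Borel sets and are stable under intersection.
  The complement step uses that the whole plane is closed.\<close>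

lemma set_integral_zero_borel:
  fixes g :: "complex \<Rightarrow> complex"
  assumes g: "integrable circle g"
    and closed: "\<And>F. closed F \<Longrightarrow> set_lebesgue_integral circle F g = 0"
    and B: "B \<in> sets borel"
  shows "set_lebesgue_integral circle B g = 0"
proof -
  have int: "set_integrable circle A g" if "A \<in> sets borel" for A
    unfolding set_integrable_def using that g by (intro integrable_mult_indicator) auto
  have "Int_stable (Collect closed)" "Collect closed \<subseteq> Pow UNIV"
    "B \<in> sigma_sets UNIV (Collect (closed :: complex set \<Rightarrow> bool))"
    using B by (auto simp: Int_stable_def borel_eq_closed)
  then show ?thesis
  proof (induct B rule: sigma_sets_induct_disjoint)
    case (compl A)
    then have A: "A \<in> sets borel" by (simp add: borel_eq_closed)
    have "set_lebesgue_integral circle (A \<union> (UNIV - A)) g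
        = set_lebesgue_integral circle A g + set_lebesgue_integral circle (UNIV - A) g"
      using A by (intro set_integral_Un int) auto
    with compl closed[of UNIV] show ?case by simp
  next
    case (union A)
    then have A: "A i \<in> sets borel" for i by (auto simp: borel_eq_closed)
    have "set_lebesgue_integral circle (\<Union>i. A i) g = (\<Sum>i. set_lebesgue_integral circle (A i) g)"
      using union(1) A by (intro lebesgue_integral_countable_add int) (auto simp: disjoint_family_on_def)
    with union show ?case by simp
  qed (use closed in auto)
qed

text \<open>The indicator of a closed set is a pointwise limit of continuous functions with values
  between 0 and 1, built from the distance to the set. Dominated convergence then transfers the
  hypothesis to closed sets.\<close>

lemma AE_zero_if_integral_continuous_zero:
  fixes g :: "complex \<Rightarrow> complex"
  assumes g: "integrable circle g"
    and zero: "\<And>p :: complex \<Rightarrow> real. continuous_on UNIV p \<Longrightarrow> (\<integral>\<xi>. complex_of_real (p \<xi>) * g \<xi> \<partial>circle) = 0"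
  shows "AE \<xi> in circle. g \<xi> = 0"
proof (rule circle.density_zero[OF g])
  have g_m [measurable]: "g \<in> borel_measurable borel"
    using borel_measurable_integrable[OF g] by simp
  have "set_lebesgue_integral circle F g = 0" if F: "closed F" for F
  \<comment> \<open>By convention \<open>infdist\<close> to the empty set is 0, so the approximating
    functions below would be constantly 1 instead of tending to 0.\<close>
  proof (cases "F = {}")
    case True
    then show ?thesis by (simp add: set_lebesgue_integral_def)
  next
    case False
    let ?p = "\<lambda>(k::nat) \<xi>. max 0 (1 - real k * infdist \<xi> F)"
    have cont: "continuous_on UNIV (?p k)" for k
      by (intro continuous_intros)
    have [measurable]: "?p k \<in> borel_measurable borel" for k
      by (intro borel_measurable_continuous_onI cont)
    have lim: "(\<lambda>k. ?p k \<xi>) \<longlonglongrightarrow> indicator F \<xi>" for \<xi>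
    proof (cases "\<xi> \<in> F")
      case False
      with F \<open>F \<noteq> {}\<close> have "infdist \<xi> F > 0"
        using in_closed_iff_infdist_zero[OF F, of \<xi>] infdist_nonneg[of \<xi> F] by auto
      then obtain N where N: "real N * infdist \<xi> F > 1"
        using reals_Archimedean3 by blast
      have "?p k \<xi> = 0" if "k \<ge> N" for k
      proof -
        have "real k * infdist \<xi> F \<ge> real N * infdist \<xi> F"
          using that by (intro mult_right_mono) (auto simp: infdist_nonneg)
        with N show ?thesis by simp
      qed
      then have "\<forall>\<^sub>F k in sequentially. ?p k \<xi> = indicator F \<xi>"
        using False by (auto simp: eventually_sequentially)
      then show ?thesis by (rule tendsto_eventually)
    qed (simp add: infdist_zero)
    have "(\<lambda>k. \<integral>\<xi>. complex_of_real (?p k \<xi>) * g \<xi> \<partial>circle)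
        \<longlonglongrightarrow> (\<integral>\<xi>. indicat_real F \<xi> *\<^sub>R g \<xi> \<partial>circle)"
    proof (rule integral_dominated_convergence)
      show "AE \<xi> in circle. (\<lambda>k. complex_of_real (?p k \<xi>) * g \<xi>) \<longlonglongrightarrow> indicat_real F \<xi> *\<^sub>R g \<xi>"
        unfolding scaleR_conv_of_real by (intro AE_I2 tendsto_intros lim)
      show "AE \<xi> in circle. norm (complex_of_real (?p k \<xi>) * g \<xi>) \<le> norm (g \<xi>)" for k
      proof (rule AE_I2)
        fix \<xi>
        have "\<bar>?p k \<xi>\<bar> \<le> 1" by (simp add: infdist_nonneg)
        then have "\<bar>?p k \<xi>\<bar> * norm (g \<xi>) \<le> 1 * norm (g \<xi>)" by (intro mult_right_mono) auto
        then show "norm (complex_of_real (?p k \<xi>) * g \<xi>) \<le> norm (g \<xi>)" by (simp add: norm_mult)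
      qed
      show "(\<lambda>\<xi>. indicat_real F \<xi> *\<^sub>R g \<xi>) \<in> borel_measurable circle"
        using F by (simp add: borel_closed)
    qed (use g in auto)
    moreover have "(\<lambda>k. \<integral>\<xi>. complex_of_real (?p k \<xi>) * g \<xi> \<partial>circle) = (\<lambda>_. 0)"
      using zero[OF cont] by (intro ext)
    ultimately show ?thesis
      unfolding set_lebesgue_integral_def by (metis LIMSEQ_const_iff)
  qed
  with set_integral_zero_borel[OF g] show "set_lebesgue_integral circle A g = 0"
    if "A \<in> sets circle" for A
    using that by simp
qed

lemma cnj_unit_circle: "cmod \<xi> = 1 \<Longrightarrow> cnj \<xi> = inverse \<xi>"
  by (rule inverse_unique[symmetric]) (simp add: complex_norm_square[symmetric])

lemma fourier_coeff_mult_powi: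
  "fourier_coeff (mult_L2 (\<lambda>\<xi>. \<xi> powi k) f) n = fourier_coeff f (n - k)"
proof -
  have "mult_L2 (\<lambda>\<xi>. cnj (\<xi> powi k)) (L2_of (\<lambda>\<xi>. \<xi> powi n)) = L2_of (\<lambda>\<xi>. \<xi> powi (n - k))"
  proof -
    have "AE \<xi> in circle. cnj (\<xi> powi k) * \<xi> powi n = \<xi> powi (n - k)"
      using AE_circle_norm
    proof eventually_elim
      case (elim \<xi>)
      then have "cnj \<xi> = inverse \<xi>" "\<xi> \<noteq> 0" by (auto simp: cnj_unit_circle)
      then show ?case
        by (simp add: power_int_diff power_int_inverse divide_inverse mult.commute)
    qed
    then show ?thesis
      unfolding mult_L2_of[OF Linfty_cnj[OF Linfty_powi] square_integrable_Linfty[OF Linfty_powi]]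
      by (intro L2_of_eqI square_integrable_Linfty Linfty_mult Linfty_cnj Linfty_powi)
  qed
  then show ?thesis
    unfolding fourier_coeff_def mult_L2_adjoint[OF Linfty_powi] by (rule arg_cong)
qed

lemma fourier_coeff_linear:
  "fourier_coeff (f + g) n = fourier_coeff f n + fourier_coeff g n"
  "fourier_coeff (f - g) n = fourier_coeff f n - fourier_coeff g n"
  "fourier_coeff (c *\<^sub>C f) n = c * fourier_coeff f n"
  by (simp_all add: fourier_coeff_def cinner_add_left cinner_diff_left cinner_scaleC_left)

text \<open>Multiplications that map a vector with no Fourier coefficients to another such vector.
  Phrased this way the class is visibly closed under sums and products, which is the form that the
  Stone-Weierstrass theorem asks for.\<close>

definition vanishing_multiplier :: "(complex \<Rightarrow> complex) \<Rightarrow> bool" where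
  "vanishing_multiplier q \<longleftrightarrow> q \<in> Linfty \<and>
    (\<forall>f. (\<forall>n. fourier_coeff f n = 0) \<longrightarrow> (\<forall>n. fourier_coeff (mult_L2 q f) n = 0))"

lemma vanishing_multiplier_powi: "vanishing_multiplier (\<lambda>\<xi>. \<xi> powi k)"
  by (simp add: vanishing_multiplier_def Linfty_powi fourier_coeff_mult_powi)

lemma vanishing_multiplier_const: "vanishing_multiplier (\<lambda>_. c)"
proof -
  have "mult_L2 (\<lambda>_. c) f = c *\<^sub>C f" for f
    by (cases f rule: L2_of_cases) (simp add: mult_L2_of Linfty_const scaleC_L2_of)
  then show ?thesis
    by (simp add: vanishing_multiplier_def Linfty_const fourier_coeff_linear)
qed

lemma vanishing_multiplier_add:
  "vanishing_multiplier p \<Longrightarrow> vanishing_multiplier q \<Longrightarrow> vanishing_multiplier (\<lambda>\<xi>. p \<xi> + q \<xi>)"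
  by (simp add: vanishing_multiplier_def Linfty_add mult_L2_plus fourier_coeff_linear)

lemma vanishing_multiplier_mult:
  "vanishing_multiplier p \<Longrightarrow> vanishing_multiplier q \<Longrightarrow> vanishing_multiplier (\<lambda>\<xi>. p \<xi> * q \<xi>)"
  unfolding vanishing_multiplier_def by (metis Linfty_mult mult_L2_mult)

lemma vanishing_multiplier_cong:
  assumes "vanishing_multiplier p" "q \<in> Linfty" "AE \<xi> in circle. q \<xi> = p \<xi>"
  shows "vanishing_multiplier q"
proof -
  have "mult_L2 q f = mult_L2 p f" for f
    using assms by (intro mult_L2_cong) (auto simp: vanishing_multiplier_def)
  with assms(1,2) show ?thesis unfolding vanishing_multiplier_def by metis
qed

text \<open>Euler's formulas. They hold on the unit circle only, hence the passage through equality
  almost everywhere.\<close>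

lemma vanishing_multiplier_Re_Im:
  "vanishing_multiplier (\<lambda>\<xi>. complex_of_real (Re \<xi>))" "vanishing_multiplier (\<lambda>\<xi>. complex_of_real (Im \<xi>))"
proof -
  have AE: "AE \<xi> in circle. \<xi> powi (-1) = cnj \<xi>"
    using AE_circle_norm
    by eventually_elim (simp add: power_int_minus cnj_unit_circle)
  have 1: "vanishing_multiplier (\<lambda>\<xi>. (1/2) * (\<xi> powi 1 + \<xi> powi (-1)))"
    "vanishing_multiplier (\<lambda>\<xi>. (1/(2*\<i>)) * (\<xi> powi 1 + (-1) * \<xi> powi (-1)))"
    by (intro vanishing_multiplier_mult vanishing_multiplier_add vanishing_multiplier_const
        vanishing_multiplier_powi)+
  show "vanishing_multiplier (\<lambda>\<xi>. complex_of_real (Re \<xi>))"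
  proof (rule vanishing_multiplier_cong[OF 1(1)])
    show "(\<lambda>\<xi>. complex_of_real (Re \<xi>)) \<in> Linfty"
      using AE_circle_norm
      by (intro LinftyI[of _ 1]) (auto elim!: eventually_mono, metis abs_Re_le_cmod)
    show "AE \<xi> in circle. complex_of_real (Re \<xi>) = (1/2) * (\<xi> powi 1 + \<xi> powi (-1))"
      using AE by eventually_elim (simp add: complex_eq_iff)
  qed
  show "vanishing_multiplier (\<lambda>\<xi>. complex_of_real (Im \<xi>))"
  proof (rule vanishing_multiplier_cong[OF 1(2)])
    show "(\<lambda>\<xi>. complex_of_real (Im \<xi>)) \<in> Linfty"
      using AE_circle_norm
      by (intro LinftyI[of _ 1]) (auto elim!: eventually_mono, metis abs_Im_le_cmod)
    show "AE \<xi> in circle. complex_of_real (Im \<xi>) = (1/(2*\<i>)) * (\<xi> powi 1 + (-1) * \<xi> powi (-1))"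
      using AE by eventually_elim (simp add: complex_eq_iff Re_divide Im_divide)
  qed
qed

text \<open>Real functions that are vanishing multipliers form an algebra separating the points of
  the circle, so they approximate every continuous \<open>p\<close> uniformly there. The integral of
  such a \<open>q\<close> times \<open>f\<close> is a zeroth Fourier coefficient and vanishes, hence
  so does the integral of \<open>p\<close> times \<open>f\<close>.\<close>

lemma fourier_coeff_zero_imp_zero:
  assumes f: "\<And>n. fourier_coeff f n = 0"
  shows "f = 0"
proof -
  define g where "g = rep_L2 f"
  have g_sq: "square_integrable g" and f_eq: "f = L2_of g"
    by (simp_all add: g_def square_integrable_rep L2_of_rep)
  note g_int = square_integrable_imp_integrable[OF g_sq]
  have "(\<integral>\<xi>. complex_of_real (p \<xi>) * g \<xi> \<partial>circle) = 0" if p: "continuous_on UNIV p" for p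
  proof -
    have [measurable]: "p \<in> borel_measurable borel" by (rule borel_measurable_continuous_onI[OF p])
    have approx: "cmod (\<integral>\<xi>. complex_of_real (p \<xi>) * g \<xi> \<partial>circle) \<le> e * (\<integral>\<xi>. cmod (g \<xi>) \<partial>circle)"
      if e: "e > 0" for e
    proof -
      have "\<exists>q. (continuous_on (sphere 0 1) q \<and> vanishing_multiplier (\<lambda>\<xi>. complex_of_real (q \<xi>))) \<and>
          (\<forall>\<xi>\<in>sphere 0 1. \<bar>p \<xi> - q \<xi>\<bar> < e)"
      proof (rule Stone_Weierstrass_HOL)
        show "\<exists>q. (continuous_on (sphere 0 1) q \<and> vanishing_multiplier (\<lambda>\<xi>. complex_of_real (q \<xi>)))
            \<and> q x \<noteq> q y" if "x \<in> sphere 0 1 \<and> y \<in> sphere 0 1 \<and> x \<noteq> y" for x y :: complex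
        proof (cases "Re x = Re y")
          case True
          with that have "Im x \<noteq> Im y" by (simp add: complex_eq_iff)
          then show ?thesis
            using vanishing_multiplier_Re_Im(2)
            by (intro exI[of _ Im]) (auto intro!: continuous_intros)
        next
          case False
          then show ?thesis
            using vanishing_multiplier_Re_Im(1)
            by (intro exI[of _ Re]) (auto intro!: continuous_intros)
        qed
      qed (use p e in \<open>auto intro: continuous_on_subset continuous_intros vanishing_multiplier_const
          vanishing_multiplier_add vanishing_multiplier_mult\<close>)
      then obtain q where q: "vanishing_multiplier (\<lambda>\<xi>. complex_of_real (q \<xi>))"
        "\<And>\<xi>. cmod \<xi> = 1 \<Longrightarrow> \<bar>p \<xi> - q \<xi>\<bar> < e" by auto
      then have q_Linfty: "(\<lambda>\<xi>. complex_of_real (q \<xi>)) \<in> Linfty"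
        by (simp add: vanishing_multiplier_def)
      then have qg_sq: "square_integrable (\<lambda>\<xi>. complex_of_real (q \<xi>) * g \<xi>)"
        using g_sq by (rule square_integrable_mult)
      have [measurable]: "(\<lambda>\<xi>. complex_of_real (q \<xi>)) \<in> borel_measurable borel"
        using q_Linfty by (simp add: Linfty_def)
      have "fourier_coeff (mult_L2 (\<lambda>\<xi>. complex_of_real (q \<xi>)) f) 0 = 0"
        using q(1) f by (simp add: vanishing_multiplier_def)
      then have q0: "(\<integral>\<xi>. complex_of_real (q \<xi>) * g \<xi> \<partial>circle) = 0"
        using q_Linfty g_sq qg_sq square_integrable_one
        by (simp add: f_eq mult_L2_of fourier_coeff_def cinner_L2_of)
      have bd: "AE \<xi> in circle. cmod (complex_of_real (p \<xi> - q \<xi>) * g \<xi>) \<le> e * cmod (g \<xi>)"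
        using AE_circle_norm
      proof eventually_elim
        case (elim \<xi>)
        show ?case
          unfolding norm_mult norm_of_real using q(2)[OF elim] by (intro mult_right_mono) auto
      qed
      have int_diff: "integrable circle (\<lambda>\<xi>. complex_of_real (p \<xi> - q \<xi>) * g \<xi>)"
      proof (rule Bochner_Integration.integrable_bound)
        show "integrable circle (\<lambda>\<xi>. e * cmod (g \<xi>))" using g_int by simp
        show "AE \<xi> in circle. norm (complex_of_real (p \<xi> - q \<xi>) * g \<xi>) \<le> norm (e * cmod (g \<xi>))"
          using bd e by (simp add: abs_mult)
        show "(\<lambda>\<xi>. complex_of_real (p \<xi> - q \<xi>) * g \<xi>) \<in> borel_measurable circle"
          using square_integrable_measurable[OF g_sq] by simp
      qed
      have "(\<integral>\<xi>. complex_of_real (p \<xi>) * g \<xi> \<partial>circle)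
          = (\<integral>\<xi>. complex_of_real (p \<xi> - q \<xi>) * g \<xi> + complex_of_real (q \<xi>) * g \<xi> \<partial>circle)"
        by (simp add: algebra_simps)
      also have "\<dots> = (\<integral>\<xi>. complex_of_real (p \<xi> - q \<xi>) * g \<xi> \<partial>circle)"
        by (subst Bochner_Integration.integral_add[OF int_diff square_integrable_imp_integrable[OF qg_sq]])
          (simp add: q0)
      also have "cmod \<dots> \<le> (\<integral>\<xi>. cmod (complex_of_real (p \<xi> - q \<xi>) * g \<xi>) \<partial>circle)"
        by (rule integral_norm_bound)
      also have "\<dots> \<le> (\<integral>\<xi>. e * cmod (g \<xi>) \<partial>circle)"
        using bd g_int int_diff by (intro integral_mono_AE) auto
      finally show ?thesis by simp
    qed
    define G where "G = (\<integral>\<xi>. cmod (g \<xi>) \<partial>circle)"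
    have G: "G \<ge> 0" by (simp add: G_def)
    have "cmod (\<integral>\<xi>. complex_of_real (p \<xi>) * g \<xi> \<partial>circle) \<le> 0 + e" if e: "e > 0" for e
    proof -
      \<comment> \<open>Dividing by \<open>G + 1\<close> instead of \<open>G\<close> covers the case
        that the L1 norm \<open>G\<close> is zero.\<close>
      have "e / (G + 1) * G \<le> e" using e G by (simp add: field_simps)
      with approx[of "e / (G + 1)"] e G show ?thesis by (simp add: G_def[symmetric])
    qed
    then have "cmod (\<integral>\<xi>. complex_of_real (p \<xi>) * g \<xi> \<partial>circle) \<le> 0"
      by (rule field_le_epsilon)
    then show ?thesis by simp
  qed
  then have "AE \<xi> in circle. g \<xi> = 0"
    by (rule AE_zero_if_integral_continuous_zero[OF g_int])
  then show ?thesis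
    using g_sq by (simp add: f_eq zero_L2_eq L2_of_eq_iff square_integrable_def)
qed

section \<open>Factorization of analytic polynomials\<close>

text \<open>Only values on the closed disk are constrained. Before a member is used as a symbol it
  is cut off by the indicator of the disk, which makes it measurable on the plane without changing
  it on the circle.\<close>

definition disk_algebra :: "(complex \<Rightarrow> complex) set" where
  "disk_algebra = {f. continuous_on (cball 0 1) f \<and> f holomorphic_on ball 0 1}"

lemma disk_algebra_const: "(\<lambda>_. c) \<in> disk_algebra"
  by (simp add: disk_algebra_def)

lemma disk_algebra_mult:
  "f \<in> disk_algebra \<Longrightarrow> g \<in> disk_algebra \<Longrightarrow> (\<lambda>z. f z * g z) \<in> disk_algebra"
  by (auto simp: disk_algebra_def intro!: continuous_intros holomorphic_intros)

text \<open>The dilation f (r z) is uniformly close to \<open>f\<close> by uniform continuity, and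
  its Taylor series converges uniformly on the closed disk because \<open>r\<close> lies inside the
  disk of convergence.\<close>

lemma disk_algebra_poly_approx:
  assumes f: "f \<in> disk_algebra" and e: "e > 0"
  obtains p where "\<And>z. cmod z \<le> 1 \<Longrightarrow> cmod (f z - poly p z) < e"
proof -
  have hol: "f holomorphic_on ball 0 1" and "uniformly_continuous_on (cball 0 1) f"
    using f compact_uniformly_continuous[OF _ compact_cball] by (auto simp: disk_algebra_def)
  then obtain d where d: "d > 0"
    "\<And>z w. cmod z \<le> 1 \<Longrightarrow> cmod w \<le> 1 \<Longrightarrow> dist w z < d \<Longrightarrow> dist (f w) (f z) < e / 2"
    using e unfolding uniformly_continuous_on_def by (metis half_gt_zero mem_cball_0)
  obtain r :: real where r: "0 < r" "1 - d < r" "r < 1"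
    using dense[of "max 0 (1 - d)" 1] d(1) by auto
  \<comment> \<open>Convergence of the series at the larger radius \<open>s\<close> gives absolute
    convergence at \<open>r\<close>.\<close>
  obtain s where s: "r < s" "s < 1" using dense[OF r(3)] by blast
  define a where "a n = (deriv ^^ n) f 0 / fact n" for n
  have sums: "(\<lambda>n. a n * w ^ n) sums f w" if "cmod w < 1" for w
    using holomorphic_power_series[OF hol, of w] that by (simp add: a_def)
  have "summable (\<lambda>n. a n * of_real s ^ n)"
    using sums[of "of_real s"] s r by (auto simp: summable_def)
  then have sm: "summable (\<lambda>n. cmod (a n * of_real r ^ n))"
    by (rule powser_insidea) (use s r in auto)
  obtain N where N: "\<And>n. n \<ge> N \<Longrightarrow> norm (\<Sum>i. cmod (a (i + n) * of_real r ^ (i + n))) < e / 2"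
    using suminf_exist_split[OF _ sm, of "e / 2"] e by auto
  define p where "p = (\<Sum>n<N. monom (a n * of_real r ^ n) n)"
  have "cmod (f z - poly p z) < e" if z: "cmod z \<le> 1" for z
  proof -
    let ?t = "\<lambda>n. a n * (of_real r * z) ^ n"
    have "r * cmod z \<le> r" using r z by (intro mult_left_le) auto
    moreover have "cmod (of_real r * z) = r * cmod z" using r by (simp add: norm_mult)
    ultimately have rz: "cmod (of_real r * z) < 1" "cmod (of_real r * z) \<le> 1"
      using r by linarith+
    have tm: "?t sums f (of_real r * z)" by (rule sums[OF rz(1)])
    have t_le: "cmod (?t n) \<le> cmod (a n * of_real r ^ n)" for n
      unfolding norm_mult norm_power power_mult_distrib
      using z by (intro mult_left_mono mult_left_le power_le_one) auto
    have "f (of_real r * z) - poly p z = (\<Sum>n. ?t (n + N))"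
      using suminf_minus_initial_segment[OF sums_summable[OF tm], of N] sums_unique[OF tm]
      by (simp add: p_def poly_sum poly_monom power_mult_distrib mult.assoc)
    also have "cmod \<dots> \<le> (\<Sum>n. cmod (a (n + N) * of_real r ^ (n + N)))"
      by (rule norm_suminf_le[OF t_le]) (rule summable_ignore_initial_segment[OF sm])
    also have "\<dots> < e / 2" using N[of N] by simp
    finally have 1: "cmod (f (of_real r * z) - poly p z) < e / 2" .
    have "dist z (of_real r * z) = (1 - r) * cmod z"
    proof -
      have "z - of_real r * z = of_real (1 - r) * z" by (simp add: algebra_simps)
      then show ?thesis unfolding dist_norm using r by (simp only: norm_mult norm_of_real)
    qed
    also have "\<dots> \<le> 1 - r" using r z by (simp add: mult_left_le)
    also have "\<dots> < d" using r by simp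
    finally have "cmod (f z - f (of_real r * z)) < e / 2"
      using d(2)[OF rz(2) z] by (simp add: dist_norm)
    with 1 show ?thesis
      using norm_triangle_ineq[of "f z - f (of_real r * z)" "f (of_real r * z) - poly p z"] by simp
  qed
  with that show thesis by blast
qed

text \<open>The branch cut meets this half-plane only in 0, where continuity follows from |csqrt w|
  = sqrt |w|. The point 0 cannot be left out: zeros of the polynomial on the circle are sent
  there.\<close>

lemma continuous_on_csqrt_right_halfplane: "continuous_on {z. Re z \<ge> 0} csqrt"
  unfolding continuous_on_eq_continuous_within
proof
  fix z assume z: "z \<in> {z. Re z \<ge> 0}"
  show "continuous (at z within {z. Re z \<ge> 0}) csqrt"
  proof (cases "z = 0")
    case True
    have "((\<lambda>w. sqrt (cmod w)) \<longlongrightarrow> sqrt (cmod 0)) (at (0::complex) within {z. Re z \<ge> 0})"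
      by (intro tendsto_intros)
    then have "((\<lambda>w. norm (csqrt w)) \<longlongrightarrow> 0) (at 0 within {z. Re z \<ge> 0})"
      by simp
    then have "(csqrt \<longlongrightarrow> 0) (at 0 within {z. Re z \<ge> 0})"
      by (rule tendsto_norm_zero_cancel)
    then show ?thesis
      using True by (simp add: continuous_within)
  next
    case False
    with z have "z \<notin> \<real>\<^sub>\<le>\<^sub>0" by (auto simp: complex_nonpos_Reals_iff complex_eq_iff)
    then show ?thesis by (rule continuous_within_csqrt)
  qed
qed

lemma disk_algebra_csqrt:
  assumes b: "cmod b \<le> 1"
  shows "(\<lambda>z. csqrt (1 - b * z)) \<in> disk_algebra"
proof -
  have Re: "Re (b * z) \<le> cmod z" for z
    using complex_Re_le_cmod[of "b * z"] b mult_right_mono[OF b norm_ge_zero[of z]]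
    by (simp add: norm_mult)
  have "continuous_on (cball 0 1) (\<lambda>z. csqrt (1 - b * z))"
  proof (rule continuous_on_compose2[OF continuous_on_csqrt_right_halfplane])
    show "(\<lambda>z. 1 - b * z) ` cball 0 1 \<subseteq> {z. Re z \<ge> 0}"
    proof
      fix w assume "w \<in> (\<lambda>z. 1 - b * z) ` cball 0 1"
      then obtain z where "w = 1 - b * z" "z \<in> cball 0 1" by (rule imageE)
      with Re[of z] show "w \<in> {z. Re z \<ge> 0}" by simp
    qed
  qed (intro continuous_intros)
  moreover have "(\<lambda>z. csqrt (1 - b * z)) holomorphic_on ball 0 1"
  proof (intro holomorphic_intros)
    fix z :: complex assume "z \<in> ball 0 1"
    with Re[of z] have "Re (1 - b * z) > 0" by simp
    then show "1 - b * z \<notin> \<real>\<^sub>\<le>\<^sub>0" by (auto simp: complex_nonpos_Reals_iff)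
  qed
  ultimately show ?thesis by (simp add: disk_algebra_def)
qed

text \<open>On the circle z times its conjugate is 1, so the denominator is \<open>z\<close> times
  the conjugate of the numerator and both have the same modulus.\<close>

lemma disk_algebra_Blaschke_factor:
  assumes a: "cmod a < 1"
  shows "(\<lambda>z. (z - a) / (1 - cnj a * z)) \<in> disk_algebra"
    and "cmod z \<le> 1 \<Longrightarrow> 1 - cnj a * z \<noteq> 0"
    and "cmod z = 1 \<Longrightarrow> cmod ((z - a) / (1 - cnj a * z)) = 1"
proof -
  show nz: "1 - cnj a * z \<noteq> 0" if "cmod z \<le> 1" for z
  proof
    assume "1 - cnj a * z = 0"
    then have "cmod (cnj a * z) = 1" by (metis eq_iff_diff_eq_0 norm_one)
    then show False
      using a that mult_left_le[of "cmod z" "cmod a"] by (simp add: norm_mult)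
  qed
  then show "(\<lambda>z. (z - a) / (1 - cnj a * z)) \<in> disk_algebra"
    by (auto simp: disk_algebra_def intro!: continuous_intros holomorphic_intros)
  show "cmod ((z - a) / (1 - cnj a * z)) = 1" if z: "cmod z = 1"
  proof -
    have "z * cnj z = 1" using z by (simp add: complex_norm_square[symmetric])
    then have "1 - cnj a * z = z * cnj (z - a)" by (simp add: algebra_simps)
    then have "cmod (1 - cnj a * z) = cmod (z - a)"
      using z by (simp add: norm_mult del: complex_cnj_diff)
    moreover have "cmod (1 - cnj a * z) \<noteq> 0" using nz[of z] z by simp
    ultimately show ?thesis by (simp add: norm_divide)
  qed
qed

text \<open>
  Zeros in the open disk are collected in a Blaschke product; the remaining zero-free part has a
  square root in the disk algebra, which is shared between the two factors.
\<close>

lemma poly_balanced_factorization: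
  obtains f g \<kappa> where "f \<in> disk_algebra" "g \<in> disk_algebra" "\<kappa> \<ge> 0"
    "\<And>z. cmod z \<le> 1 \<Longrightarrow> poly h z = f z * g z"
    "\<And>z. cmod z = 1 \<Longrightarrow> cmod (f z) = \<kappa> * cmod (g z)"
proof -
  have "\<exists>f g \<kappa>. f \<in> disk_algebra \<and> g \<in> disk_algebra \<and> \<kappa> \<ge> 0 \<and>
      (\<forall>z. cmod z \<le> 1 \<longrightarrow> poly h z = f z * g z) \<and> (\<forall>z. cmod z = 1 \<longrightarrow> cmod (f z) = \<kappa> * cmod (g z))"
  proof (induction "degree h" arbitrary: h)
    case 0
    then obtain c where "h = [:c:]" by (metis degree_eq_zeroE)
    \<comment> \<open>A constant factors as itself times 1; the zero polynomial is included, with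
      ratio 0.\<close>
    then show ?case
      by (intro exI[of _ "\<lambda>_. c"] exI[of _ "\<lambda>_. 1"] exI[of _ "cmod c"]) (simp add: disk_algebra_const)
  next
    case (Suc n)
    then have "\<not> constant (poly h)" by (simp add: constant_degree)
    then obtain a where "poly h a = 0" using fundamental_theorem_of_algebra by blast
    then obtain k where k: "h = [:- a, 1:] * k" by (metis dvdE poly_eq_0_iff_dvd)
    with Suc.hyps(2) have "k \<noteq> 0" by auto
    then have "degree h = degree [:- a, 1:] + degree k"
      unfolding k by (intro degree_mult_eq) auto
    then have "n = degree k" using Suc.hyps(2) by simp
    then obtain f g \<kappa> where fg: "f \<in> disk_algebra" "g \<in> disk_algebra" "\<kappa> \<ge> 0"
      "\<And>z. cmod z \<le> 1 \<Longrightarrow> poly k z = f z * g z" "\<And>z. cmod z = 1 \<Longrightarrow> cmod (f z) = \<kappa> * cmod (g z)"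
      using Suc.hyps(1) by blast
    show ?case
    proof (cases "cmod a < 1")
      case True
      \<comment> \<open>Here z - a = b u^2. Each factor receives one \<open>u\<close>, and
        \<open>b\<close> has modulus 1 on the circle, so the ratio \<kappa> is unchanged.\<close>
      define b where "b z = (z - a) / (1 - cnj a * z)" for z
      define u where "u z = csqrt (1 - cnj a * z)" for z
      have u: "u \<in> disk_algebra" "u z * u z = 1 - cnj a * z" for z
        using disk_algebra_csqrt[of "cnj a"] True
        by (auto simp: u_def[abs_def] power2_eq_square[symmetric])
      note B = disk_algebra_Blaschke_factor[OF True, folded b_def]
      have "poly h z = (b z * u z * f z) * (u z * g z)" if "cmod z \<le> 1" for z
      proof -
        have "b z * (u z * u z) = z - a"
          unfolding u using B(2)[OF that] by (simp add: b_def)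
        moreover have "poly h z = (z - a) * (f z * g z)"
          by (simp add: k fg(4)[OF that] left_diff_distrib)
        ultimately have "poly h z = (b z * (u z * u z)) * (f z * g z)"
          by (simp only:)
        then show ?thesis by (simp only: mult_ac)
      qed
      moreover have "cmod (b z * u z * f z) = \<kappa> * cmod (u z * g z)" if "cmod z = 1" for z
        using B(3)[OF that] fg(5)[OF that] by (simp add: norm_mult)
      ultimately show ?thesis
        using u(1) B(1) fg(1-3)
        by (intro exI[of _ "\<lambda>z. b z * u z * f z"] exI[of _ "\<lambda>z. u z * g z"] exI[of _ \<kappa>])
          (simp add: disk_algebra_mult)
    next
      case False
      then have a: "a \<noteq> 0" by auto
      \<comment> \<open>A zero outside the open disk needs no Blaschke factor: z - a = - a u^2, and
        the constant \<open>- a\<close>, given to the first factor, multiplies \<kappa> by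
        |a|.\<close>
      define u where "u z = csqrt (1 - (1 / a) * z)" for z
      have u: "u \<in> disk_algebra"
        using disk_algebra_csqrt[of "1 / a"] False a by (simp add: u_def[abs_def] norm_divide)
      have uu: "u z * u z = 1 - (1 / a) * z" for z
        by (simp add: u_def flip: power2_eq_square)
      have "poly h z = (- a * u z * f z) * (u z * g z)" if "cmod z \<le> 1" for z
      proof -
        have "- a * (u z * u z) = z - a" unfolding uu using a by (simp add: field_simps)
        moreover have "poly h z = (z - a) * (f z * g z)"
          by (simp add: k fg(4)[OF that] left_diff_distrib)
        ultimately have "poly h z = (- a * (u z * u z)) * (f z * g z)"
          by (simp only:)
        then show ?thesis by (simp only: mult_ac)
      qed
      moreover have "cmod (- a * u z * f z) = (cmod a * \<kappa>) * cmod (u z * g z)" if "cmod z = 1" for z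
        using fg(5)[OF that] by (simp add: norm_mult)
      moreover have "cmod a * \<kappa> \<ge> 0" using fg(3) by simp
      ultimately show ?thesis
        using u fg(1,2)
        by (intro exI[of _ "\<lambda>z. - a * u z * f z"] exI[of _ "\<lambda>z. u z * g z"] exI[of _ "cmod a * \<kappa>"]
            conjI allI impI disk_algebra_mult disk_algebra_const)
    qed
  qed
  with that show thesis by blast
qed

section \<open>The Hardy space\<close>

lemma closed_subspace_H2: "closed_subspace H2"
proof -
  have "closed (\<Inter>n\<in>{..<0::int}. {f. cinner f (L2_of (\<lambda>\<xi>. \<xi> powi n)) = 0})"
    by (intro closed_INT ballI closed_Collect_eq continuous_intros)
  also have "(\<Inter>n\<in>{..<0::int}. {f. cinner f (L2_of (\<lambda>\<xi>. \<xi> powi n)) = 0}) = H2"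
    by (auto simp: H2_def fourier_coeff_def)
  finally have "closed H2" .
  then show ?thesis
    by (auto simp: closed_subspace_def H2_def fourier_coeff_linear) (simp add: fourier_coeff_def)
qed

lemmas H2_closed = closed_subspaceD[OF closed_subspace_H2]

lemma shift_H2: "f \<in> H2 \<Longrightarrow> shift f \<in> H2"
  using fourier_coeff_mult_powi[of 1 f] by (simp add: H2_def shift_def)

lemma shift_L2_of: "square_integrable f \<Longrightarrow> shift (L2_of f) = L2_of (\<lambda>\<xi>. \<xi> * f \<xi>)"
  by (simp add: shift_def mult_L2_of Linfty_id)

section \<open>Polynomials as symbols and as vectors\<close>

lemma Linfty_poly: "poly p \<in> Linfty"
proof (induction p)
  case 0
  then show ?case using Linfty_const[of 0] by (simp add: poly_0[abs_def])
next
  case (pCons a p)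
  then have "(\<lambda>\<xi>. a + \<xi> * poly p \<xi>) \<in> Linfty"
    by (intro Linfty_add Linfty_mult Linfty_const Linfty_id)
  then show ?case by (simp add: fun_eq_iff cong: conj_cong)
qed

lemma L2_of_poly_0: "L2_of (poly 0) = 0"
proof -
  have "poly 0 = (\<lambda>_. 0 :: complex)" by (simp add: fun_eq_iff)
  then show ?thesis by (simp only: zero_L2_eq)
qed

lemma L2_of_poly_pCons:
  "L2_of (poly (pCons a p)) = a *\<^sub>C L2_of (\<lambda>_. 1) + shift (L2_of (poly p))"
proof -
  have "poly (pCons a p) = (\<lambda>\<xi>. a * 1 + \<xi> * poly p \<xi>)" by (simp add: fun_eq_iff)
  then show ?thesis
    by (simp only: scaleC_L2_of[OF square_integrable_one] shift_L2_of square_integrable_Linfty[OF Linfty_poly])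
      (simp add: add_L2_of square_integrable_Linfty Linfty_const Linfty_mult Linfty_id Linfty_poly)
qed

section \<open>Orthogonality of the powers on the circle\<close>

lemma integral_circle:
  fixes f :: "complex \<Rightarrow> complex"
  assumes [measurable]: "f \<in> borel_measurable borel"
  shows "(\<integral>\<xi>. f \<xi> \<partial>circle) = (\<integral>t. indicator {-pi..pi} t *\<^sub>R f (cis t) \<partial>lborel) /\<^sub>R (2 * pi)"
proof -
  have eq: "uniform_measure lborel {-pi..pi} = density lborel (\<lambda>t. ennreal (indicator {-pi..pi} t / (2 * pi)))"
    unfolding uniform_measure_def
    by (intro density_cong) (auto simp: divide_ennreal[symmetric] ennreal_indicator indicator_def)
  have "(\<integral>\<xi>. f \<xi> \<partial>circle) = (\<integral>t. (indicator {-pi..pi} t / (2 * pi)) *\<^sub>R f (cis t) \<partial>lborel)"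
    unfolding circle_def eq by (subst integral_distr) (auto simp: integral_density)
  also have "\<dots> = (\<integral>t. (indicator {-pi..pi} t *\<^sub>R f (cis t)) /\<^sub>R (2 * pi) \<partial>lborel)"
    by (simp only: scaleR_scaleR divide_inverse mult.commute)
  finally show ?thesis by (simp only: integral_scaleR_right)
qed

lemma integral_circle_powi:
  assumes "n \<noteq> 0"
  shows "(\<integral>\<xi>. \<xi> powi n \<partial>circle) = 0"
proof -
  have m: "(\<lambda>\<xi>::complex. \<xi> powi n) \<in> borel_measurable borel"
    using Linfty_powi by (simp add: Linfty_def)
  let ?F = "\<lambda>t. cis (of_int n * t) / (\<i> * of_int n)"
  have "(\<integral>t. indicator {-pi..pi} t *\<^sub>R (cis t powi n) \<partial>lborel) = ?F pi - ?F (-pi)"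
  proof (rule integral_FTC_Icc)
    show "(?F has_vector_derivative cis t powi n) (at t within {-pi..pi})" for t
      unfolding cis_power_int unfolding cis_conv_exp using assms
      by (auto intro!: derivative_eq_intros has_vector_derivative_real_field simp: field_simps)
    show "continuous_on {-pi..pi} (\<lambda>t. cis t powi n)"
      by (intro continuous_intros) auto
  qed simp
  also have "\<dots> = 0"
  proof -
    have "sin (of_int n * pi) = 0" using sin_npi_int[of n] by (simp add: mult.commute)
    then have "cis (of_int n * pi) = cis (of_int n * (- pi))" by (simp add: complex_eq_iff)
    then show ?thesis by simp
  qed
  finally show ?thesis by (simp add: integral_circle[OF m])
qed

lemma fourier_coeff_one: "fourier_coeff (L2_of (\<lambda>_. 1)) n = (if n = 0 then 1 else 0)"
proof (cases "n = 0")
  case True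
  then show ?thesis using cinner_self[of "L2_of (\<lambda>_. 1)"] by (simp add: fourier_coeff_def norm_L2_of_one)
next
  case False
  have "fourier_coeff (L2_of (\<lambda>_. 1)) n = cnj (\<integral>\<xi>. \<xi> powi n \<partial>circle)"
    by (simp add: fourier_coeff_def cinner_L2_of square_integrable_one square_integrable_Linfty
        Linfty_powi flip: Bochner_Integration.integral_cnj del: complex_cnj_power_int)
  with False show ?thesis by (simp add: integral_circle_powi)
qed

lemma L2_of_one_in_H2: "L2_of (\<lambda>_. 1) \<in> H2"
  by (simp add: H2_def fourier_coeff_one)

lemma L2_of_poly_in_H2: "L2_of (poly p) \<in> H2"
proof (induction p)
  case 0
  show ?case
    unfolding L2_of_poly_0 by (rule subspace_0[OF H2_closed(2)])
next
  case (pCons a p)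
  then show ?case
    unfolding L2_of_poly_pCons by (intro H2_closed shift_H2 L2_of_one_in_H2)
qed

section \<open>Density of the polynomials in the Hardy space\<close>

lemma L2_of_poly_monom: "L2_of (poly (monom 1 n)) = L2_of (\<lambda>\<xi>. \<xi> powi int n)"
  by (simp add: poly_monom[abs_def])

lemma L2_of_poly_add: "L2_of (poly p) + L2_of (poly q) = L2_of (poly (p + q))"
  by (simp add: add_L2_of square_integrable_Linfty Linfty_poly poly_add[abs_def])

lemma L2_of_poly_scaleC: "c *\<^sub>C L2_of (poly p) = L2_of (poly (smult c p))"
  by (simp add: scaleC_L2_of square_integrable_Linfty Linfty_poly poly_smult[abs_def])

lemma closed_subspace_closure_poly: "closed_subspace (closure (range (\<lambda>p. L2_of (poly p))))"
  (is "closed_subspace (closure ?V)")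
proof -
  have "f + g \<in> closure ?V" if fg: "f \<in> closure ?V" "g \<in> closure ?V" for f g
  proof -
    obtain x y where xy: "\<And>n. x n \<in> ?V" "x \<longlonglongrightarrow> f" "\<And>n. y n \<in> ?V" "y \<longlonglongrightarrow> g"
      using fg unfolding closure_sequential by metis
    have "x n + y n \<in> ?V" for n using xy(1,3)[of n] by (auto simp: L2_of_poly_add)
    with tendsto_add[OF xy(2,4)] show ?thesis
      unfolding closure_sequential by (intro exI[of _ "\<lambda>n. x n + y n"]) auto
  qed
  moreover have "c *\<^sub>C f \<in> closure ?V" if f: "f \<in> closure ?V" for c f
  proof -
    have cont: "bounded_linear (\<lambda>f. c *\<^sub>C f)"
      by (rule bounded_linear_intro[of _ "cmod c"])
        (simp_all add: scaleC_add scaleR_scaleC norm_scaleC mult.commute)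
    obtain x where x: "\<And>n. x n \<in> ?V" "x \<longlonglongrightarrow> f"
      using f unfolding closure_sequential by metis
    have "c *\<^sub>C x n \<in> ?V" for n using x(1)[of n] by (auto simp: L2_of_poly_scaleC)
    with bounded_linear.tendsto[OF cont x(2)] show ?thesis
      unfolding closure_sequential by (intro exI[of _ "\<lambda>n. c *\<^sub>C x n"]) auto
  qed
  moreover have "0 \<in> ?V"
    by (rule image_eqI[of _ _ 0]) (simp_all add: L2_of_poly_0)
  then have "0 \<in> closure ?V" by (rule subsetD[OF closure_subset])
  ultimately show ?thesis
    by (simp add: closed_subspace_def)
qed

text \<open>The residue \<open>g\<close> of projecting onto the closure of the polynomials is
  orthogonal to all nonnegative powers, and to the negative ones because it lies in
  \<open>H2\<close>; completeness of the Fourier basis makes it zero.\<close>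

lemma H2_poly_dense:
  assumes f: "f \<in> H2" and e: "e > 0"
  obtains p where "norm (f - L2_of (poly p)) < e"
proof -
  let ?V = "range (\<lambda>p. L2_of (poly p))"
  note cs = closed_subspace_closure_poly
  have sub: "closure ?V \<subseteq> H2"
    using L2_of_poly_in_H2 H2_closed(1) by (intro closure_minimal) auto
  define g where "g = f - proj (closure ?V) f"
  have "g \<in> H2"
    unfolding g_def using f sub proj_in[OF cs] by (intro H2_closed) auto
  moreover have "fourier_coeff g (int n) = 0" for n
  proof -
    have "L2_of (poly (monom 1 n)) \<in> closure ?V"
      by (rule subsetD[OF closure_subset]) simp
    then have "cinner g (L2_of (poly (monom 1 n))) = 0"
      using cinner_proj(1)[OF cs] unfolding g_def cinner_diff_left by simp
    then show ?thesis unfolding fourier_coeff_def L2_of_poly_monom .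
  qed
  ultimately have "fourier_coeff g n = 0" for n
    by (cases n) (auto simp: H2_def)
  then have "g = 0" by (rule fourier_coeff_zero_imp_zero)
  then have "f = proj (closure ?V) f" unfolding g_def by (rule eq_iff_diff_eq_0[THEN iffD2])
  with proj_in[OF cs, of f] have "f \<in> closure ?V" by metis
  then obtain p where "dist (L2_of (poly p)) f < e"
    using e unfolding closure_approachable by blast
  with that show thesis by (simp add: dist_norm norm_minus_commute)
qed

text \<open>Conjugating the coefficients amounts to conjugating the argument and the value, and
  conjugation preserves the measure.\<close>

lemma norm_poly_cnj: "norm (L2_of (poly (map_poly cnj p))) = norm (L2_of (poly p))"
proof -
  have [measurable]: "poly p \<in> borel_measurable borel"
    using Linfty_poly by (simp add: Linfty_def)
  have "(norm (L2_of (poly (map_poly cnj p))))\<^sup>2 = (\<integral>\<xi>. (cmod (poly p (cnj \<xi>)))\<^sup>2 \<partial>circle)"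
    by (simp add: norm_L2_of square_integrable_Linfty Linfty_poly del: poly_map_poly_cnj) (simp add: poly_map_poly_cnj)
  also have "\<dots> = (\<integral>\<xi>. (cmod (poly p \<xi>))\<^sup>2 \<partial>circle)"
    by (rule integral_circle_cnj) simp
  also have "\<dots> = (norm (L2_of (poly p)))\<^sup>2"
    by (simp add: norm_L2_of square_integrable_Linfty Linfty_poly)
  finally show ?thesis by simp
qed

text \<open>Uniform approximation by polynomials on the closed disk implies approximation in the L2
  norm, and \<open>H2\<close> is closed.\<close>

lemma disk_algebra_L2:
  assumes f: "f \<in> disk_algebra"
  defines "F \<equiv> \<lambda>z. indicat_real (cball 0 1) z *\<^sub>R f z"
  shows "F \<in> Linfty" "L2_of F \<in> H2"
proof -
  have "continuous_on (cball 0 1) f" using f by (simp add: disk_algebra_def)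
  then have meas: "F \<in> borel_measurable borel"
    unfolding F_def by (intro borel_measurable_continuous_on_indicator) auto
  have "compact (f ` cball 0 1)"
    by (rule compact_continuous_image) (use \<open>continuous_on (cball 0 1) f\<close> in auto)
  then have "bounded (f ` cball 0 1)" by (rule compact_imp_bounded)
  then obtain C where "\<forall>w\<in>f ` cball 0 1. cmod w \<le> C"
    unfolding bounded_iff by (rule exE)
  then have C: "cmod (f z) \<le> C" if "cmod z \<le> 1" for z using that by auto
  have "AE \<xi> in circle. cmod (F \<xi>) \<le> C"
    using AE_circle_norm by eventually_elim (simp add: F_def C)
  then show F: "F \<in> Linfty" using meas by (intro LinftyI)
  have "L2_of F \<in> closure H2"
    unfolding closure_approachable
  proof (intro allI impI)
    fix e :: real assume e: "e > 0"
    then obtain p where p: "\<And>z. cmod z \<le> 1 \<Longrightarrow> cmod (f z - poly p z) < e / 2"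
      using disk_algebra_poly_approx[OF f, of "e / 2"] by auto
    have "norm (L2_of (\<lambda>\<xi>. F \<xi> - poly p \<xi>)) \<le> e / 2 * norm (L2_of (\<lambda>_. 1))"
    proof (rule norm_L2_of_mono)
      show "AE \<xi> in circle. cmod (F \<xi> - poly p \<xi>) \<le> e / 2 * cmod 1"
        using AE_circle_norm
        by eventually_elim (use p in \<open>auto simp: F_def less_imp_le\<close>)
    qed (use e F in \<open>simp_all add: square_integrable_diff square_integrable_Linfty Linfty_poly Linfty_const\<close>)
    then have "norm (L2_of F - L2_of (poly p)) < e"
      using e F by (simp add: norm_L2_of_one diff_L2_of square_integrable_Linfty Linfty_poly)
    then show "\<exists>g\<in>H2. dist g (L2_of F) < e"
      by (intro bexI[OF _ L2_of_poly_in_H2[of p]]) (simp add: dist_norm norm_minus_commute)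
  qed
  then show "L2_of F \<in> H2" using H2_closed(1) by (simp add: closure_closed)
qed

lemma mult_poly_pCons:
  "mult_L2 (poly (pCons a p)) f = a *\<^sub>C f + mult_L2 (poly p) (shift f)"
proof -
  obtain g where g: "square_integrable g" "f = L2_of g" by (rule L2_of_cases)
  then show ?thesis
    using square_integrable_mult[OF Linfty_id g(1)] square_integrable_mult[OF Linfty_poly[of p]]
    by (simp add: mult_L2_of Linfty_poly scaleC_L2_of shift_L2_of add_L2_of square_integrable_scale)
      (simp add: algebra_simps)
qed

lemma mult_L2_zero: "mult_L2 (\<lambda>_. 0) f = 0"
  by (simp add: mult_L2_def zero_L2_eq)

lemma mult_poly_H2: "f \<in> H2 \<Longrightarrow> mult_L2 (poly p) f \<in> H2"
proof (induction p arbitrary: f)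
  case 0
  show ?case by (simp add: mult_L2_zero subspace_0[OF H2_closed(2)])
next
  case (pCons a p)
  show ?case
    unfolding mult_poly_pCons by (intro H2_closed(3,4) pCons.IH shift_H2 pCons.prems)
qed

section \<open>Nehari's theorem\<close>

text \<open>\<open>A_shift\<close> is A S = S^* A with the adjoint written out through inner
  products. Values of \<open>A\<close> outside \<open>H2\<close> are unconstrained.\<close>

locale hankel_operator =
  fixes A :: "L2 \<Rightarrow> L2" and C :: real
  assumes A_H2: "f \<in> H2 \<Longrightarrow> A f \<in> H2"
    and A_add: "f \<in> H2 \<Longrightarrow> g \<in> H2 \<Longrightarrow> A (f + g) = A f + A g"
    and A_scaleC: "f \<in> H2 \<Longrightarrow> A (c *\<^sub>C f) = c *\<^sub>C A f"
    and A_bound: "f \<in> H2 \<Longrightarrow> norm (A f) \<le> C * norm f"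
    and A_shift: "f \<in> H2 \<Longrightarrow> h \<in> H2 \<Longrightarrow> cinner (A (shift f)) h = cinner (A f) (shift h)"
begin

lemma C_nonneg: "C \<ge> 0"
proof -
  have "0 \<le> norm (A (L2_of (\<lambda>_. 1)))" by simp
  also have "\<dots> \<le> C" using A_bound[OF L2_of_one_in_H2] by (simp add: norm_L2_of_one)
  finally show ?thesis .
qed

lemma A_diff: "f \<in> H2 \<Longrightarrow> g \<in> H2 \<Longrightarrow> A (f - g) = A f - A g"
  using A_add[of f "- g"] A_scaleC[of g "-1"] H2_closed(3)[of g "-1"] by simp

text \<open>This functional contains all of \<open>A\<close>: by the intertwining relation the n-th
  Fourier coefficient of \<open>A f\<close> is its value at z^n f.\<close>

definition B :: "L2 \<Rightarrow> complex" where
  "B f = cinner (A f) (L2_of (\<lambda>_. 1))"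

lemma B_le_norm: "f \<in> H2 \<Longrightarrow> cmod (B f) \<le> C * norm f"
  using norm_cinner_le[of "A f" "L2_of (\<lambda>_. 1)"] A_bound[of f] by (simp add: B_def norm_L2_of_one)

lemma B_diff: "f \<in> H2 \<Longrightarrow> g \<in> H2 \<Longrightarrow> B (f - g) = B f - B g"
  by (simp add: B_def A_diff cinner_diff_left)

text \<open>Powers of the shift pass through \<open>A\<close> to the other argument of the inner
  product, where conjugate linearity conjugates the coefficients.\<close>

lemma B_mult_poly:
  "f \<in> H2 \<Longrightarrow> B (mult_L2 (poly p) f) = cinner (A f) (L2_of (poly (map_poly cnj p)))"
proof (induction p arbitrary: f)
  case 0
  have "A 0 = 0" using A_scaleC[of 0 0] subspace_0[OF H2_closed(2)] by simp
  then show ?case by (simp add: mult_L2_zero B_def flip: zero_L2_eq)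
next
  case (pCons a p)
  then have "B (mult_L2 (poly (pCons a p)) f)
      = a * B f + cinner (A (shift f)) (L2_of (poly (map_poly cnj p)))"
    by (simp add: mult_poly_pCons B_def A_add A_scaleC H2_closed mult_poly_H2 shift_H2
        cinner_add_left cinner_scaleC_left del: poly_map_poly_cnj)
  also have "\<dots> = cinner (A f) (L2_of (poly (pCons (cnj a) (map_poly cnj p))))"
    unfolding L2_of_poly_pCons using pCons.prems
    by (simp add: A_shift L2_of_poly_in_H2 cinner_add_right cinner_scaleC_right B_def
        del: poly_map_poly_cnj)
  also have "pCons (cnj a) (map_poly cnj p) = map_poly cnj (pCons a p)"
    using pCons.hyps by (simp add: map_poly_pCons)
  finally show ?case .
qed

lemma B_mult_poly_le:
  assumes "f \<in> H2"
  shows "cmod (B (mult_L2 (poly p) f)) \<le> C * norm f * norm (L2_of (poly p))"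
proof -
  have "cmod (B (mult_L2 (poly p) f)) \<le> norm (A f) * norm (L2_of (poly p))"
    using norm_cinner_le[of "A f" "L2_of (poly (map_poly cnj p))"]
    unfolding B_mult_poly[OF assms] norm_poly_cnj .
  also have "\<dots> \<le> C * norm f * norm (L2_of (poly p))"
    by (intro mult_right_mono A_bound assms) auto
  finally show ?thesis .
qed

end

context hankel_operator
begin

text \<open>Extends the bilinear bound from polynomial multipliers to the disk algebra: uniform
  approximation of the multiplier controls both its norm and the norm of its product with
  \<open>f\<close>.\<close>

lemma B_mult_disk_algebra_le:
  assumes g: "g \<in> disk_algebra" and G_def: "G = (\<lambda>z. indicat_real (cball 0 1) z *\<^sub>R g z)"
    and f: "square_integrable f" "L2_of f \<in> H2" and h: "mult_L2 G (L2_of f) \<in> H2"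
  shows "cmod (B (mult_L2 G (L2_of f))) \<le> C * norm (L2_of f) * norm (L2_of G)"
proof (rule field_le_epsilon)
  fix e :: real assume e: "e > 0"
  have G: "G \<in> Linfty" using disk_algebra_L2[OF g] by (simp add: G_def)
  define K where "K = C * norm (L2_of f)"
  have K: "K \<ge> 0" using C_nonneg by (simp add: K_def)
  \<comment> \<open>The errors in the norm of the multiplier and in the product contribute
    \<open>K * d\<close> each; adding 1 keeps the denominator positive when \<open>K\<close> is
    zero.\<close>
  define d where "d = e / (2 * K + 1)"
  have d: "d > 0" "2 * K * d \<le> e"
    using e K by (simp_all add: d_def field_simps)
  obtain q where "\<And>z. cmod z \<le> 1 \<Longrightarrow> cmod (g z - poly q z) < d"
    using disk_algebra_poly_approx[OF g d(1)] by blast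
  then have q: "AE \<xi> in circle. cmod (G \<xi> - poly q \<xi>) \<le> d"
    using AE_circle_norm by (auto simp: G_def less_imp_le elim!: eventually_mono)
  have sq: "square_integrable G" "square_integrable (poly q)"
    by (simp_all add: square_integrable_Linfty G Linfty_poly)
  have "norm (L2_of (\<lambda>\<xi>. G \<xi> - poly q \<xi>)) \<le> d * norm (L2_of (\<lambda>_. 1))"
    using q d(1) by (intro norm_L2_of_mono) (auto simp: sq square_integrable_diff square_integrable_one)
  then have "norm (L2_of G - L2_of (poly q)) \<le> d"
    by (simp add: norm_L2_of_one diff_L2_of sq)
  then have norm_q: "norm (L2_of (poly q)) \<le> norm (L2_of G) + d"
    using norm_triangle_ineq2[of "L2_of (poly q)" "L2_of G"] by (simp add: norm_minus_commute)
  have "norm (L2_of (\<lambda>\<xi>. G \<xi> * f \<xi> - poly q \<xi> * f \<xi>)) \<le> d * norm (L2_of f)"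
  proof (rule norm_L2_of_mono)
    show "AE \<xi> in circle. cmod (G \<xi> * f \<xi> - poly q \<xi> * f \<xi>) \<le> d * cmod (f \<xi>)"
      using q by eventually_elim (simp add: left_diff_distrib[symmetric] norm_mult mult_right_mono)
  qed (use d f G in \<open>simp_all add: square_integrable_diff square_integrable_mult Linfty_poly\<close>)
  then have diff: "norm (mult_L2 G (L2_of f) - mult_L2 (poly q) (L2_of f)) \<le> d * norm (L2_of f)"
    using f G by (simp add: mult_L2_of Linfty_poly diff_L2_of square_integrable_mult)
  have "cmod (B (mult_L2 G (L2_of f)))
      \<le> cmod (B (mult_L2 (poly q) (L2_of f))) + cmod (B (mult_L2 G (L2_of f) - mult_L2 (poly q) (L2_of f)))"
    unfolding B_diff[OF h mult_poly_H2[OF f(2)]]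
    using norm_triangle_ineq[of "B (mult_L2 (poly q) (L2_of f))"
        "B (mult_L2 G (L2_of f)) - B (mult_L2 (poly q) (L2_of f))"] by simp
  also have "\<dots> \<le> K * (norm (L2_of G) + d) + K * d"
  proof (rule add_mono)
    have "cmod (B (mult_L2 (poly q) (L2_of f))) \<le> K * norm (L2_of (poly q))"
      using B_mult_poly_le[OF f(2)] by (simp add: K_def)
    also have "\<dots> \<le> K * (norm (L2_of G) + d)" by (rule mult_left_mono[OF norm_q K])
    finally show "cmod (B (mult_L2 (poly q) (L2_of f))) \<le> K * (norm (L2_of G) + d)" .
    have "cmod (B (mult_L2 G (L2_of f) - mult_L2 (poly q) (L2_of f)))
        \<le> C * norm (mult_L2 G (L2_of f) - mult_L2 (poly q) (L2_of f))"
      by (intro B_le_norm closed_subspaceD(5)[OF closed_subspace_H2] h mult_poly_H2 f)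
    also have "\<dots> \<le> C * (d * norm (L2_of f))" by (rule mult_left_mono[OF diff C_nonneg])
    finally show "cmod (B (mult_L2 G (L2_of f) - mult_L2 (poly q) (L2_of f))) \<le> K * d"
      by (simp add: K_def mult_ac)
  qed
  also have "\<dots> \<le> K * norm (L2_of G) + e" using d(2) by (simp add: algebra_simps)
  finally show "cmod (B (mult_L2 G (L2_of f))) \<le> C * norm (L2_of f) * norm (L2_of G) + e"
    by (simp add: K_def)
qed

text \<open>With h = F G and |F| = \<kappa> |G| on the circle, the product of the L2 norms of
  \<open>F\<close> and \<open>G\<close> is at most \<kappa> times the integral of |G| squared, which
  is the L1 norm of \<open>h\<close>.\<close>

lemma B_poly_le: "cmod (B (L2_of (poly h))) \<le> C * L1_norm (L2_of (poly h))"
proof -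
  obtain f g \<kappa> where fg: "f \<in> disk_algebra" "g \<in> disk_algebra" "\<kappa> \<ge> 0"
    "\<And>z. cmod z \<le> 1 \<Longrightarrow> poly h z = f z * g z" "\<And>z. cmod z = 1 \<Longrightarrow> cmod (f z) = \<kappa> * cmod (g z)"
    by (rule poly_balanced_factorization[of h]) blast
  define F where "F = (\<lambda>z. indicat_real (cball 0 1) z *\<^sub>R f z)"
  define G where "G = (\<lambda>z. indicat_real (cball 0 1) z *\<^sub>R g z)"
  have F: "F \<in> Linfty" "L2_of F \<in> H2" using disk_algebra_L2[OF fg(1)] by (simp_all add: F_def)
  have G: "G \<in> Linfty" using disk_algebra_L2[OF fg(2)] by (simp add: G_def)
  note sq = square_integrable_Linfty[OF F(1)] square_integrable_Linfty[OF G]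
  have FG: "AE \<xi> in circle. cmod (F \<xi>) = \<kappa> * cmod (G \<xi>)"
    using AE_circle_norm by eventually_elim (simp add: F_def G_def fg(5))
  have h: "AE \<xi> in circle. poly h \<xi> = G \<xi> * F \<xi>"
    using AE_circle_norm by eventually_elim (simp add: F_def G_def fg(4) mult.commute)
  have h_eq: "L2_of (poly h) = mult_L2 G (L2_of F)"
    using h by (simp add: mult_L2_of G sq L2_of_eq_iff square_integrable_Linfty Linfty_poly
        square_integrable_mult)
  have "norm (L2_of F) \<le> \<kappa> * norm (L2_of G)"
    using FG fg(3) sq by (intro norm_L2_of_mono) auto
  then have "norm (L2_of F) * norm (L2_of G) \<le> \<kappa> * (norm (L2_of G))\<^sup>2"
    using mult_right_mono[of "norm (L2_of F)" "\<kappa> * norm (L2_of G)" "norm (L2_of G)"]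
    by (simp add: power2_eq_square mult.assoc)
  also have "\<dots> = (\<integral>\<xi>. \<kappa> * (cmod (G \<xi>))\<^sup>2 \<partial>circle)"
    by (simp add: norm_L2_of sq)
  also have "\<dots> = (\<integral>\<xi>. cmod (poly h \<xi>) \<partial>circle)"
  proof (rule integral_cong_AE)
    show "AE \<xi> in circle. \<kappa> * (cmod (G \<xi>))\<^sup>2 = cmod (poly h \<xi>)"
      using h FG by eventually_elim (simp add: norm_mult power2_eq_square)
  qed (use G Linfty_poly[of h] in \<open>auto simp: Linfty_def\<close>)
  also have "\<dots> = L1_norm (L2_of (poly h))"
    by (simp add: L1_norm_L2_of square_integrable_Linfty Linfty_poly)
  finally have *: "norm (L2_of F) * norm (L2_of G) \<le> L1_norm (L2_of (poly h))" .
  have "cmod (B (mult_L2 G (L2_of F))) \<le> C * norm (L2_of F) * norm (L2_of G)"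
  proof (rule B_mult_disk_algebra_le[OF fg(2) G_def sq(1) F(2)])
    show "mult_L2 G (L2_of F) \<in> H2" unfolding h_eq[symmetric] by (rule L2_of_poly_in_H2)
  qed
  also have "\<dots> \<le> C * L1_norm (L2_of (poly h))"
    using mult_left_mono[OF * C_nonneg] by (simp add: mult.assoc)
  finally show ?thesis unfolding h_eq .
qed

lemma B_le_L1_norm:
  assumes f: "f \<in> H2"
  shows "cmod (B f) \<le> C * L1_norm f"
proof (rule field_le_epsilon)
  fix e :: real assume e: "e > 0"
  \<comment> \<open>One \<open>C * d\<close> comes from the L1 norm of the approximating polynomial,
    the other from \<open>B\<close> at the remainder.\<close>
  define d where "d = e / (2 * C + 1)"
  have d: "d > 0" "2 * C * d \<le> e"
    using e C_nonneg by (simp_all add: d_def field_simps)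
  obtain p where p: "norm (f - L2_of (poly p)) < d" using H2_poly_dense[OF f d(1)] .
  let ?p = "L2_of (poly p)"
  have "L1_norm ?p \<le> L1_norm f + L1_norm (?p - f)"
    using L1_norm_triangle[of f "?p - f"] by simp
  also have "L1_norm (?p - f) \<le> d"
    using L1_norm_le_norm[of "?p - f"] p by (simp add: norm_minus_commute)
  finally have 1: "C * L1_norm ?p \<le> C * (L1_norm f + d)"
    using C_nonneg by (intro mult_left_mono) auto
  have "cmod (B (f - ?p)) \<le> C * norm (f - ?p)"
    by (intro B_le_norm closed_subspaceD(5)[OF closed_subspace_H2] f L2_of_poly_in_H2)
  also have "\<dots> \<le> C * d" using p C_nonneg by (intro mult_left_mono) auto
  finally have 2: "cmod (B (f - ?p)) \<le> C * d" .
  have "cmod (B f) \<le> cmod (B ?p) + cmod (B (f - ?p))"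
    unfolding B_diff[OF f L2_of_poly_in_H2]
    using norm_triangle_ineq[of "B ?p" "B f - B ?p"] by simp
  with 1 2 B_poly_le[of p] d(2) show "cmod (B f) \<le> C * L1_norm f + e"
    by (simp add: distrib_left)
qed

text \<open>The extension of the real part is dominated by the L1 norm, hence by the L2 norm, so a
  vector \<open>w\<close> represents it. Applying the identity of real parts to i f gives the
  imaginary parts on \<open>H2\<close>; the bound by the L1 norm holds on the whole space.\<close>

lemma B_representation:
  obtains w where "\<And>f. f \<in> H2 \<Longrightarrow> B f = cinner f w" "\<And>f. inner f w \<le> C * L1_norm f"
proof -
  note M = closed_subspaceD(2)[OF closed_subspace_H2]
  obtain L where L: "linear L" "\<And>f. L f \<le> C * L1_norm f" "\<And>f. f \<in> H2 \<Longrightarrow> L f = Re (B f)"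
  proof (rule Hahn_Banach[OF _ M, of "\<lambda>f. C * L1_norm f" "\<lambda>f. Re (B f)"])
    show "sublinear (\<lambda>f. C * L1_norm f)"
      using mult_left_mono[OF L1_norm_triangle C_nonneg]
      by (simp add: sublinear_def L1_norm_scaleR distrib_left)
    show "Re (B (f + g)) = Re (B f) + Re (B g)" if "f \<in> H2" "g \<in> H2" for f g
      using that by (simp add: B_def A_add cinner_add_left)
    show "Re (B (t *\<^sub>R f)) = t * Re (B f)" if "f \<in> H2" for t f
      using that by (simp add: B_def scaleR_scaleC A_scaleC cinner_scaleC_left)
    show "Re (B f) \<le> C * L1_norm f" if "f \<in> H2" for f
      using B_le_L1_norm[OF that] complex_Re_le_cmod[of "B f"] by simp
  qed blast
  have le: "L f \<le> norm f * C" for f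
    using L(2)[of f] mult_left_mono[OF L1_norm_le_norm[of f] C_nonneg] by (simp add: mult.commute)
  have "norm (L f) \<le> norm f * C" for f
    using le[of f] le[of "- f"] linear_neg[OF L(1), of f] by (simp add: abs_le_iff)
  then have "bounded_linear L"
    using L(1) by (auto simp: bounded_linear_def bounded_linear_axioms_def)
  then obtain w where w: "\<And>f. L f = inner f w"
    using Riesz_representation by blast
  have Re: "Re (B f) = Re (cinner f w)" if "f \<in> H2" for f
    using L(3)[OF that] w[of f] by (simp add: inner_L2_def)
  have "B f = cinner f w" if f: "f \<in> H2" for f
  proof -
    have "Im (B f) = Im (cinner f w)"
      using Re[OF closed_subspaceD(3)[OF closed_subspace_H2 f, of \<i>]] f
      by (simp add: B_def A_scaleC cinner_scaleC_left)
    with Re[OF f] show ?thesis by (simp add: complex_eq_iff)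
  qed
  with L(2) that show thesis by (simp add: w)
qed

end

text \<open>Test with \<open>w\<close> restricted to the set \<open>E\<close> where its modulus
  exceeds \<open>C\<close>: the integral of |w|^2 over \<open>E\<close> is at most that of C |w|,
  although the integrand is strictly larger there. So \<open>E\<close> is a null set.\<close>

lemma bounded_if_L1_bounded:
  assumes w: "square_integrable w" and le: "\<And>f. inner f (L2_of w) \<le> C * L1_norm f"
    and C: "C \<ge> 0"
  shows "AE \<xi> in circle. cmod (w \<xi>) \<le> C"
proof -
  note [measurable] = square_integrable_measurable[OF w]
  define E where "E = {\<xi>. cmod (w \<xi>) > C}"
  have [measurable]: "E \<in> sets borel" unfolding E_def by measurable
  define f where "f \<xi> = indicat_real E \<xi> *\<^sub>R w \<xi>" for \<xi>
  have f: "square_integrable f"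
  proof (rule square_integrable_bound[OF w, where C = 1])
    show "f \<in> borel_measurable borel" unfolding f_def by measurable
  qed (simp add: f_def indicator_def)
  define a where "a \<xi> = indicat_real E \<xi> * (cmod (w \<xi>))\<^sup>2" for \<xi>
  define b where "b \<xi> = C * (indicat_real E \<xi> * cmod (w \<xi>))" for \<xi>
  have ab_eq: "f \<xi> * cnj (w \<xi>) = complex_of_real (a \<xi>)" "C * cmod (f \<xi>) = b \<xi>" for \<xi>
    unfolding f_def a_def b_def
    by (simp_all add: scaleR_conv_of_real norm_mult mult.assoc complex_norm_square[symmetric])
  have a_int: "integrable circle a"
    using integrable_mult_cnj[OF f w] unfolding ab_eq complex_of_real_integrable_eq .
  have b_int: "integrable circle b"
    using integrable_norm[OF square_integrable_imp_integrable[OF f]]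
    unfolding ab_eq[symmetric] by simp
  have "(\<integral>\<xi>. a \<xi> \<partial>circle) = inner (L2_of f) (L2_of w)"
    unfolding inner_L2_def cinner_L2_of[OF f w] ab_eq by simp
  also have "\<dots> \<le> (\<integral>\<xi>. b \<xi> \<partial>circle)"
    using le[of "L2_of f"] by (simp add: L1_norm_L2_of f ab_eq[symmetric])
  finally have "(\<integral>\<xi>. a \<xi> - b \<xi> \<partial>circle) \<le> 0"
    using a_int b_int by simp
  moreover have nonneg: "0 \<le> a \<xi> - b \<xi>" for \<xi>
    by (auto simp: a_def b_def E_def indicator_def power2_eq_square mult_right_mono)
  ultimately have "(\<integral>\<xi>. a \<xi> - b \<xi> \<partial>circle) = 0"
    by (simp add: antisym)
  then have "AE \<xi> in circle. a \<xi> - b \<xi> = 0"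
    using nonneg a_int b_int by (subst (asm) integral_nonneg_eq_0_iff_AE) auto
  then show ?thesis
  proof eventually_elim
    case (elim \<xi>)
    show ?case
    proof (rule ccontr)
      assume "\<not> cmod (w \<xi>) \<le> C"
      then have "cmod (w \<xi>) * cmod (w \<xi>) > C * cmod (w \<xi>)"
        using C by (intro mult_strict_right_mono) auto
      with elim \<open>\<not> cmod (w \<xi>) \<le> C\<close> show False
        by (simp add: a_def b_def E_def power2_eq_square)
    qed
  qed
qed

text \<open>The extra factor cnj z of the flip is responsible for the \<open>- 1\<close>:
  nonnegative and negative exponents are exchanged with none left over, so the flip maps
  \<open>H2\<close> onto its orthogonal complement.\<close>

lemma flip_powi: "flip (L2_of (\<lambda>\<xi>. \<xi> powi n)) = L2_of (\<lambda>\<xi>. \<xi> powi (- n - 1))"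
proof -
  have "AE \<xi> in circle. cnj \<xi> * cnj \<xi> powi n = \<xi> powi (- n - 1)"
    using AE_circle_norm
  proof eventually_elim
    case (elim \<xi>)
    then have "cnj \<xi> = inverse \<xi>" "\<xi> \<noteq> 0" by (auto simp: cnj_unit_circle)
    then show ?case
      by (simp add: power_int_diff power_int_minus power_int_inverse divide_inverse mult.commute)
  qed
  moreover have sq: "square_integrable (\<lambda>\<xi>. \<xi> powi n)" for n
    by (intro square_integrable_Linfty Linfty_powi)
  ultimately show ?thesis
    unfolding flip_L2_of[OF sq] by (intro L2_of_eqI square_integrable_flip[OF sq] sq)
qed

lemma H2_eqI:
  assumes "f \<in> H2" "g \<in> H2" "\<And>n. fourier_coeff f (int n) = fourier_coeff g (int n)"
  shows "f = g"
proof -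
  have "fourier_coeff (f - g) n = 0" for n
    using assms by (cases n) (auto simp: H2_def fourier_coeff_linear)
  from fourier_coeff_zero_imp_zero[OF this] show ?thesis by simp
qed

theorem (in hankel_operator) Nehari:
  obtains \<psi> where "\<psi> \<in> Linfty" "\<And>f. f \<in> H2 \<Longrightarrow> A f = proj H2 (flip (mult_L2 \<psi> f))"
proof -
  obtain W where W: "\<And>f. f \<in> H2 \<Longrightarrow> B f = cinner f W" "\<And>f. inner f W \<le> C * L1_norm f"
    using B_representation by blast
  obtain w where w: "square_integrable w" "W = L2_of w" by (rule L2_of_cases)
  then have "AE \<xi> in circle. cmod (w \<xi>) \<le> C"
    using W(2) C_nonneg by (intro bounded_if_L1_bounded) auto
  then have w_Linfty: "w \<in> Linfty"
    using square_integrable_measurable[OF w(1)] by (intro LinftyI)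
  \<comment> \<open>Forced by comparing coefficients: <A f, z^n> = <f, z^(-n) w>, while <flip(\<psi>
    f), z^n> = <f, cnj \<psi> z^(-n-1)>, so cnj \<psi> has to be z w.\<close>
  define \<psi> where "\<psi> \<xi> = cnj (\<xi> * w \<xi>)" for \<xi>
  have \<psi>: "\<psi> \<in> Linfty"
    unfolding \<psi>_def[abs_def] by (intro Linfty_cnj Linfty_mult Linfty_id w_Linfty)
  have "A f = proj H2 (flip (mult_L2 \<psi> f))" if f: "f \<in> H2" for f
  proof (rule H2_eqI)
    fix n
    let ?e = "\<lambda>n. L2_of (\<lambda>\<xi>. \<xi> powi n)"
    have e_H2: "?e (int n) \<in> H2"
      using L2_of_poly_in_H2[of "monom 1 n"] by (simp only: L2_of_poly_monom)
    have poly_eq: "poly (monom 1 n) = (\<lambda>\<xi> :: complex. \<xi> powi int n)"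
      by (rule ext) (simp only: poly_monom mult_1 power_int_of_nat)
    have "map_poly cnj (monom 1 n) = monom 1 n" by (simp add: map_poly_monom)
    then have "cinner (A f) (?e n) = B (mult_L2 (\<lambda>\<xi>. \<xi> powi int n) f)"
      using B_mult_poly[OF f, of "monom 1 n"] unfolding poly_eq by (simp only: poly_eq)
    also have "\<dots> = cinner (mult_L2 (\<lambda>\<xi>. \<xi> powi int n) f) W"
      using mult_poly_H2[OF f, of "monom 1 n"] unfolding poly_eq by (rule W(1))
    also have "\<dots> = cinner f (L2_of (\<lambda>\<xi>. cnj (\<xi> powi int n) * w \<xi>))"
      unfolding w(2) mult_L2_adjoint[OF Linfty_powi] mult_L2_of[OF Linfty_cnj[OF Linfty_powi] w(1)] ..
    also have "L2_of (\<lambda>\<xi>. cnj (\<xi> powi int n) * w \<xi>) = mult_L2 (\<lambda>\<xi>. cnj (\<psi> \<xi>)) (?e (- int n - 1))"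
      unfolding mult_L2_of[OF Linfty_cnj[OF \<psi>] square_integrable_Linfty[OF Linfty_powi]]
    proof (rule L2_of_eqI)
      show "AE \<xi> in circle. cnj (\<xi> powi int n) * w \<xi> = cnj (\<psi> \<xi>) * \<xi> powi (- int n - 1)"
        using AE_circle_norm
      proof eventually_elim
        case (elim \<xi>)
        then have nz: "\<xi> \<noteq> 0" by auto
        have 1: "cnj (\<xi> powi int n) = inverse (\<xi> ^ n)"
          using elim by (simp add: cnj_unit_circle power_inverse)
        have 2: "\<xi> powi (- int n - 1) = inverse (\<xi> ^ n) * inverse \<xi>"
          using nz by (simp add: power_int_diff power_int_minus divide_inverse)
        show ?case unfolding 1 2 \<psi>_def using nz by simp
      qed
    qed (intro square_integrable_mult square_integrable_Linfty Linfty_cnj Linfty_powi w \<psi>)+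
    also have "cinner f \<dots> = cinner (flip (mult_L2 \<psi> f)) (?e n)"
      by (simp only: mult_L2_adjoint[OF \<psi>, symmetric] flip_powi[symmetric] cinner_flip)
    also have "\<dots> = cinner (proj H2 (flip (mult_L2 \<psi> f))) (?e n)"
      by (rule cinner_proj(1)[OF closed_subspace_H2 e_H2, symmetric])
    finally show "fourier_coeff (A f) (int n) = fourier_coeff (proj H2 (flip (mult_L2 \<psi> f))) (int n)"
      by (simp only: fourier_coeff_def)
  qed (intro A_H2 f proj_in closed_subspace_H2)+
  with \<psi> that show thesis by blast
qed

section \<open>Model spaces\<close>

lemma shift_adjoint: "cinner (shift f) g = cinner f (mult_L2 cnj g)"
  unfolding shift_def mult_L2_adjoint[OF Linfty_id] ..

lemma backward_shift_eq: "backward_shift g = proj H2 (mult_L2 cnj g)"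
  unfolding backward_shift_def
  by (rule adjoint_on_equality[OF closed_subspace_H2])
    (simp_all add: proj_in closed_subspace_H2 cinner_proj shift_adjoint)

lemma Linfty_cnj_id: "cnj \<in> Linfty"
  using Linfty_cnj[OF Linfty_id] .

lemma backward_shift_H2: "backward_shift g \<in> H2"
  unfolding backward_shift_eq by (rule proj_in[OF closed_subspace_H2])

lemma cinner_backward_shift: "h \<in> H2 \<Longrightarrow> cinner (backward_shift g) h = cinner g (shift h)"
  unfolding backward_shift_eq cinner_proj(1)[OF closed_subspace_H2]
  using mult_L2_adjoint[OF Linfty_cnj_id, of g h] by (simp add: shift_def)

lemma backward_shift_diff: "backward_shift (f - g) = backward_shift f - backward_shift g"
  by (simp add: backward_shift_eq mult_L2_diff Linfty_cnj_id proj_diff closed_subspace_H2)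

lemma mult_cnj_shift: "mult_L2 cnj (shift f) = f"
proof -
  have "AE \<xi> in circle. cnj \<xi> * \<xi> = 1"
    using AE_circle_norm
    by eventually_elim (simp add: mult.commute complex_norm_square[symmetric])
  then show ?thesis
    unfolding shift_def mult_L2_mult[OF Linfty_cnj_id Linfty_id]
    by (intro mult_L2_one Linfty_mult Linfty_cnj_id Linfty_id)
qed

lemma cinner_shift_shift: "cinner (shift f) (shift g) = cinner f g"
  by (simp add: shift_adjoint mult_cnj_shift)

lemma fourier_coeff_shift: "fourier_coeff (shift f) n = fourier_coeff f (n - 1)"
  using fourier_coeff_mult_powi[of 1 f n] by (simp add: shift_def)

lemma cinner_one_shift:
  assumes "f \<in> H2"
  shows "cinner (L2_of (\<lambda>_. 1)) (shift f) = 0"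
proof -
  have "cinner (shift f) (L2_of (\<lambda>_. 1)) = 0"
    using assms fourier_coeff_shift[of f 0] by (simp add: H2_def) (simp add: fourier_coeff_def)
  then show ?thesis by (subst cinner_commute) simp
qed

text \<open>Multiplied by \<theta>, this splits \<theta> H2 into the line through \<theta> and z
  \<theta> H2, which is how the defect of the compressed shift is located.\<close>

lemma H2_decomposition:
  assumes f: "f \<in> H2"
  shows "f = fourier_coeff f 0 *\<^sub>C L2_of (\<lambda>_. 1) + shift (backward_shift f)"
proof (rule H2_eqI[OF f])
  show "fourier_coeff f 0 *\<^sub>C L2_of (\<lambda>_. 1) + shift (backward_shift f) \<in> H2"
    by (intro closed_subspaceD(3,4)[OF closed_subspace_H2] L2_of_one_in_H2 shift_H2 backward_shift_H2)
  fix n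
  have "fourier_coeff (shift (backward_shift f)) (int n) = (if n = 0 then 0 else fourier_coeff f (int n))"
  proof (cases n)
    case 0
    then show ?thesis
      using backward_shift_H2[of f] by (simp add: fourier_coeff_shift H2_def)
  next
    case (Suc k)
    let ?e = "L2_of (\<lambda>\<xi>. \<xi> powi int k)"
    have "?e \<in> H2"
      using L2_of_poly_in_H2[of "monom 1 k"] by (simp only: L2_of_poly_monom)
    then have "fourier_coeff (shift (backward_shift f)) (int n) = cinner f (shift ?e)"
      by (simp add: fourier_coeff_shift Suc) (simp add: fourier_coeff_def cinner_backward_shift)
    also have "shift ?e = L2_of (\<lambda>\<xi>. \<xi> powi int n)"
      unfolding shift_L2_of[OF square_integrable_Linfty[OF Linfty_powi]]
      by (simp only: Suc power_int_of_nat power_Suc)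
    finally show ?thesis by (simp add: Suc fourier_coeff_def)
  qed
  then show "fourier_coeff f (int n)
      = fourier_coeff (fourier_coeff f 0 *\<^sub>C L2_of (\<lambda>_. 1) + shift (backward_shift f)) (int n)"
    by (simp add: fourier_coeff_linear fourier_coeff_one)
qed

section \<open>One fixed inner function and its model space\<close>

context
  fixes \<theta> :: "complex \<Rightarrow> complex"
  assumes \<theta>: "inner_function \<theta>"
begin

lemma inner_Linfty: "\<theta> \<in> Linfty"
  using \<theta> by (intro LinftyI[of _ 1]) (auto simp: inner_function_def elim!: eventually_mono)

lemma inner_L2_of_H2: "L2_of \<theta> \<in> H2"
  using \<theta> by (simp add: inner_function_def)

lemma mult_cnj_inner: "mult_L2 (\<lambda>\<xi>. cnj (\<theta> \<xi>)) (mult_L2 \<theta> f) = f"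
  "mult_L2 \<theta> (mult_L2 (\<lambda>\<xi>. cnj (\<theta> \<xi>)) f) = f"
proof -
  have "AE \<xi> in circle. cmod (\<theta> \<xi>) = 1" using \<theta> by (simp add: inner_function_def)
  then have "AE \<xi> in circle. cnj (\<theta> \<xi>) * \<theta> \<xi> = 1" "AE \<xi> in circle. \<theta> \<xi> * cnj (\<theta> \<xi>) = 1"
    by (eventually_elim, simp add: mult.commute complex_norm_square[symmetric])+
  then show "mult_L2 (\<lambda>\<xi>. cnj (\<theta> \<xi>)) (mult_L2 \<theta> f) = f"
    "mult_L2 \<theta> (mult_L2 (\<lambda>\<xi>. cnj (\<theta> \<xi>)) f) = f"
    by (simp_all add: mult_L2_mult inner_Linfty Linfty_cnj Linfty_mult mult_L2_one)
qed

lemma cinner_mult_inner: "cinner (mult_L2 \<theta> f) (mult_L2 \<theta> g) = cinner f g"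
  by (simp add: mult_L2_adjoint inner_Linfty mult_cnj_inner)

lemma norm_mult_inner: "norm (mult_L2 \<theta> f) = norm f"
proof -
  have "complex_of_real ((norm (mult_L2 \<theta> f))\<^sup>2) = complex_of_real ((norm f)\<^sup>2)"
    unfolding cinner_self[symmetric] by (rule cinner_mult_inner)
  then show ?thesis unfolding of_real_eq_iff by simp
qed

lemma mult_inner_shift: "mult_L2 \<theta> (shift f) = shift (mult_L2 \<theta> f)"
  by (simp add: shift_def mult_L2_mult inner_Linfty Linfty_id mult.commute)

lemma mult_inner_one: "mult_L2 \<theta> (L2_of (\<lambda>_. 1)) = L2_of \<theta>"
  by (simp add: mult_L2_of inner_Linfty square_integrable_one)

text \<open>For a polynomial the product can be read as the polynomial multiplying the vector
  \<theta>, which stays in \<open>H2\<close>. Multiplication by \<theta> is isometric, so density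
  extends this to all of \<open>H2\<close>.\<close>

lemma mult_inner_H2:
  assumes "f \<in> H2"
  shows "mult_L2 \<theta> f \<in> H2"
proof -
  have poly: "mult_L2 \<theta> (L2_of (poly p)) \<in> H2" for p
  proof -
    have "mult_L2 \<theta> (L2_of (poly p)) = mult_L2 (poly p) (L2_of \<theta>)"
      by (simp add: mult_L2_of inner_Linfty Linfty_poly square_integrable_Linfty mult.commute)
    then show ?thesis using mult_poly_H2[OF inner_L2_of_H2] by simp
  qed
  have "mult_L2 \<theta> f \<in> closure H2"
    unfolding closure_approachable
  proof (intro allI impI)
    fix e :: real assume "e > 0"
    then obtain p where "norm (f - L2_of (poly p)) < e" using H2_poly_dense[OF assms] by blast
    then show "\<exists>g\<in>H2. dist g (mult_L2 \<theta> f) < e"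
      by (intro bexI[OF _ poly[of p]])
        (simp add: dist_norm mult_L2_diff[symmetric] inner_Linfty norm_mult_inner norm_minus_commute)
  qed
  then show ?thesis
    using closed_subspaceD(1)[OF closed_subspace_H2] by (simp add: closure_closed)
qed

lemma closed_subspace_mult_H2: "closed_subspace (mult_H2 \<theta>)"
proof -
  \<comment> \<open>Since \<theta> is unimodular, its range on \<open>H2\<close> is the preimage of
    \<open>H2\<close> under multiplication by the conjugate; as a preimage it is seen to be
    closed.\<close>
  have eq: "mult_H2 \<theta> = mult_L2 (\<lambda>\<xi>. cnj (\<theta> \<xi>)) -` H2"
    by (auto simp: mult_H2_def mult_cnj_inner intro!: image_eqI mult_cnj_inner(2)[symmetric])
  note lin = bounded_linear_mult_L2[OF Linfty_cnj[OF inner_Linfty]]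
  have "closed (mult_H2 \<theta>)"
    unfolding eq
    by (intro closed_vimage closed_subspaceD(1)[OF closed_subspace_H2] linear_continuous_on lin)
  moreover have "0 \<in> mult_H2 \<theta>"
    unfolding eq using linear_0[OF bounded_linear.linear[OF lin]]
    by (simp add: subspace_0[OF closed_subspaceD(2)[OF closed_subspace_H2]])
  ultimately show ?thesis
    by (auto simp: closed_subspace_def eq mult_L2_add mult_L2_scaleC Linfty_cnj inner_Linfty
        closed_subspaceD(3,4)[OF closed_subspace_H2])
qed

lemma closed_subspace_model_space: "closed_subspace (model_space \<theta>)"
proof -
  have "model_space \<theta> = H2 \<inter> (\<Inter>g\<in>mult_H2 \<theta>. {f. cinner f g = 0})"
    by (auto simp: model_space_def)
  moreover have "closed (H2 \<inter> (\<Inter>g\<in>mult_H2 \<theta>. {f. cinner f g = 0}))"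
    by (intro closed_Int closed_INT ballI closed_Collect_eq continuous_intros
        closed_subspaceD(1)[OF closed_subspace_H2])
  ultimately have "closed (model_space \<theta>)" by simp
  then show ?thesis
    by (auto simp: closed_subspace_def model_space_def cinner_add_left cinner_scaleC_left
        closed_subspaceD(3,4)[OF closed_subspace_H2] subspace_0[OF closed_subspaceD(2)[OF closed_subspace_H2]])
qed

lemmas K_closed = closed_subspaceD[OF closed_subspace_model_space]

lemma model_spaceI:
  "f \<in> H2 \<Longrightarrow> (\<And>m. m \<in> H2 \<Longrightarrow> cinner f (mult_L2 \<theta> m) = 0) \<Longrightarrow> f \<in> model_space \<theta>"
  by (auto simp: model_space_def mult_H2_def)

lemma model_spaceD:
  assumes "f \<in> model_space \<theta>"
  shows "f \<in> H2" "m \<in> H2 \<Longrightarrow> cinner f (mult_L2 \<theta> m) = 0"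
  using assms by (auto simp: model_space_def mult_H2_def)

text \<open>The shift maps \<theta> H2 into itself, so its adjoint preserves the orthogonal
  complement.\<close>

lemma backward_shift_model_space:
  assumes g: "g \<in> model_space \<theta>"
  shows "backward_shift g \<in> model_space \<theta>"
proof (rule model_spaceI[OF backward_shift_H2])
  fix m assume m: "m \<in> H2"
  then have "cinner (backward_shift g) (mult_L2 \<theta> m) = cinner g (mult_L2 \<theta> (shift m))"
    by (simp add: cinner_backward_shift mult_inner_H2 mult_inner_shift)
  also have "\<dots> = 0" using model_spaceD(2)[OF g shift_H2[OF m]] .
  finally show "cinner (backward_shift g) (mult_L2 \<theta> m) = 0" .
qed

text \<open>Because the backward shift leaves the model space invariant, the adjoint of the
  compression is just its restriction. This replaces the description by \<open>THE\<close> in all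
  later steps.\<close>

lemma adjoint_compressed_shift:
  assumes g: "g \<in> model_space \<theta>"
  shows "adjoint_on (model_space \<theta>) (compressed_shift \<theta>) g = backward_shift g"
proof (rule adjoint_on_equality[OF closed_subspace_model_space backward_shift_model_space[OF g]])
  fix f assume f: "f \<in> model_space \<theta>"
  have "cinner (compressed_shift \<theta> f) g = cinner (shift f) g"
    unfolding compressed_shift_def by (rule cinner_proj(1)[OF closed_subspace_model_space g])
  also have "\<dots> = cinner f (backward_shift g)"
    unfolding shift_adjoint backward_shift_eq
    by (rule cinner_proj(2)[OF closed_subspace_H2 model_spaceD(1)[OF f], symmetric])
  finally show "cinner (compressed_shift \<theta> f) g = cinner f (backward_shift g)" .
qed

text \<open><S^* \<theta>, \<theta> m> = <\<theta>, z \<theta> m> = <1, z m> = 0.\<close>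

lemma backward_shift_inner_model_space: "backward_shift (L2_of \<theta>) \<in> model_space \<theta>"
proof (rule model_spaceI[OF backward_shift_H2])
  fix m assume m: "m \<in> H2"
  have "cinner (backward_shift (L2_of \<theta>)) (mult_L2 \<theta> m)
      = cinner (mult_L2 \<theta> (L2_of (\<lambda>_. 1))) (mult_L2 \<theta> (shift m))"
    using m by (simp add: cinner_backward_shift mult_inner_H2 mult_inner_shift mult_inner_one)
  also have "\<dots> = 0" using cinner_one_shift[OF m] by (simp add: cinner_mult_inner)
  finally show "cinner (backward_shift (L2_of \<theta>)) (mult_L2 \<theta> m) = 0" .
qed

text \<open>The shifted vector is orthogonal to z \<theta> H2, so within \<theta> H2 it can only
  have a component along the unit vector \<theta>; removing it leaves a vector of the model
  space.\<close>

lemma proj_model_space_shift: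
  assumes h: "h \<in> model_space \<theta>"
  shows "proj (model_space \<theta>) (shift h) = shift h - cinner (shift h) (L2_of \<theta>) *\<^sub>C L2_of \<theta>"
proof (rule proj_eqI[OF closed_subspace_model_space])
  let ?c = "cinner (shift h) (L2_of \<theta>)"
  show "shift h - ?c *\<^sub>C L2_of \<theta> \<in> model_space \<theta>"
  proof (rule model_spaceI)
    show "shift h - ?c *\<^sub>C L2_of \<theta> \<in> H2"
      by (intro closed_subspaceD(3,5)[OF closed_subspace_H2] shift_H2 model_spaceD(1)[OF h] inner_L2_of_H2)
    fix m assume m: "m \<in> H2"
    define a where "a = fourier_coeff m 0"
    define k where "k = backward_shift m"
    have k: "k \<in> H2" by (simp add: k_def backward_shift_H2)
    have m_eq: "m = a *\<^sub>C L2_of (\<lambda>_. 1) + shift k"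
      unfolding a_def k_def by (rule H2_decomposition[OF m])
    have \<theta>m: "mult_L2 \<theta> m = a *\<^sub>C L2_of \<theta> + shift (mult_L2 \<theta> k)"
      unfolding m_eq by (simp add: mult_L2_add mult_L2_scaleC inner_Linfty mult_inner_one mult_inner_shift)
    have "cinner (shift h) (shift (mult_L2 \<theta> k)) = cinner h (mult_L2 \<theta> k)"
      by (rule cinner_shift_shift)
    also have "\<dots> = 0" by (rule model_spaceD(2)[OF h k])
    finally have 1: "cinner (shift h) (mult_L2 \<theta> m) = cnj a * ?c"
      by (simp add: \<theta>m cinner_add_right cinner_scaleC_right)
    have "cinner (L2_of \<theta>) (mult_L2 \<theta> m) = cinner (L2_of (\<lambda>_. 1)) m"
      using cinner_mult_inner[of "L2_of (\<lambda>_. 1)" m] by (simp add: mult_inner_one)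
    also have "\<dots> = cnj a * cinner (L2_of (\<lambda>_. 1)) (L2_of (\<lambda>_. 1))"
      by (subst m_eq) (simp add: cinner_add_right cinner_scaleC_right cinner_one_shift[OF k])
    also have "\<dots> = cnj a" by (simp add: cinner_self norm_L2_of_one)
    finally show "cinner (shift h - ?c *\<^sub>C L2_of \<theta>) (mult_L2 \<theta> m) = 0"
      by (simp add: cinner_diff_left cinner_scaleC_left 1)
  qed
  fix f assume f: "f \<in> model_space \<theta>"
  have "cinner (L2_of \<theta>) f = 0"
    using model_spaceD(2)[OF f L2_of_one_in_H2] cinner_commute[of "L2_of \<theta>" f]
    by (simp add: mult_inner_one)
  then show "cinner (shift h) f = cinner (shift h - ?c *\<^sub>C L2_of \<theta>) f"
    by (simp add: cinner_diff_left cinner_scaleC_left)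
qed

text \<open>Paired with \<open>h\<close> in the model space, the left side is <g, z h> minus <g, P z
  h>, with P the projection onto the model space. What P removes from z h is its component along
  \<theta>, and this is the source of the rank one term.\<close>

lemma model_space_commutator:
  "proj (model_space \<theta>) (mult_L2 cnj g) - backward_shift (proj (model_space \<theta>) g)
    = cinner g (L2_of \<theta>) *\<^sub>C backward_shift (L2_of \<theta>)" (is "?l = ?r")
proof (rule cinner_zero_imp_eq)
  note cs = closed_subspace_model_space
  show "?l - ?r \<in> model_space \<theta>"
    by (intro K_closed(3,5) proj_in cs backward_shift_model_space backward_shift_inner_model_space)
  fix h assume h: "h \<in> model_space \<theta>"
  note hH = model_spaceD(1)[OF h]
  have "cinner (mult_L2 cnj g) h = cinner g (shift h)"
    using mult_L2_adjoint[OF Linfty_cnj_id, of g h] by (simp add: shift_def)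
  moreover have "cinner (proj (model_space \<theta>) g) (shift h) = cinner g (proj (model_space \<theta>) (shift h))"
    by (metis cinner_proj cs proj_in)
  ultimately have "cinner ?l h = cinner g (shift h) - cinner g (proj (model_space \<theta>) (shift h))"
    by (simp add: cinner_diff_left cinner_proj cs h cinner_backward_shift hH)
  also have "\<dots> = cinner g (L2_of \<theta>) * cnj (cinner (shift h) (L2_of \<theta>))"
    by (simp add: proj_model_space_shift h cinner_diff_right cinner_scaleC_right)
  also have "\<dots> = cinner ?r h"
    using cinner_commute[of "L2_of \<theta>" "shift h"]
    by (simp add: cinner_scaleC_left cinner_backward_shift hH)
  finally show "cinner ?l h = cinner ?r h" .
qed

end

section \<open>The commutator identity and the characterization\<close>

lemma restricted_shift_mult:
  assumes "inner_function \<eta>" "f \<in> H2"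
  shows "restricted_shift \<eta> (mult_L2 \<eta> f) = mult_L2 \<eta> (shift f)"
  unfolding restricted_shift_def mult_inner_shift[OF assms(1), symmetric]
  by (intro proj_id closed_subspace_mult_H2 assms) (simp add: mult_H2_def shift_H2 assms)

text \<open>The flip turns multiplication by z into multiplication by cnj z, which reduces the claim
  to \<open>model_space_commutator\<close> at the flip of \<psi> \<eta> f. Moving the flip and the
  symbol onto \<theta> produces the second vector of the rank one operator; projecting it to
  \<open>H2\<close> changes nothing when paired with \<open>f\<close>.\<close>

lemma restricted_hankel_commutator:
  assumes \<eta>: "inner_function \<eta>" and \<theta>: "inner_function \<theta>" and \<psi>: "\<psi> \<in> Linfty" and f: "f \<in> H2"
  shows "restricted_hankel \<theta> \<psi> (mult_L2 \<eta> (shift f)) - backward_shift (restricted_hankel \<theta> \<psi> (mult_L2 \<eta> f))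
    = rank_one (backward_shift (L2_of \<theta>))
        (proj H2 (L2_of (\<lambda>\<xi>. reflect \<theta> \<xi> * cnj (\<xi> * \<eta> \<xi> * \<psi> \<xi>)))) f"
proof -
  note L = \<psi> inner_Linfty[OF \<eta>] inner_Linfty[OF \<theta>]
  let ?g = "flip (mult_L2 \<psi> (mult_L2 \<eta> f))"
  let ?w = "\<lambda>\<xi>. reflect \<theta> \<xi> * cnj (\<xi> * \<eta> \<xi> * \<psi> \<xi>)"
  have "mult_L2 \<psi> (mult_L2 \<eta> (shift f)) = mult_L2 (\<lambda>\<xi>. \<xi>) (mult_L2 \<psi> (mult_L2 \<eta> f))"
    by (simp add: shift_def mult_L2_mult L Linfty_id Linfty_mult mult_ac)
  then have 1: "flip (mult_L2 \<psi> (mult_L2 \<eta> (shift f))) = mult_L2 cnj ?g"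
    using flip_mult[OF Linfty_id, of "mult_L2 \<psi> (mult_L2 \<eta> f)"] by (simp add: reflect_def[abs_def])
  have "cinner ?g (L2_of \<theta>) = cinner (mult_L2 (\<lambda>\<xi>. \<psi> \<xi> * \<eta> \<xi>) f) (flip (L2_of \<theta>))"
    by (simp add: cinner_flip mult_L2_mult L)
  also have "\<dots> = cinner f (mult_L2 (\<lambda>\<xi>. cnj (\<psi> \<xi> * \<eta> \<xi>)) (flip (L2_of \<theta>)))"
    by (intro mult_L2_adjoint Linfty_mult L)
  also have "mult_L2 (\<lambda>\<xi>. cnj (\<psi> \<xi> * \<eta> \<xi>)) (flip (L2_of \<theta>)) = L2_of ?w"
  proof -
    have "square_integrable (\<lambda>\<xi>. cnj \<xi> * \<theta> (cnj \<xi>))"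
      by (intro square_integrable_flip square_integrable_Linfty L)
    from mult_L2_of[OF Linfty_cnj[OF Linfty_mult[OF L(1,2)]] this] show ?thesis
      by (simp add: flip_L2_of square_integrable_Linfty L reflect_def mult_ac)
  qed
  also have "cinner f (L2_of ?w) = cinner f (proj H2 (L2_of ?w))"
    by (rule cinner_proj(2)[OF closed_subspace_H2 f, symmetric])
  finally show ?thesis
    using model_space_commutator[OF \<theta>, of ?g] by (simp add: restricted_hankel_def rank_one_def 1)
qed

lemma bounded_linear_restricted_hankel:
  assumes "inner_function \<theta>" "\<psi> \<in> Linfty"
  shows "bounded_linear (restricted_hankel \<theta> \<psi>)"
  unfolding restricted_hankel_def[abs_def]
  by (intro bounded_linear_compose[OF bounded_linear_proj] bounded_linear_compose[OF bounded_linear_flip]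
      bounded_linear_mult_L2 closed_subspace_model_space assms)

theorem theorem1p3:
  fixes \<eta> \<theta> :: "complex \<Rightarrow> complex" and X :: "L2 \<Rightarrow> L2"
  assumes "inner_function \<eta>" and "inner_function \<theta>"
    and "bounded_operator (mult_H2 \<eta>) (model_space \<theta>) X"
  shows "is_restricted_hankel \<eta> \<theta> X \<longleftrightarrow>
    (\<exists>\<phi>\<in>Linfty. \<forall>f\<in>H2.
       X (restricted_shift \<eta> (mult_L2 \<eta> f))
         - adjoint_on (model_space \<theta>) (compressed_shift \<theta>) (X (mult_L2 \<eta> f))
       = rank_one (backward_shift (L2_of \<theta>))
           (proj H2 (L2_of (\<lambda>\<xi>. reflect \<theta> \<xi> * cnj (\<xi> * \<eta> \<xi> * \<phi> \<xi>)))) f)"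
    (is "_ \<longleftrightarrow> (\<exists>\<phi>\<in>Linfty. \<forall>f\<in>H2. ?L f = ?R \<phi> f)")
proof -
  note \<eta> = assms(1) and \<theta> = assms(2)
  note cs = closed_subspace_model_space[OF \<theta>]
  have in_M: "mult_L2 \<eta> f \<in> mult_H2 \<eta>" if "f \<in> H2" for f
    using that by (simp add: mult_H2_def)
  have X_in: "X (mult_L2 \<eta> f) \<in> model_space \<theta>" if "f \<in> H2" for f
    using assms(3) in_M[OF that] by (simp add: bounded_operator_def)
  have L_eq: "?L f = X (mult_L2 \<eta> (shift f)) - backward_shift (X (mult_L2 \<eta> f))" if "f \<in> H2" for f
    using that by (simp add: restricted_shift_mult \<eta> adjoint_compressed_shift \<theta> X_in)
  show ?thesis
  proof
    assume "is_restricted_hankel \<eta> \<theta> X"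
    then obtain \<psi> where \<psi>: "\<psi> \<in> Linfty" "\<And>h. h \<in> mult_H2 \<eta> \<Longrightarrow> X h = restricted_hankel \<theta> \<psi> h"
      by (auto simp: is_restricted_hankel_def)
    have "?L f = ?R \<psi> f" if f: "f \<in> H2" for f
      unfolding L_eq[OF f] unfolding \<psi>(2)[OF in_M[OF f]] \<psi>(2)[OF in_M[OF shift_H2[OF f]]]
      by (rule restricted_hankel_commutator[OF \<eta> \<theta> \<psi>(1) f])
    with \<psi>(1) show "\<exists>\<phi>\<in>Linfty. \<forall>f\<in>H2. ?L f = ?R \<phi> f" by blast
  next
    assume "\<exists>\<phi>\<in>Linfty. \<forall>f\<in>H2. ?L f = ?R \<phi> f"
    then obtain \<phi> where \<phi>: "\<phi> \<in> Linfty" "\<And>f. f \<in> H2 \<Longrightarrow> ?L f = ?R \<phi> f" by blast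
    define H where "H = restricted_hankel \<theta> \<phi>"
    \<comment> \<open>Both operators have the same rank one commutator, that of \<phi>, so it
      cancels in the difference. Multiplication by \<eta> transports the domain isometrically to
      \<open>H2\<close>.\<close>
    define A where "A f = X (mult_L2 \<eta> f) - H (mult_L2 \<eta> f)" for f
    have H_lin: "bounded_linear H"
      unfolding H_def by (rule bounded_linear_restricted_hankel[OF \<theta> \<phi>(1)])
    have H_scaleC: "H (c *\<^sub>C f) = c *\<^sub>C H f" for c f
      by (simp add: H_def restricted_hankel_def mult_L2_scaleC \<phi>(1) flip_scaleC proj_scaleC cs)
    have H_in: "H f \<in> model_space \<theta>" for f
      unfolding H_def restricted_hankel_def by (rule proj_in[OF cs])
    have A_in: "A f \<in> model_space \<theta>" if "f \<in> H2" for f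
      unfolding A_def by (intro closed_subspaceD(5)[OF cs] X_in H_in that)
    obtain a where a: "\<And>f. f \<in> mult_H2 \<eta> \<Longrightarrow> norm (X f) \<le> a * norm f"
      using assms(3) unfolding bounded_operator_def by blast
    obtain b where b: "\<And>f. norm (H f) \<le> norm f * b"
      using bounded_linear.bounded[OF H_lin] by blast
    interpret hankel_operator A "a + b"
    proof
      fix f assume f: "f \<in> H2"
      show "A f \<in> H2" by (rule model_spaceD(1)[OF \<theta> A_in[OF f]])
      show "norm (A f) \<le> (a + b) * norm f"
        using norm_triangle_ineq4[of "X (mult_L2 \<eta> f)" "H (mult_L2 \<eta> f)"]
          a[OF in_M[OF f]] b[of "mult_L2 \<eta> f"]
        by (simp add: A_def norm_mult_inner \<eta> algebra_simps)
      show "A (c *\<^sub>C f) = c *\<^sub>C A f" for c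
        using assms(3) in_M[OF f]
        by (simp add: A_def mult_L2_scaleC inner_Linfty \<eta> H_scaleC scaleC_diff bounded_operator_def)
      show "A (f + g) = A f + A g" if "g \<in> H2" for g
        using assms(3) in_M[OF f] in_M[OF that] linear_add[OF bounded_linear.linear[OF H_lin]]
        by (simp add: A_def mult_L2_add inner_Linfty \<eta> bounded_operator_def)
      \<comment> \<open>The commutator of X from the hypothesis and that of \<open>H\<close> from
        the first direction have equal right-hand sides.\<close>
      have "A (shift f) = backward_shift (A f)"
        using \<phi>(2)[OF f] restricted_hankel_commutator[OF \<eta> \<theta> \<phi>(1) f]
        unfolding L_eq[OF f] A_def H_def backward_shift_diff by (simp add: algebra_simps)
      then show "cinner (A (shift f)) h = cinner (A f) (shift h)" if "h \<in> H2" for h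
        using that by (simp add: cinner_backward_shift)
    qed
    obtain \<psi> where \<psi>: "\<psi> \<in> Linfty" "\<And>f. f \<in> H2 \<Longrightarrow> A f = proj H2 (flip (mult_L2 \<psi> f))"
      by (rule Nehari) blast
    \<comment> \<open>The factor \<open>cnj (\<eta> \<xi>)\<close> undoes the \<eta> in
      \<open>h\<close>, so that \<psi> acts on \<open>f\<close> itself.\<close>
    let ?\<psi> = "\<lambda>\<xi>. \<phi> \<xi> + \<psi> \<xi> * cnj (\<eta> \<xi>)"
    note \<psi>\<eta> = Linfty_mult[OF \<psi>(1) Linfty_cnj[OF inner_Linfty[OF \<eta>]]]
    have "X h = restricted_hankel \<theta> ?\<psi> h" if h: "h \<in> mult_H2 \<eta>" for h
    proof -
      obtain f where f: "f \<in> H2" "h = mult_L2 \<eta> f" using h by (auto simp: mult_H2_def)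
      have "mult_L2 (\<lambda>\<xi>. \<psi> \<xi> * cnj (\<eta> \<xi>)) h = mult_L2 \<psi> f"
        unfolding f(2) mult_L2_mult[OF \<psi>(1) Linfty_cnj[OF inner_Linfty[OF \<eta>]], symmetric]
        by (simp add: mult_cnj_inner \<eta>)
      then have "mult_L2 ?\<psi> h = mult_L2 \<phi> h + mult_L2 \<psi> f"
        using mult_L2_plus[OF \<phi>(1) \<psi>\<eta>, of h] by simp
      then have "restricted_hankel \<theta> ?\<psi> h = H h + proj (model_space \<theta>) (flip (mult_L2 \<psi> f))"
        by (simp add: restricted_hankel_def H_def flip_add proj_add cs)
      \<comment> \<open>Nehari's theorem gives the projection to the larger space \<open>H2\<close>.
        As \<open>A f\<close> already lies in the model space and the test vectors lie in
        \<open>H2\<close>, both projections agree here.\<close>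
      also have "proj (model_space \<theta>) (flip (mult_L2 \<psi> f)) = A f"
      proof (rule proj_eqI[OF cs A_in[OF f(1)]])
        fix k assume k: "k \<in> model_space \<theta>"
        show "cinner (flip (mult_L2 \<psi> f)) k = cinner (A f) k"
          unfolding \<psi>(2)[OF f(1)]
          by (rule cinner_proj(1)[OF closed_subspace_H2 model_spaceD(1)[OF \<theta> k], symmetric])
      qed
      finally show ?thesis by (simp add: A_def f(2))
    qed
    moreover have "?\<psi> \<in> Linfty" by (rule Linfty_add[OF \<phi>(1) \<psi>\<eta>])
    ultimately show "is_restricted_hankel \<eta> \<theta> X"
      unfolding is_restricted_hankel_def by blast
  qed
qed

end
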